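(* Suppose $x$ and $X$ both have i.i.d. $N(0,1)$ entries, and that not both $\pi=1$ and $\sigma=0$. Given $W$, $XW^\top$ and $Y$, define $$\beta_{opt}=\operatorname{argmin}_{\beta\in\mathbb{R}^p}\ \mathbb{E}_{p(\theta\mid XW^\top,W,Y)}\,\mathbb{E}_{x,\varepsilon}\left[(Wx)^\top\beta-(x^\top\theta+\varepsilon)\right]^2,$$ where $p(\theta\mid XW^\top,W,Y)$ is the posterior distribution of $\theta$ and $x\sim N(0,I_d)$, $\varepsilon\sim N(0,\sigma^2)$ are independent. Then $$\beta_{opt}=W\cdot\mathbb{E}_{p(\theta\mid XW^\top,W,Y)}\theta .$$ Moreover, the optimal ridge estimator $$\hat\beta=\left(\tfrac1nWX^\top XW^\top+\lambda^*I_p\right)^{-1}\tfrac1nWX^\top Y,\qquad \lambda^*=\delta(1-\pi+\sigma^2/\alpha^2),$$ satisfies $$\lim_{d\to\infty}\mathbb{E}_{XW^\top,W,Y}\|\hat\beta-\beta_{opt}\|_2^2=0,$$ and is thus asymptotically optimal.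
   Context: Setting. $\alpha>0$, $\sigma\ge0$ fixed. For each $d$, $p=p_d\le d$, $n=n_d$, with $p/d\to\pi\in(0,1]$ and $d/n\to\delta\in(0,\infty)$ as $d\to\infty$. $X\in\mathbb{R}^{n\times d}$ is the data matrix; $\theta\sim N(0,\alpha^2I_d/d)$; $\mathcal{E}\sim N(0,\sigma^2I_n)$; $Y=X\theta+\mathcal{E}$; $W$ is a $p\times d$ random matrix uniformly distributed on $\{W:WW^\top=I_p\}$; $X,\theta,\mathcal{E},W$ and the test data $x,\varepsilon$ are independent. *)

theory Defs
  imports
    "HOL-Probability.Probability"
    "Jordan_Normal_Form.Gauss_Jordan_Elimination"
begin

unbundle no vec_syntax and no inner_syntax

text \<open>
  Matrices and vectors whose size varies with an index are the ones of \<^theory>\<open>Jordan_Normal_Form.Matrix\<close>.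
  Their Borel structure is pulled back along the coordinates.
\<close>

definition borel_mat :: "nat \<Rightarrow> nat \<Rightarrow> real mat measure" where
  "borel_mat m k = vimage_algebra (carrier_mat m k)
     (\<lambda>A. \<lambda>ij\<in>{..<m} \<times> {..<k}. A $$ ij) (\<Pi>\<^sub>M ij\<in>{..<m} \<times> {..<k}. borel)"

definition borel_vec :: "nat \<Rightarrow> real vec measure" where
  "borel_vec m = vimage_algebra (carrier_vec m)
     (\<lambda>v. \<lambda>i\<in>{..<m}. v $ i) (\<Pi>\<^sub>M i\<in>{..<m}. borel)"

text \<open>
  The argument \<open>s\<close> of the Gaussian laws is the standard deviation; for \<open>s = 0\<close>, where
  \<^const>\<open>normal_density\<close> is identically zero, the law is the point mass at the origin.
\<close>

definition gauss :: "real \<Rightarrow> real measure" where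
  "gauss s = (if s = 0 then return borel 0 else density lborel (normal_density 0 s))"

definition gauss_vec :: "real \<Rightarrow> nat \<Rightarrow> real vec measure" where
  "gauss_vec s m = distr (\<Pi>\<^sub>M i\<in>{..<m}. gauss s) (borel_vec m) (Matrix.vec m)"

definition gauss_mat :: "real \<Rightarrow> nat \<Rightarrow> nat \<Rightarrow> real mat measure" where
  "gauss_mat s m k = distr (\<Pi>\<^sub>M ij\<in>{..<m} \<times> {..<k}. gauss s) (borel_mat m k) (Matrix.mat m k)"

text \<open>
  The uniform distribution on \<open>{w. w w\<^sup>T = I\<^sub>k}\<close>: the orthogonal group of order \<open>m\<close>
  acts transitively on this set by right multiplication, so its invariant probability
  measure is unique.
\<close>

definition uniform_stiefel :: "nat \<Rightarrow> nat \<Rightarrow> real mat measure \<Rightarrow> bool" where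
  "uniform_stiefel k m \<mu> \<longleftrightarrow>
     prob_space \<mu> \<and> sets \<mu> = sets (borel_mat k m) \<and>
     (AE w in \<mu>. w * w\<^sup>T = 1\<^sub>m k) \<and>
     (\<forall>Q\<in>carrier_mat m m. Q * Q\<^sup>T = 1\<^sub>m m \<longrightarrow> distr \<mu> (borel_mat k m) (\<lambda>w. w * Q) = \<mu>)"

text \<open>
  \<open>\<kappa>\<close> is a posterior distribution (regular conditional distribution) of the parameter
  \<open>T\<close> with values in \<open>N\<close>, given the data \<open>Z\<close> with values in \<open>S\<close>.  It is determined
  up to a null set of data.
\<close>

definition posterior_dist ::
  "'w measure \<Rightarrow> 'z measure \<Rightarrow> ('w \<Rightarrow> 'z) \<Rightarrow> 't measure \<Rightarrow> ('w \<Rightarrow> 't) \<Rightarrow> ('z \<Rightarrow> 't measure) \<Rightarrow> bool" where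
  "posterior_dist M S Z N T \<kappa> \<longleftrightarrow>
     \<kappa> \<in> S \<rightarrow>\<^sub>M prob_algebra N \<and>
     (\<forall>A\<in>sets S. \<forall>B\<in>sets N.
        emeasure M {\<omega> \<in> space M. Z \<omega> \<in> A \<and> T \<omega> \<in> B} = (\<integral>\<^sup>+z\<in>A. emeasure (\<kappa> z) B \<partial>distr M S Z))"

definition posterior_mean :: "nat \<Rightarrow> real vec measure \<Rightarrow> real vec" where
  "posterior_mean m Q = Matrix.vec m (\<lambda>i. \<integral>t. t $ i \<partial>Q)"

definition sq_norm :: "real vec \<Rightarrow> real" where
  "sq_norm v = v \<bullet> v"

definition test_risk :: "real \<Rightarrow> nat \<Rightarrow> real mat \<Rightarrow> real vec \<Rightarrow> real vec \<Rightarrow> real" where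
  "test_risk \<sigma> m w t b =
     (\<integral>(x, e). ((w *\<^sub>v x) \<bullet> b - (x \<bullet> t + e))\<^sup>2 \<partial>(gauss_vec 1 m \<Otimes>\<^sub>M gauss \<sigma>))"

definition posterior_risk :: "real \<Rightarrow> nat \<Rightarrow> real mat \<Rightarrow> real vec measure \<Rightarrow> real vec \<Rightarrow> real" where
  "posterior_risk \<sigma> m w Q b = (\<integral>t. test_risk \<sigma> m w t b \<partial>Q)"

definition beta_opt :: "real \<Rightarrow> nat \<Rightarrow> nat \<Rightarrow> real mat \<Rightarrow> real vec measure \<Rightarrow> real vec" where
  "beta_opt \<sigma> m k w Q = arg_min (posterior_risk \<sigma> m w Q) (\<lambda>b. b \<in> carrier_vec k)"

definition ridge :: "real \<Rightarrow> nat \<Rightarrow> nat \<Rightarrow> real mat \<Rightarrow> real mat \<Rightarrow> real vec \<Rightarrow> real vec" where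
  "ridge l m k X w Y =
     the (mat_inverse ((1 / real m) \<cdot>\<^sub>m (w * X\<^sup>T * X * w\<^sup>T) + l \<cdot>\<^sub>m 1\<^sub>m k))
       *\<^sub>v ((1 / real m) \<cdot>\<^sub>v (w * X\<^sup>T *\<^sub>v Y))"

end

theory Submission
  imports Defs "Jordan_Normal_Form.Determinant"
begin

text \<open>
  Put \<open>Z = X W\<^sup>T\<close>, \<open>\<eta> = W \<theta>\<close> and \<open>q = |\<theta>|\<^sup>2 - |W \<theta>|\<^sup>2\<close>.  The part of \<open>\<theta>\<close> orthogonal to the rows of \<open>W\<close>
  enters the data only as additional Gaussian noise, so given \<open>W\<close> and \<open>q\<close> the model is the linear
  model \<open>Y = Z \<eta> + s \<xi>\<close> with \<open>s\<^sup>2 = q + \<sigma>\<^sup>2\<close>.  With \<open>q\<close> known, the posterior mean of \<open>\<eta>\<close> is therefore the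
  ridge estimator \<open>C\<close> with parameter \<open>\<mu> = d (q + \<sigma>\<^sup>2) / (n \<alpha>\<^sup>2)\<close>.  Reflecting \<open>\<eta>\<close> in \<open>C\<close> preserves the joint law,
  which yields \<open>E |g - \<eta>|\<^sup>2 = E |g - C|\<^sup>2 + E |C - \<eta>|\<^sup>2\<close> for every function \<open>g\<close> of the data; the true
  posterior mean \<open>\<beta>opt\<close> of \<open>\<eta>\<close> satisfies the same identity in place of \<open>C\<close>, whence
  \<open>E |g - \<beta>opt|\<^sup>2 \<le> E |g - C|\<^sup>2\<close>.  For the ridge estimator \<open>g\<close> with parameter \<open>\<lambda>\<close> one has
  \<open>|g - C| \<le> |\<mu> - \<lambda>| |C| / \<lambda>\<close>, and \<open>q\<close> concentrates at \<open>\<alpha>\<^sup>2 (1 - p/d)\<close>, so that \<open>\<mu>\<close> tends to \<open>\<lambda>\<^sup>*\<close> in mean square.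
\<close>

section \<open>Measurability of matrix operations\<close>

text \<open>Given the data, the law of \<open>W \<theta>\<close> is in general a mixture over the
  unknown \<open>q\<close> without closed form, so \<open>\<beta>opt\<close> is never computed.
  \<open>C\<close> is explicit but not a function of the data. Its error is nevertheless orthogonal
  to functions of the data, and the comparison uses only this: taking \<open>\<beta>opt\<close> for
  \<open>g\<close> in the identity for \<open>C\<close> gives E |C - \<eta>|^2 \<le> E |\<beta>opt -
  \<eta>|^2, and subtracting the two decompositions of a general \<open>g\<close> leaves the
  inequality.

  Reflection takes the place of conditional Gaussian laws. It is an equality of joint laws, checked
  by comparing the variances of all linear forms through characteristic functions; this also covers
  noise of variance 0, where densities do not exist.

  In the perturbation bound both \<open>\<mu>\<close> and |C| depend on \<open>q\<close>. The
  reflection yields a Jensen inequality that replaces |C| by |\<eta>| under any weight in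
  \<open>q\<close>, and \<eta> is independent of \<open>q\<close>. The bound then factors into E
  |\<eta>|^2 = p \<alpha>^2 / d and the mean square of (\<mu> - \<lambda>) / \<lambda>.\<close>

lemma space_borel_mat [simp]: "space (borel_mat m k) = carrier_mat m k"
  by (simp add: borel_mat_def)

lemma space_borel_vec [simp]: "space (borel_vec m) = carrier_vec m"
  by (simp add: borel_vec_def)

lemma measurable_borel_matI:
  assumes "\<And>x. x \<in> space M \<Longrightarrow> f x \<in> carrier_mat m k"
    and "\<And>i j. i < m \<Longrightarrow> j < k \<Longrightarrow> (\<lambda>x. f x $$ (i, j)) \<in> borel_measurable M"
  shows "f \<in> M \<rightarrow>\<^sub>M borel_mat m k"
  unfolding borel_mat_def
proof (rule measurable_vimage_algebra2)
  show "f \<in> space M \<rightarrow> carrier_mat m k" using assms(1) by auto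
  show "(\<lambda>x. \<lambda>ij\<in>{..<m} \<times> {..<k}. f x $$ ij) \<in> M \<rightarrow>\<^sub>M (\<Pi>\<^sub>M ij\<in>{..<m} \<times> {..<k}. borel)"
    using assms(2) by (intro measurable_restrict) auto
qed

lemma measurable_borel_vecI:
  assumes "\<And>x. x \<in> space M \<Longrightarrow> f x \<in> carrier_vec m"
    and "\<And>i. i < m \<Longrightarrow> (\<lambda>x. f x $ i) \<in> borel_measurable M"
  shows "f \<in> M \<rightarrow>\<^sub>M borel_vec m"
  unfolding borel_vec_def
proof (rule measurable_vimage_algebra2)
  show "f \<in> space M \<rightarrow> carrier_vec m" using assms(1) by auto
  show "(\<lambda>x. \<lambda>i\<in>{..<m}. f x $ i) \<in> M \<rightarrow>\<^sub>M (\<Pi>\<^sub>M i\<in>{..<m}. borel)"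
    using assms(2) by (intro measurable_restrict) auto
qed

lemma measurable_mat_entry:
  assumes "f \<in> M \<rightarrow>\<^sub>M borel_mat m k" "i < m" "j < k"
  shows "(\<lambda>x. f x $$ (i, j)) \<in> borel_measurable M"
proof -
  have "(\<lambda>A::real mat. \<lambda>ij\<in>{..<m} \<times> {..<k}. A $$ ij) \<in> borel_mat m k \<rightarrow>\<^sub>M (\<Pi>\<^sub>M ij\<in>{..<m} \<times> {..<k}. borel)"
    unfolding borel_mat_def by (rule measurable_vimage_algebra1) (auto simp: space_PiM)
  from measurable_compose[OF assms(1) measurable_compose[OF this measurable_component_singleton[of "(i, j)"]]]
  show ?thesis using assms by simp
qed

lemma measurable_vec_entry:
  assumes "f \<in> M \<rightarrow>\<^sub>M borel_vec m" "i < m"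
  shows "(\<lambda>x. f x $ i) \<in> borel_measurable M"
proof -
  have "(\<lambda>v::real vec. \<lambda>i\<in>{..<m}. v $ i) \<in> borel_vec m \<rightarrow>\<^sub>M (\<Pi>\<^sub>M i\<in>{..<m}. borel)"
    unfolding borel_vec_def by (rule measurable_vimage_algebra1) (auto simp: space_PiM)
  from measurable_compose[OF assms(1) measurable_compose[OF this measurable_component_singleton[of i]]]
  show ?thesis using assms by simp
qed

lemma measurable_carrier_mat:
  "f \<in> M \<rightarrow>\<^sub>M borel_mat m k \<Longrightarrow> x \<in> space M \<Longrightarrow> f x \<in> carrier_mat m k"
  using measurable_space[of f M "borel_mat m k" x] by simp

lemma measurable_carrier_vec:
  "f \<in> M \<rightarrow>\<^sub>M borel_vec m \<Longrightarrow> x \<in> space M \<Longrightarrow> f x \<in> carrier_vec m"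
  using measurable_space[of f M "borel_vec m" x] by simp

lemma measurable_dim_mat:
  assumes "f \<in> M \<rightarrow>\<^sub>M borel_mat m k" "x \<in> space M"
  shows "dim_row (f x) = m" "dim_col (f x) = k"
  using measurable_carrier_mat[OF assms] by auto

lemma measurable_dim_vec:
  assumes "f \<in> M \<rightarrow>\<^sub>M borel_vec m" "x \<in> space M"
  shows "dim_vec (f x) = m"
  using measurable_carrier_vec[OF assms] by auto

lemma measurable_scalar_prod [measurable (raw)]:
  assumes f: "f \<in> M \<rightarrow>\<^sub>M borel_vec m" and g: "g \<in> M \<rightarrow>\<^sub>M borel_vec m"
  shows "(\<lambda>x. f x \<bullet> g x) \<in> borel_measurable M"
proof -
  have "(\<lambda>x. \<Sum>i<m. f x $ i * g x $ i) \<in> borel_measurable M"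
    using f g by (intro borel_measurable_sum borel_measurable_times measurable_vec_entry) auto
  then show ?thesis
    by (rule measurable_cong[THEN iffD1, rotated])
      (use measurable_dim_vec[OF g] in \<open>auto simp: scalar_prod_def atLeast0LessThan\<close>)
qed

lemma measurable_sq_norm [measurable (raw)]:
  "f \<in> M \<rightarrow>\<^sub>M borel_vec m \<Longrightarrow> (\<lambda>x. sq_norm (f x)) \<in> borel_measurable M"
  unfolding sq_norm_def by (rule measurable_scalar_prod)

lemma measurable_mat_row:
  assumes f: "f \<in> M \<rightarrow>\<^sub>M borel_mat m k" and "i < m"
  shows "(\<lambda>x. Matrix.row (f x) i) \<in> M \<rightarrow>\<^sub>M borel_vec k"
proof (rule measurable_borel_vecI)
  fix j assume "j < k"
  then show "(\<lambda>x. Matrix.row (f x) i $ j) \<in> borel_measurable M"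
    using measurable_mat_entry[OF f \<open>i < m\<close> \<open>j < k\<close>] measurable_dim_mat[OF f] assms(2)
    by (subst measurable_cong[where g = "\<lambda>x. f x $$ (i, j)"]) auto
qed (use measurable_carrier_mat[OF f] assms(2) in \<open>auto intro!: row_carrier_vec\<close>)

lemma measurable_mult_mat_vec [measurable (raw)]:
  assumes f: "f \<in> M \<rightarrow>\<^sub>M borel_mat m k" and g: "g \<in> M \<rightarrow>\<^sub>M borel_vec k"
  shows "(\<lambda>x. f x *\<^sub>v g x) \<in> M \<rightarrow>\<^sub>M borel_vec m"
proof (rule measurable_borel_vecI)
  fix i assume "i < m"
  then show "(\<lambda>x. (f x *\<^sub>v g x) $ i) \<in> borel_measurable M"
    using measurable_scalar_prod[OF measurable_mat_row[OF f \<open>i < m\<close>] g] measurable_dim_mat[OF f]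
    by (subst measurable_cong[where g = "\<lambda>x. Matrix.row (f x) i \<bullet> g x"]) auto
qed (use measurable_carrier_mat[OF f] in \<open>auto intro: mult_mat_vec_carrier measurable_carrier_vec[OF g]\<close>)

lemma measurable_transpose_mat [measurable (raw)]:
  assumes f: "f \<in> M \<rightarrow>\<^sub>M borel_mat m k"
  shows "(\<lambda>x. (f x)\<^sup>T) \<in> M \<rightarrow>\<^sub>M borel_mat k m"
proof (rule measurable_borel_matI)
  fix i j assume "i < k" "j < m"
  then show "(\<lambda>x. (f x)\<^sup>T $$ (i, j)) \<in> borel_measurable M"
    using measurable_mat_entry[OF f] measurable_dim_mat[OF f]
    by (subst measurable_cong[where g = "\<lambda>x. f x $$ (j, i)"]) auto
qed (use measurable_carrier_mat[OF f] in \<open>auto\<close>)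

lemma measurable_mult_mat [measurable (raw)]:
  assumes f: "f \<in> M \<rightarrow>\<^sub>M borel_mat m k" and g: "g \<in> M \<rightarrow>\<^sub>M borel_mat k l"
  shows "(\<lambda>x. f x * g x) \<in> M \<rightarrow>\<^sub>M borel_mat m l"
proof (rule measurable_borel_matI)
  fix i j assume ij: "i < m" "j < l"
  have "(\<lambda>x. \<Sum>h<k. f x $$ (i, h) * g x $$ (h, j)) \<in> borel_measurable M"
    using ij by (intro borel_measurable_sum borel_measurable_times measurable_mat_entry[OF f]
        measurable_mat_entry[OF g]) auto
  then show "(\<lambda>x. (f x * g x) $$ (i, j)) \<in> borel_measurable M"
    by (rule measurable_cong[THEN iffD1, rotated])
      (use measurable_dim_mat[OF f] measurable_dim_mat[OF g] ij
        in \<open>auto simp: scalar_prod_def atLeast0LessThan\<close>)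
qed (use measurable_carrier_mat[OF f] measurable_carrier_mat[OF g] in \<open>auto intro!: mult_carrier_mat\<close>)

lemma measurable_add_mat [measurable (raw)]:
  assumes f: "f \<in> M \<rightarrow>\<^sub>M borel_mat m k" and g: "g \<in> M \<rightarrow>\<^sub>M borel_mat m k"
  shows "(\<lambda>x. f x + g x) \<in> M \<rightarrow>\<^sub>M borel_mat m k"
proof (rule measurable_borel_matI)
  fix i j assume ij: "i < m" "j < k"
  have "(\<lambda>x. f x $$ (i, j) + g x $$ (i, j)) \<in> borel_measurable M"
    using ij by (intro borel_measurable_add measurable_mat_entry[OF f] measurable_mat_entry[OF g]) auto
  then show "(\<lambda>x. (f x + g x) $$ (i, j)) \<in> borel_measurable M"
    by (rule measurable_cong[THEN iffD1, rotated])
      (use measurable_dim_mat[OF f] measurable_dim_mat[OF g] ij in \<open>auto\<close>)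
qed (use measurable_carrier_mat[OF f] measurable_carrier_mat[OF g] in \<open>auto\<close>)

lemma measurable_smult_mat [measurable (raw)]:
  assumes c: "c \<in> borel_measurable M" and g: "g \<in> M \<rightarrow>\<^sub>M borel_mat m k"
  shows "(\<lambda>x. c x \<cdot>\<^sub>m g x) \<in> M \<rightarrow>\<^sub>M borel_mat m k"
proof (rule measurable_borel_matI)
  fix i j assume ij: "i < m" "j < k"
  have "(\<lambda>x. c x * g x $$ (i, j)) \<in> borel_measurable M"
    using ij by (intro borel_measurable_times measurable_mat_entry[OF g] c) auto
  then show "(\<lambda>x. (c x \<cdot>\<^sub>m g x) $$ (i, j)) \<in> borel_measurable M"
    by (rule measurable_cong[THEN iffD1, rotated])
      (use measurable_dim_mat[OF g] ij in \<open>auto\<close>)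
qed (use measurable_carrier_mat[OF g] in \<open>auto\<close>)

lemma measurable_add_vec [measurable (raw)]:
  assumes f: "f \<in> M \<rightarrow>\<^sub>M borel_vec m" and g: "g \<in> M \<rightarrow>\<^sub>M borel_vec m"
  shows "(\<lambda>x. f x + g x) \<in> M \<rightarrow>\<^sub>M borel_vec m"
proof (rule measurable_borel_vecI)
  fix i assume i: "i < m"
  have "(\<lambda>x. f x $ i + g x $ i) \<in> borel_measurable M"
    using i by (intro borel_measurable_add measurable_vec_entry[OF f] measurable_vec_entry[OF g]) auto
  then show "(\<lambda>x. (f x + g x) $ i) \<in> borel_measurable M"
    by (rule measurable_cong[THEN iffD1, rotated])
      (use measurable_dim_vec[OF f] measurable_dim_vec[OF g] i in \<open>auto\<close>)
qed (use measurable_carrier_vec[OF f] measurable_carrier_vec[OF g] in \<open>auto\<close>)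

lemma measurable_minus_vec [measurable (raw)]:
  assumes f: "f \<in> M \<rightarrow>\<^sub>M borel_vec m" and g: "g \<in> M \<rightarrow>\<^sub>M borel_vec m"
  shows "(\<lambda>x. f x - g x) \<in> M \<rightarrow>\<^sub>M borel_vec m"
proof (rule measurable_borel_vecI)
  fix i assume i: "i < m"
  have "(\<lambda>x. f x $ i - g x $ i) \<in> borel_measurable M"
    using i by (intro borel_measurable_diff measurable_vec_entry[OF f] measurable_vec_entry[OF g]) auto
  then show "(\<lambda>x. (f x - g x) $ i) \<in> borel_measurable M"
    by (rule measurable_cong[THEN iffD1, rotated])
      (use measurable_dim_vec[OF f] measurable_dim_vec[OF g] i in \<open>auto\<close>)
qed (use measurable_carrier_vec[OF f] measurable_carrier_vec[OF g] in \<open>auto\<close>)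

lemma measurable_smult_vec [measurable (raw)]:
  assumes c: "c \<in> borel_measurable M" and g: "g \<in> M \<rightarrow>\<^sub>M borel_vec m"
  shows "(\<lambda>x. c x \<cdot>\<^sub>v g x) \<in> M \<rightarrow>\<^sub>M borel_vec m"
proof (rule measurable_borel_vecI)
  fix i assume i: "i < m"
  have "(\<lambda>x. c x * g x $ i) \<in> borel_measurable M"
    using i by (intro borel_measurable_times measurable_vec_entry[OF g] c) auto
  then show "(\<lambda>x. (c x \<cdot>\<^sub>v g x) $ i) \<in> borel_measurable M"
    by (rule measurable_cong[THEN iffD1, rotated])
      (use measurable_dim_vec[OF g] i in \<open>auto\<close>)
qed (use measurable_carrier_vec[OF g] in \<open>auto\<close>)

text \<open>Leibniz' formula is a polynomial in the entries. Together with the adjugate below it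
  gives a measurable form of the inverse, used in \<open>mat_solve\<close>.\<close>

lemma measurable_det:
  assumes f: "f \<in> M \<rightarrow>\<^sub>M borel_mat m m"
  shows "(\<lambda>x. Determinant.det (f x)) \<in> borel_measurable M"
proof -
  have "(\<lambda>x. \<Sum>\<pi>\<in>{\<pi>. \<pi> permutes {0..<m}}. signof \<pi> * (\<Prod>i = 0..<m. f x $$ (i, \<pi> i))) \<in> borel_measurable M"
    by (intro borel_measurable_sum borel_measurable_times borel_measurable_prod measurable_mat_entry[OF f])
      (auto simp: permutes_in_image)
  then show ?thesis
    by (rule measurable_cong[THEN iffD1, rotated])
      (use measurable_carrier_mat[OF f] in \<open>simp add: Determinant.det_def'[OF measurable_carrier_mat[OF f]]\<close>)
qed

lemma measurable_adj_mat:
  assumes f: "f \<in> M \<rightarrow>\<^sub>M borel_mat m m"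
  shows "(\<lambda>x. adj_mat (f x)) \<in> M \<rightarrow>\<^sub>M borel_mat m m"
proof (rule measurable_borel_matI)
  fix i j assume ij: "i < m" "j < m"
  \<comment> \<open>The adjugate is the transposed cofactor matrix: its entry (i, j) deletes row
    \<open>j\<close> and column \<open>i\<close>.\<close>
  have "(\<lambda>x. mat_delete (f x) j i) \<in> M \<rightarrow>\<^sub>M borel_mat (m - 1) (m - 1)"
  proof (rule measurable_borel_matI)
    fix i' j' assume ij': "i' < m - 1" "j' < m - 1"
    have "(\<lambda>x. f x $$ (if i' < j then i' else Suc i', if j' < i then j' else Suc j')) \<in> borel_measurable M"
      using ij' ij by (intro measurable_mat_entry[OF f]) auto
    then show "(\<lambda>x. mat_delete (f x) j i $$ (i', j')) \<in> borel_measurable M"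
      by (rule measurable_cong[THEN iffD1, rotated])
        (use measurable_dim_mat[OF f] ij' in \<open>auto simp: mat_delete_def\<close>)
  qed (use measurable_dim_mat[OF f] in \<open>auto intro: mat_delete_carrier\<close>)
  then have "(\<lambda>x. (-1) ^ (j + i) * Determinant.det (mat_delete (f x) j i)) \<in> borel_measurable M"
    by (intro borel_measurable_times borel_measurable_const measurable_det)
  then show "(\<lambda>x. adj_mat (f x) $$ (i, j)) \<in> borel_measurable M"
    by (rule measurable_cong[THEN iffD1, rotated])
      (use measurable_dim_mat[OF f] ij in \<open>auto simp: adj_mat_def cofactor_def\<close>)
qed (use measurable_dim_mat[OF f] in \<open>auto simp: adj_mat_def intro!: carrier_matI\<close>)

section \<open>Uniqueness of laws on finite product spaces\<close>

text \<open>Levy's uniqueness theorem after a change of measure: divided by their common mass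
  \<open>c\<close>, the weights become probability densities, and the cosine and sine integrals are
  the real and imaginary parts of the characteristic functions of \<open>X\<close> and
  \<open>Y\<close> under them.\<close>

lemma weighted_law_eqI:
  fixes X :: "'a \<Rightarrow> real" and Y :: "'b \<Rightarrow> real"
  assumes M: "prob_space M" and N: "prob_space N"
    and X [measurable]: "X \<in> borel_measurable M" and Y [measurable]: "Y \<in> borel_measurable N"
    and v [measurable]: "v \<in> borel_measurable M" and w [measurable]: "w \<in> borel_measurable N"
    and v0: "\<And>x. 0 \<le> v x" and w0: "\<And>x. 0 \<le> w x"
    and vb: "integrable M v" and wb: "integrable N w"
    and cos_eq: "\<And>t. (\<integral>x. v x * cos (t * X x) \<partial>M) = (\<integral>x. w x * cos (t * Y x) \<partial>N)"
    and sin_eq: "\<And>t. (\<integral>x. v x * sin (t * X x) \<partial>M) = (\<integral>x. w x * sin (t * Y x) \<partial>N)"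
    and A [measurable]: "A \<in> sets borel"
  shows "(\<integral>x. v x * indicator A (X x) \<partial>M) = (\<integral>x. w x * indicator A (Y x) \<partial>N)"
proof -
  interpret M: prob_space M by (rule M)
  interpret N: prob_space N by (rule N)
  define c where "c = (\<integral>x. v x \<partial>M)"
  \<comment> \<open>At frequency 0 the cosine hypothesis says that both weights have the same
    mass.\<close>
  have cN: "c = (\<integral>x. w x \<partial>N)" using cos_eq[of 0] by (simp add: c_def)
  have law: "real_distribution (distr (density P (\<lambda>x. ennreal (u x / c))) borel Z) \<and>
      (\<forall>t. char (distr (density P (\<lambda>x. ennreal (u x / c))) borel Z) t =
        complex_of_real ((\<integral>x. u x * cos (t * Z x) \<partial>P) / c) + \<i> * complex_of_real ((\<integral>x. u x * sin (t * Z x) \<partial>P) / c)) \<and>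
      measure (distr (density P (\<lambda>x. ennreal (u x / c))) borel Z) A = (\<integral>x. u x * indicator A (Z x) \<partial>P) / c"
    if c: "c > 0" and P: "prob_space P" and u[measurable]: "u \<in> borel_measurable P" "integrable P u"
      and Z[measurable]: "Z \<in> borel_measurable P" and u0: "\<And>x. 0 \<le> u x" and cu: "c = (\<integral>x. u x \<partial>P)"
    for P :: "'c measure" and u Z
  proof -
    interpret P: prob_space P by (rule P)
    let ?D = "density P (\<lambda>x. ennreal (u x / c))"
    have "emeasure ?D (space ?D) = ennreal (\<integral>x. u x / c \<partial>P)"
      using u u0 c by (subst nn_integral_eq_integral[symmetric])
        (auto simp: emeasure_density intro!: nn_integral_cong)
    also have "\<dots> = 1" using c cu by simp
    finally interpret D: prob_space ?D by (rule prob_spaceI)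
    have 1: "real_distribution (distr ?D borel Z)"
      by (intro real_distribution.intro D.prob_space_distr real_distribution_axioms.intro) auto
    have int_bd: "integrable P (\<lambda>x. u x * f x)"
      if "f \<in> borel_measurable P" "\<And>x. \<bar>f x\<bar> \<le> 1" for f :: "_ \<Rightarrow> real"
      using that u0
      by (intro Bochner_Integration.integrable_bound[OF u(2)]) (auto simp: abs_mult mult_left_le intro!: AE_I2)
    have 2: "char (distr ?D borel Z) t =
        complex_of_real ((\<integral>x. u x * cos (t * Z x) \<partial>P) / c) + \<i> * complex_of_real ((\<integral>x. u x * sin (t * Z x) \<partial>P) / c)" for t
    proof -
      have "char (distr ?D borel Z) t = (CLINT x|P. (u x / c) *\<^sub>R iexp (t * Z x))"
        using u0 c by (simp add: char_def integral_distr integral_density)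
      also have "\<dots> = (CLINT x|P. complex_of_real (u x * cos (t * Z x)) / c + \<i> * (complex_of_real (u x * sin (t * Z x)) / c))"
        by (intro Bochner_Integration.integral_cong refl)
          (simp add: Re_exp Im_exp complex_eq_iff)
      also have "\<dots> = complex_of_real ((\<integral>x. u x * cos (t * Z x) \<partial>P) / c) + \<i> * complex_of_real ((\<integral>x. u x * sin (t * Z x) \<partial>P) / c)"
      proof -
        have "integrable P (\<lambda>x. complex_of_real (u x * cos (t * Z x)))" "integrable P (\<lambda>x. complex_of_real (u x * sin (t * Z x)))"
          by (auto intro!: integrable_of_real int_bd simp del: of_real_mult)
        then show ?thesis
          by (simp add: Bochner_Integration.integral_add del: of_real_mult)
      qed
      finally show ?thesis .
    qed
    have "measure (distr ?D borel Z) A = (\<integral>x. indicator (Z -` A \<inter> space P) x \<partial>?D)"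
      by (simp add: measure_distr)
    also have "\<dots> = (\<integral>x. (u x / c) *\<^sub>R indicator (Z -` A \<inter> space P) x \<partial>P)"
      using u0 c by (subst integral_density) auto
    also have "\<dots> = (\<integral>x. u x * indicator A (Z x) / c \<partial>P)"
      by (intro Bochner_Integration.integral_cong) (auto simp: indicator_def)
    finally show ?thesis using 1 2 by simp
  qed
  show ?thesis
  proof (cases "c = 0")
    case True
    have "AE x in M. v x = 0"
      using integral_nonneg_eq_0_iff_AE[OF vb] v0 True by (auto simp: c_def)
    moreover have "AE x in N. w x = 0"
      using integral_nonneg_eq_0_iff_AE[OF wb] w0 True cN by auto
    ultimately have "(\<integral>x. v x * indicator A (X x) \<partial>M) = 0" "(\<integral>x. w x * indicator A (Y x) \<partial>N) = 0"
      by (auto intro!: integral_eq_zero_AE)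
    then show ?thesis by simp
  next
    case False
    have c: "c > 0" using False v0 by (auto simp: c_def order_less_le intro!: integral_nonneg)
    note lM = law[OF c M v vb X v0 c_def] and lN = law[OF c N w wb Y w0 cN]
    have "distr (density M (\<lambda>x. ennreal (v x / c))) borel X = distr (density N (\<lambda>x. ennreal (w x / c))) borel Y"
      using lM lN cos_eq sin_eq by (intro Levy_uniqueness) (auto simp: fun_eq_iff)
    then show ?thesis using lM lN c by (auto simp: field_simps)
  qed
qed

text \<open>
  Coordinates are moved one at a time from the characteristic function into a product of
  indicators, each time by the one-dimensional uniqueness theorem for the weights
  \<open>1 + cos\<close>, which are nonnegative.
\<close>

lemma measure_eqI_PiM_char:
  fixes M N :: "('i \<Rightarrow> real) measure"
  assumes I: "finite I" and M: "prob_space M" and N: "prob_space N"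
    and sets_M: "sets M = sets (\<Pi>\<^sub>M i\<in>I. borel)" and sets_N: "sets N = sets (\<Pi>\<^sub>M i\<in>I. borel)"
    and char_eq: "\<And>t. (CLINT x|M. iexp (\<Sum>i\<in>I. t i * x i)) = (CLINT x|N. iexp (\<Sum>i\<in>I. t i * x i))"
  shows "M = N"
proof -
  interpret M: prob_space M by (rule M)
  interpret N: prob_space N by (rule N)
  note meas_cong = measurable_cong_sets[OF sets_M refl] measurable_cong_sets[OF sets_N refl]
  have bd_M: "f \<in> borel_measurable (\<Pi>\<^sub>M i\<in>I. borel) \<Longrightarrow> (\<And>x. \<bar>f x\<bar> \<le> b) \<Longrightarrow> integrable M f" for f :: "_ \<Rightarrow> real" and b
    by (intro M.integrable_const_bound[of _ b] AE_I2) (auto simp: meas_cong)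
  have bd_N: "f \<in> borel_measurable (\<Pi>\<^sub>M i\<in>I. borel) \<Longrightarrow> (\<And>x. \<bar>f x\<bar> \<le> b) \<Longrightarrow> integrable N f" for f :: "_ \<Rightarrow> real" and b
    by (intro N.integrable_const_bound[of _ b] AE_I2) (auto simp: meas_cong)
  \<comment> \<open>\<open>K J A\<close> collects the indicators of the coordinates already
    converted, \<open>L J t\<close> the linear form in those still under the characteristic
    function.\<close>
  define K where "K J A x = (\<Prod>j\<in>J. indicator (A j) (x j :: real) :: real)" for J :: "'i set" and A x
  define L where "L J t x = (\<Sum>i\<in>I - J. t i * (x i :: real))" for J t x
  have K_meas [measurable]: "K J A \<in> borel_measurable (\<Pi>\<^sub>M i\<in>I. borel)"
    if "J \<subseteq> I" "\<forall>j\<in>J. A j \<in> sets borel" for J A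
    unfolding K_def using that
    by (intro borel_measurable_prod measurable_compose[OF measurable_component_singleton] borel_measurable_indicator) auto
  have L_meas [measurable]: "L J t \<in> borel_measurable (\<Pi>\<^sub>M i\<in>I. borel)" for J t
    unfolding L_def by (intro borel_measurable_sum borel_measurable_times measurable_component_singleton) auto
  have K01: "0 \<le> K J A x" "K J A x \<le> 1" for J A x
    unfolding K_def by (auto intro!: prod_nonneg prod_le_1 simp: indicator_def)
  \<comment> \<open>The free phase \<open>\<phi>\<close> belongs to the induction claim: a sine is a
    cosine shifted by a quarter period, and a product of two cosines is a sum of cosines with other
    phases.\<close>
  have H: "(\<integral>x. K J A x * cos (\<phi> + L J t x) \<partial>M) = (\<integral>x. K J A x * cos (\<phi> + L J t x) \<partial>N)"
    if "J \<subseteq> I" "\<forall>j\<in>J. A j \<in> sets borel" for J A \<phi> t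
    using finite_subset[OF \<open>J \<subseteq> I\<close> I] that
  proof (induction J arbitrary: A \<phi> t rule: finite_induct)
    case empty
    have *: "(\<integral>x. cos (\<phi> + L {} t x) \<partial>P) = Re (exp (\<i> * \<phi>) * (CLINT x|P. iexp (\<Sum>i\<in>I. t i * x i)))"
      if P: "prob_space P" and sP: "sets P = sets (\<Pi>\<^sub>M i\<in>I. borel)" for P
    proof -
      interpret P: prob_space P by (rule P)
      have S: "(\<Sum>i\<in>I. t i * x i) = L {} t x" for x by (simp add: L_def)
      have [measurable]: "L {} t \<in> borel_measurable P"
        using L_meas[of "{}" t] by (simp add: measurable_cong_sets[OF sP refl])
      have i: "integrable P (\<lambda>x. iexp (L {} t x))"
        by (intro P.integrable_const_bound[of _ 1] AE_I2) auto
      have "Re (exp (\<i> * \<phi>) * (CLINT x|P. iexp (\<Sum>i\<in>I. t i * x i))) = (\<integral>x. Re (exp (\<i> * \<phi>) * iexp (L {} t x)) \<partial>P)"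
        unfolding S using i by (simp only: integral_mult_right_zero[symmetric] integral_Re integrable_mult_right)
      also have "\<dots> = (\<integral>x. cos (\<phi> + L {} t x) \<partial>P)"
        by (intro Bochner_Integration.integral_cong refl)
          (simp add: Re_exp Im_exp cos_add)
      finally show ?thesis by simp
    qed
    show ?case unfolding K_def prod.empty mult_1_left *[OF M sets_M] *[OF N sets_N] char_eq ..
  next
    case (insert j J)
    then have j: "j \<in> I" "j \<notin> J" "J \<subseteq> I" and A: "\<forall>i\<in>J. A i \<in> sets borel" "A j \<in> sets borel" by auto
    let ?L = "L (insert j J) t"
    have L_split: "L J (t(j := s)) x = ?L x + s * x j" for s x
    proof -
      have "L J (t(j := s)) x = (\<Sum>i\<in>insert j (I - insert j J). (t(j := s)) i * x i)"
        unfolding L_def using j by (intro sum.cong) auto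
      also have "\<dots> = s * x j + (\<Sum>i\<in>I - insert j J. (t(j := s)) i * x i)"
        using I by (subst sum.insert) auto
      also have "(\<Sum>i\<in>I - insert j J. (t(j := s)) i * x i) = ?L x"
        unfolding L_def by (intro sum.cong) auto
      finally show ?thesis by (simp only: add.commute)
    qed
    have L_single: "L J ((\<lambda>_. 0)(j := s)) x = s * x j" for s x
    proof -
      have "L J ((\<lambda>_. 0)(j := s)) x = (\<Sum>i\<in>I - J. if i = j then s * x j else 0)"
        unfolding L_def by (intro sum.cong) auto
      then show ?thesis using j I by (simp add: sum.delta)
    qed
    have IH: "(\<integral>x. K J A x * cos (\<psi> + L J u x) \<partial>M) = (\<integral>x. K J A x * cos (\<psi> + L J u x) \<partial>N)" for \<psi> u
      using insert.IH[OF j(3) A(1)] .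
    \<comment> \<open>Two specialisations of the induction hypothesis, each with a free frequency
      \<open>s\<close> at \<open>j\<close>: \<open>1\<close> sets the other frequencies to 0,
      \<open>2\<close> keeps them.\<close>
    have 1: "(\<integral>x. K J A x * cos (\<psi> + s * x j) \<partial>M) = (\<integral>x. K J A x * cos (\<psi> + s * x j) \<partial>N)" for \<psi> s
      using IH[of \<psi> "(\<lambda>_. 0)(j := s)"] unfolding L_single .
    have 2: "(\<integral>x. K J A x * cos (\<psi> + ?L x + s * x j) \<partial>M) = (\<integral>x. K J A x * cos (\<psi> + ?L x + s * x j) \<partial>N)" for \<psi> s
      using IH[of \<psi> "t(j := s)"] unfolding L_split add.assoc .
    note [measurable] = K_meas[OF j(3) A(1)]
    have xj [measurable]: "(\<lambda>x. x j) \<in> borel_measurable (\<Pi>\<^sub>M i\<in>I. borel)"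
      using j by (intro measurable_component_singleton) auto
    have bd: "f \<in> borel_measurable (\<Pi>\<^sub>M i\<in>I. borel) \<Longrightarrow> (\<And>x. \<bar>f x\<bar> \<le> b) \<Longrightarrow>
        integrable M (\<lambda>x. K J A x * f x) \<and> integrable N (\<lambda>x. K J A x * f x)" for f b
    proof -
      assume f [measurable]: "f \<in> borel_measurable (\<Pi>\<^sub>M i\<in>I. borel)" and b: "\<And>x. \<bar>f x\<bar> \<le> b"
      have "\<bar>K J A x * f x\<bar> \<le> b" for x
        using mult_mono[OF K01(2)[of J A x] b[of x]] K01(1)[of J A x] by (simp add: abs_mult)
      then show ?thesis by (intro conjI bd_M bd_N) auto
    qed
    let ?v = "\<lambda>x. K J A x * (1 + cos (\<phi> + ?L x))"
    have v: "\<bar>1 + cos (\<phi> + ?L x)\<bar> \<le> 2" "0 \<le> ?v x" for x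
    proof -
      have "-1 \<le> cos (\<phi> + ?L x)" "cos (\<phi> + ?L x) \<le> 1" by auto
      then show "\<bar>1 + cos (\<phi> + ?L x)\<bar> \<le> 2" by linarith
      show "0 \<le> ?v x" using K01(1)[of J A x] \<open>-1 \<le> cos (\<phi> + ?L x)\<close> by (intro mult_nonneg_nonneg) linarith+
    qed
    \<comment> \<open>With a and b for the two arguments, (1 + cos a) cos b = cos b + (cos (a + b) +
      cos (a - b)) / 2, and the induction hypothesis covers each summand.\<close>
    have cs: "(\<integral>x. K J A x * (1 + cos (\<phi> + ?L x)) * cos (\<psi> + s * x j) \<partial>M)
      = (\<integral>x. K J A x * (1 + cos (\<phi> + ?L x)) * cos (\<psi> + s * x j) \<partial>N)" for \<psi> s
    proof -
      have e: "K J A x * (1 + cos (\<phi> + ?L x)) * cos (\<psi> + s * x j) =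
          K J A x * cos (\<psi> + s * x j) + (K J A x * cos ((\<phi> + \<psi>) + ?L x + s * x j) / 2 +
          K J A x * cos ((\<phi> - \<psi>) + ?L x + (- s) * x j) / 2)" for x
      proof -
        have alg: "k * (1 + c) * d = k * d + (k * a / 2 + k * b / 2)" if "c * d = (b + a) / 2" for a b c d k :: real
        proof -
          have "k * (1 + c) * d = k * d + k * (c * d)" by (simp add: algebra_simps)
          then show ?thesis unfolding that by (simp add: field_simps)
        qed
        have "cos (\<phi> + ?L x) * cos (\<psi> + s * x j) =
           (cos ((\<phi> + ?L x) - (\<psi> + s * x j)) + cos ((\<phi> + ?L x) + (\<psi> + s * x j))) / 2"
          by (rule cos_times_cos)
        moreover have "(\<phi> + ?L x) - (\<psi> + s * x j) = (\<phi> - \<psi>) + ?L x + (- s) * x j" by (simp add: algebra_simps)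
        moreover have "(\<phi> + ?L x) + (\<psi> + s * x j) = (\<phi> + \<psi>) + ?L x + s * x j" by (simp add: algebra_simps)
        ultimately show ?thesis by (intro alg) (simp only:)
      qed
      have i: "integrable P (\<lambda>x. K J A x * cos (\<psi> + s * x j))"
        "integrable P (\<lambda>x. K J A x * cos (\<psi> + ?L x + s * x j))" if P: "P = M \<or> P = N" for \<psi> s P
      proof -
        have "(\<lambda>x. cos (\<psi> + s * x j)) \<in> borel_measurable (\<Pi>\<^sub>M i\<in>I. borel)"
          "(\<lambda>x. cos (\<psi> + ?L x + s * x j)) \<in> borel_measurable (\<Pi>\<^sub>M i\<in>I. borel)"
          by measurable
        note this[THEN bd, OF abs_cos_le_one]
        then show "integrable P (\<lambda>x. K J A x * cos (\<psi> + s * x j))"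
          "integrable P (\<lambda>x. K J A x * cos (\<psi> + ?L x + s * x j))"
          using P by (elim disjE; simp only:)+
      qed
      have lin: "(\<integral>x. f x + (g x / 2 + h x / 2) \<partial>P) = (\<integral>x. f x \<partial>P) + ((\<integral>x. g x \<partial>P) / 2 + (\<integral>x. h x \<partial>P) / 2)"
        if "integrable P f" "integrable P g" "integrable P h" for P and f g h :: "('i \<Rightarrow> real) \<Rightarrow> real"
        using that by simp
      show ?thesis
        unfolding e lin[OF i(1)[OF disjI1[OF refl]] i(2)[OF disjI1[OF refl]] i(2)[OF disjI1[OF refl]]]
          lin[OF i(1)[OF disjI2[OF refl]] i(2)[OF disjI2[OF refl]] i(2)[OF disjI2[OF refl]]]
        by (simp only: 1 2)
    qed
    have sin_cos: "sin z = cos (- pi / 2 + z)" for z :: real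
      by (simp add: cos_diff)
    have Aj: "(\<integral>x. ?v x * indicator (A j) (x j) \<partial>M) = (\<integral>x. ?v x * indicator (A j) (x j) \<partial>N)"
    proof (rule weighted_law_eqI[OF M N])
      show "integrable M ?v" "integrable N ?v" by (rule bd[THEN conjunct1, OF _ v(1)] bd[THEN conjunct2, OF _ v(1)], measurable)+
      show "(\<integral>x. ?v x * cos (s * x j) \<partial>M) = (\<integral>x. ?v x * cos (s * x j) \<partial>N)" for s using cs[of 0] by simp
      show "(\<integral>x. ?v x * sin (s * x j) \<partial>M) = (\<integral>x. ?v x * sin (s * x j) \<partial>N)" for s
        unfolding sin_cos by (rule cs)
    qed (use v(2) A in \<open>simp_all add: meas_cong\<close>)
    have Bj: "(\<integral>x. K J A x * indicator (A j) (x j) \<partial>M) = (\<integral>x. K J A x * indicator (A j) (x j) \<partial>N)"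
    proof (rule weighted_law_eqI[OF M N])
      show "integrable M (K J A)" "integrable N (K J A)" using bd[of "\<lambda>x. 1" 1] by simp_all
      show "(\<integral>x. K J A x * cos (s * x j) \<partial>M) = (\<integral>x. K J A x * cos (s * x j) \<partial>N)" for s using 1[of 0] by simp
      show "(\<integral>x. K J A x * sin (s * x j) \<partial>M) = (\<integral>x. K J A x * sin (s * x j) \<partial>N)" for s
        unfolding sin_cos by (rule 1)
    qed (use K01 A in \<open>simp_all add: meas_cong\<close>)
    \<comment> \<open>The cosine, which may be negative, is written as (1 + cos) - 1, a difference
      of two nonnegative weights; \<open>Aj\<close> and \<open>Bj\<close> treat one each.\<close>
    have e: "K (insert j J) A x * cos (\<phi> + ?L x) = ?v x * indicator (A j) (x j) - K J A x * indicator (A j) (x j)" for x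
    proof -
      have Ki: "K (insert j J) A x = indicator (A j) (x j) * K J A x"
        unfolding K_def using insert.hyps by simp
      have "a * k * c = k * (1 + c) * a - k * a" for a k c :: real by (simp add: algebra_simps)
      then show ?thesis unfolding Ki by this
    qed
    have i: "integrable P (\<lambda>x. ?v x * indicator (A j) (x j))" "integrable P (\<lambda>x. K J A x * indicator (A j) (x j))"
      if P: "P = M \<or> P = N" for P
    proof -
      have [measurable]: "(\<lambda>x. indicator (A j) (x j) :: real) \<in> borel_measurable (\<Pi>\<^sub>M i\<in>I. borel)"
        using A(2) by measurable
      have ind: "\<bar>(1 + cos (\<phi> + ?L x)) * indicator (A j) (x j)\<bar> \<le> 2" "\<bar>indicator (A j) (x j) :: real\<bar> \<le> 1" for x
        using v(1)[of x] by (cases "x j \<in> A j"; simp)+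
      have "(\<lambda>x. (1 + cos (\<phi> + ?L x)) * indicator (A j) (x j)) \<in> borel_measurable (\<Pi>\<^sub>M i\<in>I. borel)"
        by measurable
      from bd[OF this ind(1)] P
      have "integrable P (\<lambda>x. K J A x * ((1 + cos (\<phi> + ?L x)) * indicator (A j) (x j)))"
        by (elim disjE; simp only:)
      then show "integrable P (\<lambda>x. ?v x * indicator (A j) (x j))" by (simp only: mult.assoc)
      have "(\<lambda>x. indicator (A j) (x j) :: real) \<in> borel_measurable (\<Pi>\<^sub>M i\<in>I. borel)"
        by measurable
      from bd[of "\<lambda>x. indicator (A j) (x j)" 1, OF this] ind(2) P
      show "integrable P (\<lambda>x. K J A x * indicator (A j) (x j))"
        by blast
    qed
    show ?case
      unfolding e Bochner_Integration.integral_diff[OF i[OF disjI1[OF refl]]]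
        Bochner_Integration.integral_diff[OF i[OF disjI2[OF refl]]] Aj Bj ..
  qed
  show ?thesis
  proof (rule measure_eqI_PiM_finite[OF I sets_M sets_N])
    fix A :: "'i \<Rightarrow> real set" assume A: "\<And>i. i \<in> I \<Longrightarrow> A i \<in> sets borel"
    \<comment> \<open>For \<open>J = I\<close> no coordinate is left in the linear form, so the
      cosine is 1 and \<open>K\<close> is the indicator of a box.\<close>
    have *: "measure P (Pi\<^sub>E I A) = (\<integral>x. K I A x * cos (0 + L I (\<lambda>_. 0) x) \<partial>P)"
      if sP: "sets P = sets (\<Pi>\<^sub>M i\<in>I. borel)" for P
    proof -
      have "(\<integral>x. K I A x * cos (0 + L I (\<lambda>_. 0) x) \<partial>P) = (\<integral>x. indicator (Pi\<^sub>E I A) x \<partial>P)"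
      proof (intro Bochner_Integration.integral_cong refl)
        fix x assume "x \<in> space P"
        \<comment> \<open>Membership in the box also constrains \<open>x\<close> outside
          \<open>I\<close>, which \<open>K\<close> does not see; points of the product space meet
          that constraint anyway.\<close>
        then have "x \<in> extensional I" using sets_eq_imp_space_eq[OF sP] by (auto simp: space_PiM PiE_def)
        then show "K I A x * cos (0 + L I (\<lambda>_. 0) x) = indicator (Pi\<^sub>E I A) x"
        proof (cases "x \<in> Pi\<^sub>E I A")
          case True
          then have "K I A x = 1" unfolding K_def by (intro prod.neutral) (auto simp: PiE_def Pi_def)
          then show ?thesis using True by (simp add: L_def)
        next
          case False
          then obtain i where "i \<in> I" "x i \<notin> A i" using \<open>x \<in> extensional I\<close> by (auto simp: PiE_def Pi_def)
          then have "K I A x = 0" unfolding K_def using I by (intro prod_zero bexI[of _ i]) auto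
          then show ?thesis using False by simp
        qed
      qed
      moreover have "Pi\<^sub>E I A \<in> sets P" unfolding sP using A I by (intro sets_PiM_I_finite) auto
      ultimately show ?thesis by simp
    qed
    show "emeasure M (Pi\<^sub>E I A) = emeasure N (Pi\<^sub>E I A)"
    proof -
      have "measure M (Pi\<^sub>E I A) = measure N (Pi\<^sub>E I A)"
        unfolding *[OF sets_M] *[OF sets_N] by (rule H) (use A in auto)
      then show ?thesis by (simp only: M.emeasure_eq_measure N.emeasure_eq_measure)
    qed
  next
    show "range (\<lambda>_::nat. space (\<Pi>\<^sub>M i\<in>I. borel :: real measure)) \<subseteq> prod_algebra I (\<lambda>i. borel)"
      using prod_algebraI_finite[OF I, of "\<lambda>_. UNIV" "\<lambda>_. borel :: real measure"] by (auto simp: space_PiM)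
    show "emeasure M (space (\<Pi>\<^sub>M i\<in>I. borel :: real measure)) \<noteq> \<infinity>" for i :: nat
      by (simp only: M.emeasure_eq_measure) simp
  qed simp
qed

section \<open>Gaussian vectors and matrices\<close>

lemma sets_gauss [simp, measurable_cong]: "sets (gauss s) = sets borel"
  by (simp add: gauss_def)

lemma space_gauss [simp]: "space (gauss s) = UNIV"
  by (simp add: gauss_def)

lemma prob_space_gauss: "0 \<le> s \<Longrightarrow> prob_space (gauss s)"
  by (auto simp: gauss_def intro!: prob_space_return prob_space_normal_density)

text \<open>For \<open>s = 0\<close> both sides are the point mass at 0. Moments and characteristic
  functions thus come from the standard normal law, with no separate treatment of the degenerate
  case.\<close>

lemma gauss_scale:
  assumes "0 \<le> s"
  shows "gauss s = distr (gauss 1) borel (\<lambda>x. s * x)"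
proof (cases "s = 0")
  case True
  interpret prob_space "gauss 1" by (rule prob_space_gauss) simp
  have "distr (gauss 1) borel (\<lambda>x. 0 * x) = return borel (0::real)"
    by (rule measure_eqI) (auto simp: emeasure_distr indicator_def emeasure_space_1[simplified])
  then show ?thesis using True by (simp add: gauss_def)
next
  case False
  then have s: "s > 0" using assms by simp
  let ?N = "density lborel std_normal_density"
  interpret prob_space ?N by (rule prob_space_normal_density) simp
  have "distributed ?N lborel (\<lambda>x. x) (normal_density 0 1)"
    unfolding distributed_def using distr_id[of ?N] by (simp cong: distr_cong add: distr_id2)
  from normal_density_affine[OF this _ less_imp_neq[OF s, symmetric], of 0]
  have "distr ?N lborel (\<lambda>x. s * x) = density lborel (normal_density 0 s)"
    using s by (simp add: distributed_def)
  moreover have "distr ?N lborel (\<lambda>x. s * x) = distr ?N borel (\<lambda>x. s * x)"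
    by (intro distr_cong) auto
  ultimately show ?thesis using s by (simp add: gauss_def)
qed

lemma gauss_moments:
  assumes "0 \<le> s"
  shows "integrable (gauss s) (\<lambda>x. x ^ k)"
    and "(\<integral>x. x \<partial>gauss s) = 0"
    and "(\<integral>x. x\<^sup>2 \<partial>gauss s) = s\<^sup>2"
    and "(\<integral>x. x ^ 4 \<partial>gauss s) = 3 * s ^ 4"
proof -
  have g1: "gauss 1 = std_normal_distribution" by (simp add: gauss_def)
  have *: "(\<integral>x. x ^ k \<partial>gauss s) = s ^ k * (\<integral>x. x ^ k \<partial>std_normal_distribution)" for k
    by (subst gauss_scale[OF assms]) (simp add: integral_distr g1 power_mult_distrib)
  show "integrable (gauss s) (\<lambda>x. x ^ k)"
    using integrable_std_normal_distribution_moment[of k]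
    by (subst gauss_scale[OF assms]) (simp add: integrable_distr_eq g1 power_mult_distrib)
  show "(\<integral>x. x \<partial>gauss s) = 0"
    using *[of 1] integral_std_normal_distribution_moment_odd[of 1] by simp
  show "(\<integral>x. x\<^sup>2 \<partial>gauss s) = s\<^sup>2"
    using *[of 2] std_normal_distribution_even_moments(1)[of 1] by simp
  show "(\<integral>x. x ^ 4 \<partial>gauss s) = 3 * s ^ 4"
    using *[of 4] std_normal_distribution_even_moments(1)[of 2] by (simp add: fact_numeral)
qed

lemma gauss_char:
  assumes "0 \<le> s"
  shows "(CLINT x|gauss s. iexp (t * x)) = of_real (exp (- (s * t)\<^sup>2 / 2))"
proof -
  have "(CLINT x|gauss s. iexp (t * x)) = char (gauss 1) (s * t)"
    by (subst gauss_scale[OF assms]) (simp add: integral_distr char_def mult_ac)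
  also have "gauss 1 = std_normal_distribution" by (simp add: gauss_def)
  finally show ?thesis by (simp add: char_std_normal_distribution)
qed

text \<open>Records the characteristic function of N(0, v) at the single argument 1. This suffices
  because it is always required of all linear forms of a vector, and these include all multiples of
  each. Degenerate laws have \<open>v = 0\<close>.\<close>

definition centered_normal :: "'a measure \<Rightarrow> ('a \<Rightarrow> real) \<Rightarrow> real \<Rightarrow> bool" where
  "centered_normal M f v \<longleftrightarrow> f \<in> borel_measurable M \<and> (CLINT x|M. iexp (f x)) = of_real (exp (- v / 2))"

text \<open>By Fubini the characteristic function of a sum of independent terms is a product, so the
  variances add.\<close>

lemma centered_normal_pair:
  assumes M: "prob_space M" and N: "prob_space N"
    and f: "centered_normal M f v" and g: "centered_normal N g w"
  shows "centered_normal (M \<Otimes>\<^sub>M N) (\<lambda>x. f (fst x) + g (snd x)) (v + w)"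
proof -
  interpret M: prob_space M by (rule M)
  interpret N: prob_space N by (rule N)
  interpret MN: pair_prob_space M N ..
  have [measurable]: "f \<in> borel_measurable M" "g \<in> borel_measurable N"
    using f g by (auto simp: centered_normal_def)
  have i: "integrable (M \<Otimes>\<^sub>M N) (\<lambda>x. iexp (f (fst x) + g (snd x)))"
    by (intro MN.integrable_const_bound[of _ 1] AE_I2) auto
  have "(CLINT x|M \<Otimes>\<^sub>M N. iexp (f (fst x) + g (snd x))) = (CLINT x|M. CLINT y|N. iexp (f x + g y))"
    using MN.integral_fst'[OF i] by simp
  also have "\<dots> = (CLINT x|M. iexp (f x) * (CLINT y|N. iexp (g y)))"
    by (simp add: distrib_left exp_add)
  also have "\<dots> = of_real (exp (- v / 2)) * of_real (exp (- w / 2))"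
    using f g by (simp add: centered_normal_def)
  also have "\<dots> = of_real (exp (- (v + w) / 2))"
    by (simp only: of_real_mult[symmetric] exp_add[symmetric]) (simp add: field_simps)
  finally show ?thesis by (simp add: centered_normal_def)
qed

lemma centered_normal_PiM:
  assumes s: "0 \<le> s" and J: "finite J"
  shows "centered_normal (\<Pi>\<^sub>M j\<in>J. gauss s) (\<lambda>x. \<Sum>j\<in>J. c j * x j) (s\<^sup>2 * (\<Sum>j\<in>J. (c j)\<^sup>2))"
proof -
  interpret G: prob_space "gauss s" by (rule prob_space_gauss[OF s])
  interpret product_sigma_finite "\<lambda>_. gauss s" by unfold_locales
  have iexp_sum: "iexp (\<Sum>j\<in>J. a j) = (\<Prod>j\<in>J. iexp (a j))" for a
    using J by (induction J) (simp_all add: distrib_left exp_add)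
  have exp_prod: "(\<Prod>j\<in>J. complex_of_real (exp (b j))) = of_real (exp (\<Sum>j\<in>J. b j))" for b
    using J by (induction J) (simp_all add: exp_add)
  have "(CLINT x|(\<Pi>\<^sub>M j\<in>J. gauss s). iexp (\<Sum>j\<in>J. c j * x j)) = (CLINT x|(\<Pi>\<^sub>M j\<in>J. gauss s). (\<Prod>j\<in>J. iexp (c j * x j)))"
    by (simp only: iexp_sum)
  also have "\<dots> = (\<Prod>j\<in>J. CLINT x|gauss s. iexp (c j * x))"
    by (rule product_integral_prod[OF J]) (intro G.integrable_const_bound[of _ 1] AE_I2, auto)
  also have "\<dots> = of_real (exp (\<Sum>j\<in>J. - (s * c j)\<^sup>2 / 2))"
    by (simp only: gauss_char[OF s] exp_prod)
  also have "(\<Sum>j\<in>J. - (s * c j)\<^sup>2 / 2) = (\<Sum>j\<in>J. (- s\<^sup>2 / 2) * (c j)\<^sup>2)"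
    by (simp add: power_mult_distrib)
  also have "\<dots> = - (s\<^sup>2 * (\<Sum>j\<in>J. (c j)\<^sup>2)) / 2"
    by (simp only: sum_distrib_left[symmetric])
  finally show ?thesis using J by (simp add: centered_normal_def)
qed

text \<open>Independence and mean 0 remove the cross terms. Used with the identity for linear forms
  and with \<open>x\<^sup>2 - s\<^sup>2\<close> for the squared norm.\<close>

lemma PiM_sum_square:
  fixes h :: "'b \<Rightarrow> real"
  assumes N: "prob_space N" and J: "finite J" and h: "integrable N h" "integrable N (\<lambda>x. (h x)\<^sup>2)"
    and mean: "(\<integral>x. h x \<partial>N) = 0" and var: "(\<integral>x. (h x)\<^sup>2 \<partial>N) = V"
  shows "integrable (\<Pi>\<^sub>M j\<in>J. N) (\<lambda>x. \<Sum>j\<in>J. c j * h (x j))"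
    and "(\<integral>x. (\<Sum>j\<in>J. c j * h (x j)) \<partial>(\<Pi>\<^sub>M j\<in>J. N)) = 0"
    and "integrable (\<Pi>\<^sub>M j\<in>J. N) (\<lambda>x. (\<Sum>j\<in>J. c j * h (x j))\<^sup>2)"
    and "(\<integral>x. (\<Sum>j\<in>J. c j * h (x j))\<^sup>2 \<partial>(\<Pi>\<^sub>M j\<in>J. N)) = V * (\<Sum>j\<in>J. (c j)\<^sup>2)"
proof -
  interpret N: prob_space N by (rule N)
  interpret product_sigma_finite "\<lambda>_. N" by unfold_locales
  let ?P = "\<Pi>\<^sub>M j\<in>J. N"
  \<comment> \<open>A coordinate function is written as a product over all of \<open>J\<close> with
    factors 1 elsewhere, the shape in which the product integral factors; a product of two
    coordinates is treated in the same way below.\<close>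
  have prod1: "(\<Prod>k\<in>J. if k = i then h (x k) else 1) = h (x i)" if "i \<in> J" for i x
    using that J by (simp add: prod.delta')
  have 1: "integrable ?P (\<lambda>x. h (x i))" "(\<integral>x. h (x i) \<partial>?P) = 0" if i: "i \<in> J" for i
  proof -
    let ?f = "\<lambda>k y. if k = i then h y else 1"
    have f: "integrable N (?f k)" for k using h(1) by (cases "k = i") auto
    show "integrable ?P (\<lambda>x. h (x i))"
      using product_integrable_prod[OF J, of ?f] f prod1[OF i] by simp
    have "(\<integral>x. h (x i) \<partial>?P) = (\<Prod>k\<in>J. integral\<^sup>L N (?f k))"
      using product_integral_prod[OF J, of ?f] f prod1[OF i] by simp
    also have "\<dots> = 0" using i J mean by (intro prod_zero bexI[of _ i]) auto
    finally show "(\<integral>x. h (x i) \<partial>?P) = 0" .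
  qed
  have 2: "integrable ?P (\<lambda>x. h (x i) * h (x j))" "(\<integral>x. h (x i) * h (x j) \<partial>?P) = (if i = j then V else 0)"
    if ij: "i \<in> J" "j \<in> J" for i j
  proof -
    let ?f = "\<lambda>k y. (if k = i then h y else 1) * (if k = j then h y else 1)"
    have f: "integrable N (?f k)" for k using h by (cases "k = i"; cases "k = j") (auto simp: power2_eq_square)
    have pr: "(\<Prod>k\<in>J. ?f k (x k)) = h (x i) * h (x j)" for x
      by (simp only: prod.distrib prod1[OF ij(1)] prod1[OF ij(2)])
    show "integrable ?P (\<lambda>x. h (x i) * h (x j))"
      using product_integrable_prod[OF J, of ?f] f pr by simp
    have eq: "(\<integral>x. h (x i) * h (x j) \<partial>?P) = (\<Prod>k\<in>J. integral\<^sup>L N (?f k))"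
      using product_integral_prod[OF J, of ?f] f pr by simp
    show "(\<integral>x. h (x i) * h (x j) \<partial>?P) = (if i = j then V else 0)"
    proof (cases "i = j")
      case True
      have "(\<Prod>k\<in>J. integral\<^sup>L N (?f k)) = (\<Prod>k\<in>J. if k = i then V else 1)"
        using True var by (intro prod.cong) (auto simp: power2_eq_square N.prob_space)
      then show ?thesis unfolding eq using True ij J by (simp add: prod.delta')
    next
      case False
      have "integral\<^sup>L N (?f i) = 0" using False mean by simp
      then show ?thesis using False ij J unfolding eq by (auto intro!: prod_zero bexI[of _ i])
    qed
  qed
  show "integrable ?P (\<lambda>x. \<Sum>j\<in>J. c j * h (x j))" using 1 by auto
  show "(\<integral>x. (\<Sum>j\<in>J. c j * h (x j)) \<partial>?P) = 0" using 1 by (simp add: Bochner_Integration.integral_sum)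
  have sq: "(\<Sum>j\<in>J. c j * h (x j))\<^sup>2 = (\<Sum>i\<in>J. \<Sum>j\<in>J. (c i * c j) * (h (x i) * h (x j)))" for x
    by (simp add: power2_eq_square sum_product mult_ac)
  show "integrable ?P (\<lambda>x. (\<Sum>j\<in>J. c j * h (x j))\<^sup>2)"
    unfolding sq using 2(1) by (intro Bochner_Integration.integrable_sum integrable_mult_right) auto
  have "(\<integral>x. (\<Sum>j\<in>J. c j * h (x j))\<^sup>2 \<partial>?P) = (\<Sum>i\<in>J. \<Sum>j\<in>J. (c i * c j) * (if i = j then V else 0))"
    unfolding sq using 2 by (simp add: Bochner_Integration.integral_sum Bochner_Integration.integrable_sum)
  also have "\<dots> = (\<Sum>i\<in>J. c i * c i * V)"
    using J by (intro sum.cong refl) (simp add: if_distrib[of "\<lambda>x. _ * x"] sum.delta cong: if_cong)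
  finally show "(\<integral>x. (\<Sum>j\<in>J. c j * h (x j))\<^sup>2 \<partial>?P) = V * (\<Sum>j\<in>J. (c j)\<^sup>2)"
    by (simp add: sum_distrib_left power2_eq_square mult_ac)
qed

section \<open>Linear forms and norms of Gaussian vectors and matrices\<close>

lemma measurable_vec_PiM: "Matrix.vec m \<in> (\<Pi>\<^sub>M i\<in>{..<m}. gauss s) \<rightarrow>\<^sub>M borel_vec m"
  by (rule measurable_borel_vecI) auto

lemma measurable_mat_PiM: "Matrix.mat m k \<in> (\<Pi>\<^sub>M ij\<in>{..<m} \<times> {..<k}. gauss s) \<rightarrow>\<^sub>M borel_mat m k"
  by (rule measurable_borel_matI) auto

lemma sets_gauss_vec [simp, measurable_cong]: "sets (gauss_vec s m) = sets (borel_vec m)"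
  by (simp add: gauss_vec_def)

lemma space_gauss_vec [simp]: "space (gauss_vec s m) = carrier_vec m"
  by (simp add: gauss_vec_def)

lemma sets_gauss_mat [simp, measurable_cong]: "sets (gauss_mat s m k) = sets (borel_mat m k)"
  by (simp add: gauss_mat_def)

lemma space_gauss_mat [simp]: "space (gauss_mat s m k) = carrier_mat m k"
  by (simp add: gauss_mat_def)

lemma prob_space_gauss_vec: "0 \<le> s \<Longrightarrow> prob_space (gauss_vec s m)"
  unfolding gauss_vec_def
  by (intro prob_space.prob_space_distr prob_space_PiM prob_space_gauss measurable_vec_PiM)

lemma prob_space_gauss_mat: "0 \<le> s \<Longrightarrow> prob_space (gauss_mat s m k)"
  unfolding gauss_mat_def
  by (intro prob_space.prob_space_distr prob_space_PiM prob_space_gauss measurable_mat_PiM)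

lemma sq_norm_sum: "sq_norm v = (\<Sum>i<dim_vec v. (v $ i)\<^sup>2)"
  by (simp add: sq_norm_def scalar_prod_def atLeast0LessThan power2_eq_square)

lemma sq_norm_nonneg [simp]: "0 \<le> sq_norm v"
  by (simp add: sq_norm_sum sum_nonneg)

lemma centered_normal_gauss_vec:
  assumes s: "0 \<le> s" and c: "c \<in> carrier_vec m"
  shows "centered_normal (gauss_vec s m) (\<lambda>v. c \<bullet> v) (s\<^sup>2 * sq_norm c)"
proof -
  have [measurable]: "(\<lambda>v. c \<bullet> v) \<in> borel_measurable (borel_vec m)"
    using c by (intro measurable_scalar_prod[where m = m]) auto
  have *: "c \<bullet> Matrix.vec m x = (\<Sum>i<m. c $ i * x i)" for x
    by (simp add: scalar_prod_def atLeast0LessThan)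
  show ?thesis
    using centered_normal_PiM[OF s, of "{..<m}" "\<lambda>i. c $ i"] c measurable_vec_PiM[of m s]
    by (simp add: centered_normal_def gauss_vec_def integral_distr * sq_norm_sum)
qed

text \<open>The sum over rows is the Frobenius pairing of \<open>C\<close> with \<open>A\<close>, so
  every linear functional of the matrix has this form.\<close>

lemma centered_normal_gauss_mat:
  assumes s: "0 \<le> s" and C: "C \<in> carrier_mat m k"
  shows "centered_normal (gauss_mat s m k) (\<lambda>A. \<Sum>i<m. Matrix.row C i \<bullet> Matrix.row A i)
    (s\<^sup>2 * (\<Sum>i<m. sq_norm (Matrix.row C i)))"
proof -
  have "(\<lambda>A. C) \<in> borel_mat m k \<rightarrow>\<^sub>M borel_mat m k" using C by simp
  then have [measurable]: "(\<lambda>A. \<Sum>i<m. Matrix.row C i \<bullet> Matrix.row A i) \<in> borel_measurable (borel_mat m k)"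
    by (intro borel_measurable_sum measurable_scalar_prod[where m = k] measurable_mat_row) auto
  have *: "(\<Sum>i<m. Matrix.row C i \<bullet> Matrix.row (Matrix.mat m k x) i) = (\<Sum>ij\<in>{..<m} \<times> {..<k}. C $$ ij * x ij)" for x
  proof -
    have "(\<Sum>i<m. Matrix.row C i \<bullet> Matrix.row (Matrix.mat m k x) i) = (\<Sum>i<m. \<Sum>j<k. C $$ (i, j) * x (i, j))"
      using C by (auto simp: scalar_prod_def atLeast0LessThan intro!: sum.cong)
    then show ?thesis by (simp add: sum.cartesian_product split_def)
  qed
  have **: "(\<Sum>i<m. sq_norm (Matrix.row C i)) = (\<Sum>ij\<in>{..<m} \<times> {..<k}. (C $$ ij)\<^sup>2)"
  proof -
    have "(\<Sum>i<m. sq_norm (Matrix.row C i)) = (\<Sum>i<m. \<Sum>j<k. (C $$ (i, j))\<^sup>2)"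
      using C by (auto simp: sq_norm_sum intro!: sum.cong)
    then show ?thesis by (simp add: sum.cartesian_product split_def)
  qed
  have "(CLINT A|gauss_mat s m k. iexp (\<Sum>i<m. Matrix.row C i \<bullet> Matrix.row A i)) =
      (CLINT x|(\<Pi>\<^sub>M ij\<in>{..<m} \<times> {..<k}. gauss s). iexp (\<Sum>ij\<in>{..<m} \<times> {..<k}. C $$ ij * x ij))"
    unfolding gauss_mat_def *[symmetric]
    by (rule integral_distr[OF measurable_mat_PiM]) measurable
  then show ?thesis
    using centered_normal_PiM[OF s, of "{..<m} \<times> {..<k}" "\<lambda>ij. C $$ ij"]
    by (simp add: centered_normal_def ** del: of_real_sum)
qed

lemma integrable_gauss_vec:
  fixes f :: "real vec \<Rightarrow> real"
  shows "f \<in> borel_measurable (borel_vec m) \<Longrightarrow>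
    integrable (gauss_vec s m) f \<longleftrightarrow> integrable (\<Pi>\<^sub>M i\<in>{..<m}. gauss s) (\<lambda>x. f (Matrix.vec m x))"
  unfolding gauss_vec_def by (rule integrable_distr_eq[OF measurable_vec_PiM])

lemma integral_gauss_vec:
  fixes f :: "real vec \<Rightarrow> real"
  shows "f \<in> borel_measurable (borel_vec m) \<Longrightarrow>
    (\<integral>v. f v \<partial>gauss_vec s m) = (\<integral>x. f (Matrix.vec m x) \<partial>(\<Pi>\<^sub>M i\<in>{..<m}. gauss s))"
  unfolding gauss_vec_def by (rule integral_distr[OF measurable_vec_PiM])

lemma gauss_vec_linear:
  assumes s: "0 \<le> s" and c: "c \<in> carrier_vec m"
  shows "integrable (gauss_vec s m) (\<lambda>v. c \<bullet> v)"
    and "(\<integral>v. c \<bullet> v \<partial>gauss_vec s m) = 0"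
    and "integrable (gauss_vec s m) (\<lambda>v. (c \<bullet> v)\<^sup>2)"
    and "(\<integral>v. (c \<bullet> v)\<^sup>2 \<partial>gauss_vec s m) = s\<^sup>2 * sq_norm c"
proof -
  have [measurable]: "(\<lambda>v. c \<bullet> v) \<in> borel_measurable (borel_vec m)"
    using c by (intro measurable_scalar_prod[where m = m]) auto
  have *: "c \<bullet> Matrix.vec m x = (\<Sum>i<m. c $ i * x i)" for x
    by (simp add: scalar_prod_def atLeast0LessThan)
  have h: "integrable (gauss s) (\<lambda>x. x)" "integrable (gauss s) (\<lambda>x. x\<^sup>2)"
    using gauss_moments(1)[OF s, of 1] gauss_moments(1)[OF s, of 2] by simp_all
  note P = PiM_sum_square[OF prob_space_gauss[OF s] finite_lessThan[of m] h gauss_moments(2,3)[OF s], of "\<lambda>i. c $ i"]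
  show "integrable (gauss_vec s m) (\<lambda>v. c \<bullet> v)"
    by (subst integrable_gauss_vec) (simp_all only: * P(1), measurable)
  show "(\<integral>v. c \<bullet> v \<partial>gauss_vec s m) = 0"
    by (subst integral_gauss_vec) (simp_all only: * P(2), measurable)
  show "integrable (gauss_vec s m) (\<lambda>v. (c \<bullet> v)\<^sup>2)"
    by (subst integrable_gauss_vec) (simp_all only: * P(3), measurable)
  have "(\<Sum>i<m. (c $ i)\<^sup>2) = sq_norm c" using c by (simp add: sq_norm_sum)
  then show "(\<integral>v. (c \<bullet> v)\<^sup>2 \<partial>gauss_vec s m) = s\<^sup>2 * sq_norm c"
    by (subst integral_gauss_vec) (simp_all only: * P(4), measurable)
qed

text \<open>The squared norm is a sum of \<open>m\<close> independent squares, each of variance 3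
  s^4 - s^4 = 2 s^4. That the variance is only linear in \<open>m\<close> is what makes
  \<open>q\<close> concentrate.\<close>

lemma gauss_vec_sq_norm:
  assumes s: "0 \<le> s"
  shows "integrable (gauss_vec s m) sq_norm"
    and "(\<integral>v. sq_norm v \<partial>gauss_vec s m) = real m * s\<^sup>2"
    and "integrable (gauss_vec s m) (\<lambda>v. (sq_norm v - real m * s\<^sup>2)\<^sup>2)"
    and "(\<integral>v. (sq_norm v - real m * s\<^sup>2)\<^sup>2 \<partial>gauss_vec s m) = 2 * real m * s ^ 4"
proof -
  interpret G: prob_space "gauss s" by (rule prob_space_gauss[OF s])
  interpret P: prob_space "\<Pi>\<^sub>M i\<in>{..<m}. gauss s" by (intro prob_space_PiM prob_space_gauss s)
  have [measurable]: "sq_norm \<in> borel_measurable (borel_vec m)"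
    by (intro measurable_sq_norm[where m = m]) auto
  let ?h = "\<lambda>x::real. x\<^sup>2 - s\<^sup>2"
  have *: "sq_norm (Matrix.vec m x) - real m * s\<^sup>2 = (\<Sum>i<m. 1 * ?h (x i))" for x
    by (simp add: sq_norm_sum sum_subtractf)
  have eq: "(?h x)\<^sup>2 = x ^ 4 - 2 * s\<^sup>2 * x\<^sup>2 + s ^ 4" for x
    by (simp add: power2_eq_square power4_eq_xxxx algebra_simps)
  have h: "integrable (gauss s) ?h" "(\<integral>x. ?h x \<partial>gauss s) = 0"
    using gauss_moments(1)[OF s, of 2] gauss_moments(3)[OF s] by (simp_all add: G.prob_space[simplified])
  have h2: "integrable (gauss s) (\<lambda>x. (?h x)\<^sup>2)"
    unfolding eq using gauss_moments(1)[OF s, of 2] gauss_moments(1)[OF s, of 4] by simp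
  have "(\<integral>x. (?h x)\<^sup>2 \<partial>gauss s) = 3 * s ^ 4 - 2 * s\<^sup>2 * s\<^sup>2 + s ^ 4"
    unfolding eq using gauss_moments(1)[OF s, of 2] gauss_moments(1)[OF s, of 4] gauss_moments(3,4)[OF s]
    by (simp add: G.prob_space[simplified])
  also have "\<dots> = 2 * s ^ 4" by (simp add: power2_eq_square power4_eq_xxxx)
  finally have V: "(\<integral>x. (?h x)\<^sup>2 \<partial>gauss s) = 2 * s ^ 4" .
  note P = PiM_sum_square[OF prob_space_gauss[OF s] finite_lessThan[of m] h(1) h2 h(2) V, of "\<lambda>_. 1"]
  have i: "integrable (gauss_vec s m) (\<lambda>v. sq_norm v - real m * s\<^sup>2)"
    by (subst integrable_gauss_vec) (simp_all only: * P(1), measurable)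
  interpret GV: prob_space "gauss_vec s m" by (rule prob_space_gauss_vec[OF s])
  have "integrable (gauss_vec s m) (\<lambda>v. (sq_norm v - real m * s\<^sup>2) + real m * s\<^sup>2)"
    by (rule Bochner_Integration.integrable_add[OF i]) simp
  then show sqi: "integrable (gauss_vec s m) sq_norm" by simp
  have "(\<integral>v. sq_norm v - real m * s\<^sup>2 \<partial>gauss_vec s m) = 0"
    by (subst integral_gauss_vec) (simp_all only: * P(2), measurable)
  then show "(\<integral>v. sq_norm v \<partial>gauss_vec s m) = real m * s\<^sup>2"
    using sqi by (simp add: GV.prob_space[simplified])
  show "integrable (gauss_vec s m) (\<lambda>v. (sq_norm v - real m * s\<^sup>2)\<^sup>2)"
    by (subst integrable_gauss_vec) (simp_all only: * P(3), measurable)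
  have "(\<integral>v. (sq_norm v - real m * s\<^sup>2)\<^sup>2 \<partial>gauss_vec s m) = 2 * s ^ 4 * (\<Sum>i<m. 1\<^sup>2)"
    by (subst integral_gauss_vec) (simp_all only: * P(4), measurable)
  then show "(\<integral>v. (sq_norm v - real m * s\<^sup>2)\<^sup>2 \<partial>gauss_vec s m) = 2 * real m * s ^ 4" by simp
qed

section \<open>Equality of Gaussian laws from equality of variances\<close>

lemma centered_normal_cong:
  "(\<And>x. x \<in> space M \<Longrightarrow> f x = g x) \<Longrightarrow> centered_normal M f v \<longleftrightarrow> centered_normal M g v"
  by (simp add: centered_normal_def cong: measurable_cong Bochner_Integration.integral_cong)

text \<open>Carries the uniqueness theorem from product spaces to spaces with coordinates:
  \<open>\<phi>\<close> reads them off and \<open>r\<close> rebuilds the point from them. A common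
  variance \<open>v\<close> for each linear form stands for equal characteristic functions.\<close>

lemma distr_eqI_coords:
  fixes \<phi> :: "'i \<Rightarrow> 's \<Rightarrow> real" and r :: "('i \<Rightarrow> real) \<Rightarrow> 's"
  assumes I: "finite I" and M: "prob_space M" and N: "prob_space N"
    and f [measurable]: "f \<in> M \<rightarrow>\<^sub>M S" and g [measurable]: "g \<in> N \<rightarrow>\<^sub>M S"
    and \<phi>: "\<And>i. i \<in> I \<Longrightarrow> \<phi> i \<in> borel_measurable S"
    and r [measurable]: "r \<in> (\<Pi>\<^sub>M i\<in>I. borel) \<rightarrow>\<^sub>M S" and r\<phi>: "\<And>x. x \<in> space S \<Longrightarrow> r (\<lambda>i\<in>I. \<phi> i x) = x"
    and cn: "\<And>t. \<exists>v. centered_normal M (\<lambda>\<omega>. \<Sum>i\<in>I. t i * \<phi> i (f \<omega>)) v \<and>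
      centered_normal N (\<lambda>\<omega>. \<Sum>i\<in>I. t i * \<phi> i (g \<omega>)) v"
  shows "distr M S f = distr N S g"
proof -
  interpret M: prob_space M by (rule M)
  interpret N: prob_space N by (rule N)
  define F where "F \<omega> = (\<lambda>i\<in>I. \<phi> i (f \<omega>))" for \<omega>
  define G where "G \<omega> = (\<lambda>i\<in>I. \<phi> i (g \<omega>))" for \<omega>
  have F [measurable]: "F \<in> M \<rightarrow>\<^sub>M (\<Pi>\<^sub>M i\<in>I. borel)"
    unfolding F_def by (intro measurable_restrict measurable_compose[OF f \<phi>])
  have G [measurable]: "G \<in> N \<rightarrow>\<^sub>M (\<Pi>\<^sub>M i\<in>I. borel)"
    unfolding G_def by (intro measurable_restrict measurable_compose[OF g \<phi>])
  have meas: "(\<lambda>x. iexp (\<Sum>i\<in>I. t i * x i)) \<in> borel_measurable (\<Pi>\<^sub>M i\<in>I. borel)" for t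
    by (intro borel_measurable_exp[THEN measurable_compose[rotated]]) measurable
  have "distr M (\<Pi>\<^sub>M i\<in>I. borel) F = distr N (\<Pi>\<^sub>M i\<in>I. borel) G"
  proof (rule measure_eqI_PiM_char[OF I])
    fix t
    obtain v where v: "centered_normal M (\<lambda>\<omega>. \<Sum>i\<in>I. t i * \<phi> i (f \<omega>)) v"
      "centered_normal N (\<lambda>\<omega>. \<Sum>i\<in>I. t i * \<phi> i (g \<omega>)) v" using cn by blast
    have "(CLINT x|distr M (\<Pi>\<^sub>M i\<in>I. borel) F. iexp (\<Sum>i\<in>I. t i * x i)) = (CLINT \<omega>|M. iexp (\<Sum>i\<in>I. t i * F \<omega> i))"
      by (rule integral_distr[OF F meas])
    moreover have "(CLINT x|distr N (\<Pi>\<^sub>M i\<in>I. borel) G. iexp (\<Sum>i\<in>I. t i * x i)) = (CLINT \<omega>|N. iexp (\<Sum>i\<in>I. t i * G \<omega> i))"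
      by (rule integral_distr[OF G meas])
    moreover have "(\<Sum>i\<in>I. t i * F \<omega> i) = (\<Sum>i\<in>I. t i * \<phi> i (f \<omega>))" for \<omega>
      unfolding F_def by (intro sum.cong) auto
    moreover have "(\<Sum>i\<in>I. t i * G \<omega> i) = (\<Sum>i\<in>I. t i * \<phi> i (g \<omega>))" for \<omega>
      unfolding G_def by (intro sum.cong) auto
    ultimately show "(CLINT x|distr M (\<Pi>\<^sub>M i\<in>I. borel) F. iexp (\<Sum>i\<in>I. t i * x i)) =
        (CLINT x|distr N (\<Pi>\<^sub>M i\<in>I. borel) G. iexp (\<Sum>i\<in>I. t i * x i))"
      using v by (simp only: centered_normal_def)
  qed (auto intro!: M.prob_space_distr N.prob_space_distr)
  moreover have "distr M S f = distr (distr M (\<Pi>\<^sub>M i\<in>I. borel) F) S r"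
    using measurable_space[OF f] by (subst distr_distr) (auto simp: F_def r\<phi> intro!: distr_cong)
  moreover have "distr N S g = distr (distr N (\<Pi>\<^sub>M i\<in>I. borel) G) S r"
    using measurable_space[OF g] by (subst distr_distr) (auto simp: G_def r\<phi> intro!: distr_cong)
  ultimately show ?thesis by simp
qed

text \<open>The coordinates of a pair are indexed by a disjoint sum. Equality of two Gaussian laws
  on pairs becomes one variance computation for each pair of test vectors.\<close>

lemma distr_eqI_vec_vec:
  assumes M: "prob_space M" and N: "prob_space N"
    and f: "f \<in> M \<rightarrow>\<^sub>M borel_vec m \<Otimes>\<^sub>M borel_vec k" and g: "g \<in> N \<rightarrow>\<^sub>M borel_vec m \<Otimes>\<^sub>M borel_vec k"
    and cn: "\<And>a b. a \<in> carrier_vec m \<Longrightarrow> b \<in> carrier_vec k \<Longrightarrow>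
      \<exists>v. centered_normal M (\<lambda>\<omega>. a \<bullet> fst (f \<omega>) + b \<bullet> snd (f \<omega>)) v \<and>
          centered_normal N (\<lambda>\<omega>. a \<bullet> fst (g \<omega>) + b \<bullet> snd (g \<omega>)) v"
  shows "distr M (borel_vec m \<Otimes>\<^sub>M borel_vec k) f = distr N (borel_vec m \<Otimes>\<^sub>M borel_vec k) g"
proof (rule distr_eqI_coords[where I = "{..<m} <+> {..<k}" and \<phi> = "case_sum (\<lambda>i x. fst x $ i) (\<lambda>j x. snd x $ j)"
      and r = "\<lambda>x. (Matrix.vec m (\<lambda>i. x (Inl i)), Matrix.vec k (\<lambda>j. x (Inr j)))"])
  show "case_sum (\<lambda>i x. fst x $ i) (\<lambda>j x. snd x $ j) i \<in> borel_measurable (borel_vec m \<Otimes>\<^sub>M borel_vec k)"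
    if "i \<in> {..<m} <+> {..<k}" for i
    using that by (auto intro!: measurable_vec_entry[OF measurable_fst] measurable_vec_entry[OF measurable_snd])
  show "(\<lambda>x. (Matrix.vec m (\<lambda>i. x (Inl i)), Matrix.vec k (\<lambda>j. x (Inr j))))
      \<in> (\<Pi>\<^sub>M i\<in>{..<m} <+> {..<k}. borel) \<rightarrow>\<^sub>M borel_vec m \<Otimes>\<^sub>M borel_vec k"
    by (intro measurable_Pair measurable_borel_vecI) (auto intro!: measurable_component_singleton)
  fix t :: "nat + nat \<Rightarrow> real"
  have eq: "(\<Sum>i\<in>{..<m} <+> {..<k}. t i * case_sum (\<lambda>i x. fst x $ i) (\<lambda>j x. snd x $ j) i y) =
      Matrix.vec m (\<lambda>i. t (Inl i)) \<bullet> fst y + Matrix.vec k (\<lambda>j. t (Inr j)) \<bullet> snd y"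
    if "y \<in> space (borel_vec m \<Otimes>\<^sub>M borel_vec k)" for y
    using that by (cases y) (auto simp: space_pair_measure sum.Plus scalar_prod_def atLeast0LessThan)
  show "\<exists>v. centered_normal M (\<lambda>\<omega>. \<Sum>i\<in>{..<m} <+> {..<k}. t i * case_sum (\<lambda>i x. fst x $ i) (\<lambda>j x. snd x $ j) i (f \<omega>)) v \<and>
      centered_normal N (\<lambda>\<omega>. \<Sum>i\<in>{..<m} <+> {..<k}. t i * case_sum (\<lambda>i x. fst x $ i) (\<lambda>j x. snd x $ j) i (g \<omega>)) v"
    using cn[of "Matrix.vec m (\<lambda>i. t (Inl i))" "Matrix.vec k (\<lambda>j. t (Inr j))"]
    by (simp add: eq measurable_space[OF f] measurable_space[OF g] cong: centered_normal_cong)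
qed (use assms in \<open>auto simp: space_pair_measure\<close>)

lemma distr_eqI_mat_vec:
  assumes M: "prob_space M" and N: "prob_space N"
    and f: "f \<in> M \<rightarrow>\<^sub>M borel_mat m k \<Otimes>\<^sub>M borel_vec l" and g: "g \<in> N \<rightarrow>\<^sub>M borel_mat m k \<Otimes>\<^sub>M borel_vec l"
    and cn: "\<And>T a. T \<in> carrier_mat m k \<Longrightarrow> a \<in> carrier_vec l \<Longrightarrow>
      \<exists>v. centered_normal M (\<lambda>\<omega>. (\<Sum>i<m. Matrix.row T i \<bullet> Matrix.row (fst (f \<omega>)) i) + a \<bullet> snd (f \<omega>)) v \<and>
          centered_normal N (\<lambda>\<omega>. (\<Sum>i<m. Matrix.row T i \<bullet> Matrix.row (fst (g \<omega>)) i) + a \<bullet> snd (g \<omega>)) v"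
  shows "distr M (borel_mat m k \<Otimes>\<^sub>M borel_vec l) f = distr N (borel_mat m k \<Otimes>\<^sub>M borel_vec l) g"
proof (rule distr_eqI_coords[where I = "({..<m} \<times> {..<k}) <+> {..<l}"
      and \<phi> = "case_sum (\<lambda>ij x. fst x $$ ij) (\<lambda>j x. snd x $ j)"
      and r = "\<lambda>x. (Matrix.mat m k (\<lambda>ij. x (Inl ij)), Matrix.vec l (\<lambda>j. x (Inr j)))"])
  show "case_sum (\<lambda>i x. fst x $$ i) (\<lambda>j x. snd x $ j) i \<in> borel_measurable (borel_mat m k \<Otimes>\<^sub>M borel_vec l)"
    if "i \<in> ({..<m} \<times> {..<k}) <+> {..<l}" for i
    using that by (auto intro!: measurable_mat_entry[OF measurable_fst] measurable_vec_entry[OF measurable_snd])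
  show "(\<lambda>x. (Matrix.mat m k (\<lambda>i. x (Inl i)), Matrix.vec l (\<lambda>j. x (Inr j))))
      \<in> (\<Pi>\<^sub>M i\<in>({..<m} \<times> {..<k}) <+> {..<l}. borel) \<rightarrow>\<^sub>M borel_mat m k \<Otimes>\<^sub>M borel_vec l"
    by (intro measurable_Pair measurable_borel_vecI measurable_borel_matI) (auto intro!: measurable_component_singleton)
  fix t :: "nat \<times> nat + nat \<Rightarrow> real"
  have eq: "(\<Sum>i\<in>({..<m} \<times> {..<k}) <+> {..<l}. t i * case_sum (\<lambda>i x. fst x $$ i) (\<lambda>j x. snd x $ j) i y) =
      (\<Sum>i<m. Matrix.row (Matrix.mat m k (\<lambda>ij. t (Inl ij))) i \<bullet> Matrix.row (fst y) i) + Matrix.vec l (\<lambda>j. t (Inr j)) \<bullet> snd y"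
    if y: "y \<in> space (borel_mat m k \<Otimes>\<^sub>M borel_vec l)" for y
  proof -
    have "(\<Sum>i<m. Matrix.row (Matrix.mat m k (\<lambda>ij. t (Inl ij))) i \<bullet> Matrix.row (fst y) i)
        = (\<Sum>i<m. \<Sum>j<k. t (Inl (i, j)) * fst y $$ (i, j))"
      using y by (intro sum.cong refl) (auto simp: scalar_prod_def atLeast0LessThan space_pair_measure)
    then show ?thesis
      using y by (auto simp: space_pair_measure sum.Plus scalar_prod_def atLeast0LessThan sum.cartesian_product split_def)
  qed
  show "\<exists>v. centered_normal M (\<lambda>\<omega>. \<Sum>i\<in>({..<m} \<times> {..<k}) <+> {..<l}. t i * case_sum (\<lambda>i x. fst x $$ i) (\<lambda>j x. snd x $ j) i (f \<omega>)) v \<and>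
      centered_normal N (\<lambda>\<omega>. \<Sum>i\<in>({..<m} \<times> {..<k}) <+> {..<l}. t i * case_sum (\<lambda>i x. fst x $$ i) (\<lambda>j x. snd x $ j) i (g \<omega>)) v"
    using cn[of "Matrix.mat m k (\<lambda>ij. t (Inl ij))" "Matrix.vec l (\<lambda>j. t (Inr j))"]
    by (simp add: eq measurable_space[OF f] measurable_space[OF g] cong: centered_normal_cong)
qed (use assms in \<open>auto simp: space_pair_measure\<close>)

section \<open>Laws of Gaussian designs\<close>

lemma sq_norm_add:
  assumes "u \<in> carrier_vec m" "v \<in> carrier_vec m"
  shows "sq_norm (u + v) = sq_norm u + 2 * (u \<bullet> v) + sq_norm v"
  unfolding sq_norm_def using assms comm_scalar_prod[OF assms]
  by (simp add: scalar_prod_add_distrib[of _ m] add_scalar_prod_distrib[of _ m])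

lemma sq_norm_minus:
  assumes "u \<in> carrier_vec m" "v \<in> carrier_vec m"
  shows "sq_norm (u - v) = sq_norm u - 2 * (u \<bullet> v) + sq_norm v"
  unfolding sq_norm_def using assms comm_scalar_prod[OF assms]
  by (simp add: scalar_prod_minus_distrib[of _ m] minus_scalar_prod_distrib[of _ m])

lemma sq_norm_smult: "sq_norm (c \<cdot>\<^sub>v v) = c\<^sup>2 * sq_norm v"
  by (simp add: sq_norm_sum power_mult_distrib sum_distrib_left)

lemma sq_norm_eq_0_iff: "v \<in> carrier_vec m \<Longrightarrow> sq_norm v = 0 \<longleftrightarrow> v = 0\<^sub>v m"
  by (auto simp: sq_norm_sum sum_nonneg_eq_0_iff)

lemma scalar_prod_le_sq_norm:
  assumes "u \<in> carrier_vec m" "v \<in> carrier_vec m"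
  shows "(u \<bullet> v)\<^sup>2 \<le> sq_norm u * sq_norm v"
  using Cauchy_Schwarz_ineq_sum[of "\<lambda>i. u $ i" "\<lambda>i. v $ i" "{..<m}"] assms
  by (simp add: sq_norm_sum scalar_prod_def atLeast0LessThan)

lemma row_mult_transpose:
  fixes A B :: "real mat"
  assumes A: "A \<in> carrier_mat n d" and B: "B \<in> carrier_mat p d" and i: "i < n"
  shows "Matrix.row (A * B\<^sup>T) i = B *\<^sub>v Matrix.row A i"
  using assms by (intro eq_vecI) (auto intro!: comm_scalar_prod[of _ d])

section \<open>Geometry of a matrix with orthonormal rows, and the laws it induces\<close>

context
  fixes w :: "real mat" and p d :: nat
  assumes w: "w \<in> carrier_mat p d" and ww: "w * w\<^sup>T = 1\<^sub>m p"
begin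

lemma stiefel_mult: "t \<in> carrier_vec p \<Longrightarrow> w *\<^sub>v (w\<^sup>T *\<^sub>v t) = t"
  using w ww assoc_mult_mat_vec[of w p d "w\<^sup>T" p t] by simp

lemma stiefel_adjoint:
  "t \<in> carrier_vec p \<Longrightarrow> x \<in> carrier_vec d \<Longrightarrow> (w\<^sup>T *\<^sub>v t) \<bullet> x = t \<bullet> (w *\<^sub>v x)"
  using transpose_vec_mult_scalar[OF w, of x t] by simp

lemma stiefel_sq_norm: "t \<in> carrier_vec p \<Longrightarrow> sq_norm (w\<^sup>T *\<^sub>v t) = sq_norm t"
  using w by (simp add: sq_norm_def stiefel_adjoint stiefel_mult)

text \<open>The orthogonal projection onto the kernel of \<open>w\<close>: as the rows of
  \<open>w\<close> are orthonormal, \<open>w\<^sup>T * w\<close> projects onto the row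
  space.\<close>

definition resid :: "real vec \<Rightarrow> real vec" where
  "resid x = x - w\<^sup>T *\<^sub>v (w *\<^sub>v x)"

lemma resid_carrier [simp]: "x \<in> carrier_vec d \<Longrightarrow> resid x \<in> carrier_vec d"
  using w by (simp add: resid_def)

lemma mult_resid: "x \<in> carrier_vec d \<Longrightarrow> w *\<^sub>v resid x = 0\<^sub>v p"
  using w by (simp add: resid_def mult_minus_distrib_mat_vec[OF w] stiefel_mult)

lemma resid_adjoint:
  assumes "x \<in> carrier_vec d" "y \<in> carrier_vec d"
  shows "resid x \<bullet> y = x \<bullet> resid y"
proof -
  have "(w\<^sup>T *\<^sub>v (w *\<^sub>v x)) \<bullet> y = (w *\<^sub>v x) \<bullet> (w *\<^sub>v y)"
    using w assms by (simp add: stiefel_adjoint)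
  also have "\<dots> = (w\<^sup>T *\<^sub>v (w *\<^sub>v y)) \<bullet> x"
    using w assms by (simp add: stiefel_adjoint comm_scalar_prod[of "w *\<^sub>v x" p])
  also have "\<dots> = x \<bullet> (w\<^sup>T *\<^sub>v (w *\<^sub>v y))"
    using w assms by (simp add: comm_scalar_prod[of x d])
  finally show ?thesis
    using w assms by (simp add: resid_def scalar_prod_minus_distrib[of _ d] minus_scalar_prod_distrib[of _ d])
qed

text \<open>Pythagoras. It identifies \<open>q\<close> with the squared norm of the part of
  \<open>\<theta>\<close> that \<open>w\<close> does not see, so that \<open>q\<close> is
  nonnegative.\<close>

lemma sq_norm_resid: "x \<in> carrier_vec d \<Longrightarrow> sq_norm (resid x) = sq_norm x - sq_norm (w *\<^sub>v x)"
  using w stiefel_adjoint[of "w *\<^sub>v x" x]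
  by (simp add: resid_def sq_norm_minus[of _ d] stiefel_sq_norm comm_scalar_prod[of x d])
    (simp add: sq_norm_def)

lemma resid_decomp: "x \<in> carrier_vec d \<Longrightarrow> x = w\<^sup>T *\<^sub>v (w *\<^sub>v x) + resid x"
  using w by (intro eq_vecI) (auto simp: resid_def)

text \<open>
  The product \<open>x w\<^sup>T\<close> is independent of \<open>x z\<close> for \<open>z\<close> in the kernel of \<open>w\<close>, so that \<open>x z\<close>
  acts as additional noise.
\<close>

lemma law_design_noise:
  assumes \<sigma>: "0 \<le> \<sigma>" and z: "z \<in> carrier_vec d" and wz: "w *\<^sub>v z = 0\<^sub>v p"
  shows "distr (gauss_mat 1 n d \<Otimes>\<^sub>M gauss_vec \<sigma> n) (borel_mat n p \<Otimes>\<^sub>M borel_vec n) (\<lambda>x. (fst x * w\<^sup>T, fst x *\<^sub>v z + snd x)) =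
    distr (gauss_mat 1 n p \<Otimes>\<^sub>M gauss_vec 1 n) (borel_mat n p \<Otimes>\<^sub>M borel_vec n) (\<lambda>x. (fst x, sqrt (sq_norm z + \<sigma>\<^sup>2) \<cdot>\<^sub>v snd x))"
proof (rule distr_eqI_mat_vec)
  have [measurable]: "(\<lambda>x. w\<^sup>T) \<in> M \<rightarrow>\<^sub>M borel_mat d p" "(\<lambda>x. z) \<in> M \<rightarrow>\<^sub>M borel_vec d" for M :: "'a measure"
    using w z by auto
  show "(\<lambda>x. (fst x * w\<^sup>T, fst x *\<^sub>v z + snd x)) \<in> gauss_mat 1 n d \<Otimes>\<^sub>M gauss_vec \<sigma> n \<rightarrow>\<^sub>M borel_mat n p \<Otimes>\<^sub>M borel_vec n"
    by measurable
  show "(\<lambda>x. (fst x, sqrt (sq_norm z + \<sigma>\<^sup>2) \<cdot>\<^sub>v snd x)) \<in> gauss_mat 1 n p \<Otimes>\<^sub>M gauss_vec 1 n \<rightarrow>\<^sub>M borel_mat n p \<Otimes>\<^sub>M borel_vec n"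
    by measurable
  show "prob_space (gauss_mat 1 n d \<Otimes>\<^sub>M gauss_vec \<sigma> n)" "prob_space (gauss_mat 1 n p \<Otimes>\<^sub>M gauss_vec 1 n)"
    using \<sigma> by (intro prob_space_pair prob_space_gauss_mat prob_space_gauss_vec; simp)+
  fix T :: "real mat" and a :: "real vec" assume T: "T \<in> carrier_mat n p" and a: "a \<in> carrier_vec n"
  let ?s2 = "sq_norm z + \<sigma>\<^sup>2"
  \<comment> \<open>The adjoint test matrix: pairing \<open>T\<close> with
    \<open>x * w\<^sup>T\<close> and \<open>a\<close> with \<open>x *\<^sub>v z\<close> amounts to
    pairing \<open>C\<close> with \<open>x\<close>.\<close>
  define C where "C = T * w + Matrix.mat n d (\<lambda>(i, j). a $ i * z $ j)"
  have C: "C \<in> carrier_mat n d" using T w by (simp add: C_def)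
  have rowC: "Matrix.row C i = w\<^sup>T *\<^sub>v Matrix.row T i + (a $ i) \<cdot>\<^sub>v z" if "i < n" for i
    using that T w z a by (intro eq_vecI) (auto simp: C_def intro!: comm_scalar_prod[of _ p])
  have norm_rowC: "sq_norm (Matrix.row C i) = sq_norm (Matrix.row T i) + (a $ i)\<^sup>2 * sq_norm z" if i: "i < n" for i
  proof -
    have Ti: "Matrix.row T i \<in> carrier_vec p" using T by auto
    \<comment> \<open>The cross term between seen and unseen directions vanishes because
      \<open>z\<close> lies in the kernel of \<open>w\<close>; this is the asserted
      independence.\<close>
    have "(w\<^sup>T *\<^sub>v Matrix.row T i) \<bullet> ((a $ i) \<cdot>\<^sub>v z) = a $ i * (Matrix.row T i \<bullet> (w *\<^sub>v z))"
      using Ti z w by (simp add: stiefel_adjoint)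
    also have "\<dots> = 0" using Ti by (simp add: wz)
    finally show ?thesis
      using rowC[OF i] Ti z w by (simp add: sq_norm_add[of _ d] stiefel_sq_norm sq_norm_smult)
  qed
  have lin: "(\<Sum>i<n. Matrix.row T i \<bullet> Matrix.row (x * w\<^sup>T) i) + a \<bullet> (x *\<^sub>v z + e) =
      (\<Sum>i<n. Matrix.row C i \<bullet> Matrix.row x i) + a \<bullet> e" if x: "x \<in> carrier_mat n d" and e: "e \<in> carrier_vec n" for x e
  proof -
    have "Matrix.row C i \<bullet> Matrix.row x i = Matrix.row T i \<bullet> Matrix.row (x * w\<^sup>T) i + a $ i * (x *\<^sub>v z) $ i"
      if i: "i < n" for i
    proof -
      have c: "Matrix.row T i \<in> carrier_vec p" "Matrix.row x i \<in> carrier_vec d" using T x by auto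
      show ?thesis
        unfolding rowC[OF i] row_mult_transpose[OF x w i] using c z w x i
        by (simp add: add_scalar_prod_distrib[of _ d] stiefel_adjoint comm_scalar_prod[of z d])
    qed
    then have "(\<Sum>i<n. Matrix.row C i \<bullet> Matrix.row x i) =
        (\<Sum>i<n. Matrix.row T i \<bullet> Matrix.row (x * w\<^sup>T) i) + (\<Sum>i<n. a $ i * (x *\<^sub>v z) $ i)"
      by (simp add: sum.distrib)
    also have "(\<Sum>i<n. a $ i * (x *\<^sub>v z) $ i) = a \<bullet> (x *\<^sub>v z)"
      using x by (simp add: scalar_prod_def atLeast0LessThan)
    finally show ?thesis using a x z e by (simp add: scalar_prod_add_distrib[of _ n])
  qed
  have "centered_normal (gauss_mat 1 n d \<Otimes>\<^sub>M gauss_vec \<sigma> n)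
      (\<lambda>x. (\<Sum>i<n. Matrix.row C i \<bullet> Matrix.row (fst x) i) + a \<bullet> snd x)
      (1\<^sup>2 * (\<Sum>i<n. sq_norm (Matrix.row C i)) + \<sigma>\<^sup>2 * sq_norm a)"
    using \<sigma> C a by (intro centered_normal_pair prob_space_gauss_mat prob_space_gauss_vec
        centered_normal_gauss_mat centered_normal_gauss_vec) auto
  also have "1\<^sup>2 * (\<Sum>i<n. sq_norm (Matrix.row C i)) + \<sigma>\<^sup>2 * sq_norm a =
      (\<Sum>i<n. sq_norm (Matrix.row T i)) + ?s2 * sq_norm a"
    using a by (simp add: norm_rowC sum.distrib sq_norm_sum[of a] algebra_simps flip: sum_distrib_left)
  finally have 1: "centered_normal (gauss_mat 1 n d \<Otimes>\<^sub>M gauss_vec \<sigma> n)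
      (\<lambda>x. (\<Sum>i<n. Matrix.row T i \<bullet> Matrix.row (fst (fst x * w\<^sup>T, fst x *\<^sub>v z + snd x)) i) + a \<bullet> snd (fst x * w\<^sup>T, fst x *\<^sub>v z + snd x))
      ((\<Sum>i<n. sq_norm (Matrix.row T i)) + ?s2 * sq_norm a)"
    by (rule centered_normal_cong[THEN iffD1, rotated]) (auto simp: space_pair_measure lin)
  have "centered_normal (gauss_mat 1 n p \<Otimes>\<^sub>M gauss_vec 1 n)
      (\<lambda>x. (\<Sum>i<n. Matrix.row T i \<bullet> Matrix.row (fst x) i) + (sqrt ?s2 \<cdot>\<^sub>v a) \<bullet> snd x)
      (1\<^sup>2 * (\<Sum>i<n. sq_norm (Matrix.row T i)) + 1\<^sup>2 * sq_norm (sqrt ?s2 \<cdot>\<^sub>v a))"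
    using T a by (intro centered_normal_pair prob_space_gauss_mat prob_space_gauss_vec
        centered_normal_gauss_mat centered_normal_gauss_vec) auto
  also have "1\<^sup>2 * (\<Sum>i<n. sq_norm (Matrix.row T i)) + 1\<^sup>2 * sq_norm (sqrt ?s2 \<cdot>\<^sub>v a) =
      (\<Sum>i<n. sq_norm (Matrix.row T i)) + ?s2 * sq_norm a"
    by (simp add: sq_norm_smult)
  finally have 2: "centered_normal (gauss_mat 1 n p \<Otimes>\<^sub>M gauss_vec 1 n)
      (\<lambda>x. (\<Sum>i<n. Matrix.row T i \<bullet> Matrix.row (fst (fst x, sqrt ?s2 \<cdot>\<^sub>v snd x)) i) + a \<bullet> snd (fst x, sqrt ?s2 \<cdot>\<^sub>v snd x))
      ((\<Sum>i<n. sq_norm (Matrix.row T i)) + ?s2 * sq_norm a)"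
    by (rule centered_normal_cong[THEN iffD1, rotated]) (use a in \<open>auto simp: space_pair_measure\<close>)
  show "\<exists>v. centered_normal (gauss_mat 1 n d \<Otimes>\<^sub>M gauss_vec \<sigma> n)
      (\<lambda>x. (\<Sum>i<n. Matrix.row T i \<bullet> Matrix.row (fst (fst x * w\<^sup>T, fst x *\<^sub>v z + snd x)) i) + a \<bullet> snd (fst x * w\<^sup>T, fst x *\<^sub>v z + snd x)) v \<and>
    centered_normal (gauss_mat 1 n p \<Otimes>\<^sub>M gauss_vec 1 n)
      (\<lambda>x. (\<Sum>i<n. Matrix.row T i \<bullet> Matrix.row (fst (fst x, sqrt ?s2 \<cdot>\<^sub>v snd x)) i) + a \<bullet> snd (fst x, sqrt ?s2 \<cdot>\<^sub>v snd x)) v"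
    using 1 2 by blast
qed

lemma measurable_resid [measurable (raw)]:
  "f \<in> M \<rightarrow>\<^sub>M borel_vec d \<Longrightarrow> (\<lambda>x. resid (f x)) \<in> M \<rightarrow>\<^sub>M borel_vec d"
proof -
  assume [measurable]: "f \<in> M \<rightarrow>\<^sub>M borel_vec d"
  have [measurable]: "(\<lambda>x. w) \<in> M \<rightarrow>\<^sub>M borel_mat p d" using w by simp
  show ?thesis unfolding resid_def by measurable
qed

text \<open>The two projections of an isotropic Gaussian vector are uncorrelated, hence independent.
  On the right they come from independent vectors, the second still of dimension \<open>d\<close>,
  so that no basis of the kernel has to be chosen.\<close>

lemma law_signal_resid:
  assumes \<tau>: "0 \<le> \<tau>"
  shows "distr (gauss_vec \<tau> d) (borel_vec p \<Otimes>\<^sub>M borel_vec d) (\<lambda>x. (w *\<^sub>v x, resid x)) =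
    distr (gauss_vec \<tau> p \<Otimes>\<^sub>M gauss_vec \<tau> d) (borel_vec p \<Otimes>\<^sub>M borel_vec d) (\<lambda>x. (fst x, resid (snd x)))"
proof (rule distr_eqI_vec_vec)
  have [measurable]: "(\<lambda>x. w) \<in> M \<rightarrow>\<^sub>M borel_mat p d" for M :: "'a measure" using w by simp
  show "(\<lambda>x. (w *\<^sub>v x, resid x)) \<in> gauss_vec \<tau> d \<rightarrow>\<^sub>M borel_vec p \<Otimes>\<^sub>M borel_vec d" by measurable
  show "(\<lambda>x. (fst x, resid (snd x))) \<in> gauss_vec \<tau> p \<Otimes>\<^sub>M gauss_vec \<tau> d \<rightarrow>\<^sub>M borel_vec p \<Otimes>\<^sub>M borel_vec d" by measurable
  show "prob_space (gauss_vec \<tau> d)" "prob_space (gauss_vec \<tau> p \<Otimes>\<^sub>M gauss_vec \<tau> d)"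
    using \<tau> by (intro prob_space_pair prob_space_gauss_vec; simp)+
  fix a b :: "real vec" assume a: "a \<in> carrier_vec p" and b: "b \<in> carrier_vec d"
  \<comment> \<open>The coefficient vector of the test functional on the left. Its two summands are
    orthogonal, which makes its squared norm the sum of the two variances on the right.\<close>
  let ?c = "w\<^sup>T *\<^sub>v a + resid b"
  have wa: "w\<^sup>T *\<^sub>v a \<in> carrier_vec d" using w a by simp
  have "(w\<^sup>T *\<^sub>v a) \<bullet> resid b = 0"
    using a b by (simp add: stiefel_adjoint mult_resid)
  then have v: "sq_norm ?c = sq_norm a + sq_norm (resid b)"
    using wa a b by (simp add: sq_norm_add[of _ d] stiefel_sq_norm)
  have "centered_normal (gauss_vec \<tau> d) (\<lambda>x. ?c \<bullet> x) (\<tau>\<^sup>2 * sq_norm ?c)"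
    using wa b by (intro centered_normal_gauss_vec \<tau>) simp
  then have 1: "centered_normal (gauss_vec \<tau> d) (\<lambda>x. a \<bullet> fst (w *\<^sub>v x, resid x) + b \<bullet> snd (w *\<^sub>v x, resid x)) (\<tau>\<^sup>2 * sq_norm ?c)"
    by (rule centered_normal_cong[THEN iffD1, rotated])
      (use wa a b in \<open>simp add: add_scalar_prod_distrib[of _ d] stiefel_adjoint resid_adjoint\<close>)
  have "centered_normal (gauss_vec \<tau> p \<Otimes>\<^sub>M gauss_vec \<tau> d) (\<lambda>x. a \<bullet> fst x + resid b \<bullet> snd x)
      (\<tau>\<^sup>2 * sq_norm a + \<tau>\<^sup>2 * sq_norm (resid b))"
    using a b by (intro centered_normal_pair prob_space_gauss_vec centered_normal_gauss_vec \<tau>) simp_all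
  also have "\<tau>\<^sup>2 * sq_norm a + \<tau>\<^sup>2 * sq_norm (resid b) = \<tau>\<^sup>2 * sq_norm ?c"
    by (simp add: v distrib_left)
  finally have 2: "centered_normal (gauss_vec \<tau> p \<Otimes>\<^sub>M gauss_vec \<tau> d)
      (\<lambda>x. a \<bullet> fst (fst x, resid (snd x)) + b \<bullet> snd (fst x, resid (snd x))) (\<tau>\<^sup>2 * sq_norm ?c)"
    by (rule centered_normal_cong[THEN iffD1, rotated])
      (use a b in \<open>auto simp: space_pair_measure resid_adjoint\<close>)
  show "\<exists>v. centered_normal (gauss_vec \<tau> d) (\<lambda>x. a \<bullet> fst (w *\<^sub>v x, resid x) + b \<bullet> snd (w *\<^sub>v x, resid x)) v \<and>
      centered_normal (gauss_vec \<tau> p \<Otimes>\<^sub>M gauss_vec \<tau> d)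
        (\<lambda>x. a \<bullet> fst (fst x, resid (snd x)) + b \<bullet> snd (fst x, resid (snd x))) v"
    using 1 2 by blast
qed

end

text \<open>
  In a Gaussian linear model, reflecting the parameter in its posterior mean \<open>r y\<close> preserves
  the joint law with the data.  The hypothesis on \<open>r\<close> is the normal equation.
\<close>

lemma law_reflection:
  assumes \<tau>: "0 \<le> \<tau>" and Z: "Z \<in> carrier_mat n p"
    and r [measurable]: "r \<in> borel_vec n \<rightarrow>\<^sub>M borel_vec p"
    and normal_eq: "\<And>b. b \<in> carrier_vec p \<Longrightarrow> \<exists>\<kappa>\<in>carrier_vec n. (\<forall>y\<in>carrier_vec n. b \<bullet> r y = \<kappa> \<bullet> y) \<and>
        \<tau>\<^sup>2 \<cdot>\<^sub>v (Z *\<^sub>v (Z\<^sup>T *\<^sub>v \<kappa>)) + s\<^sup>2 \<cdot>\<^sub>v \<kappa> = \<tau>\<^sup>2 \<cdot>\<^sub>v (Z *\<^sub>v b)"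
  shows "distr (gauss_vec \<tau> p \<Otimes>\<^sub>M gauss_vec 1 n) (borel_vec n \<Otimes>\<^sub>M borel_vec p)
      (\<lambda>x. (Z *\<^sub>v fst x + s \<cdot>\<^sub>v snd x, fst x)) =
    distr (gauss_vec \<tau> p \<Otimes>\<^sub>M gauss_vec 1 n) (borel_vec n \<Otimes>\<^sub>M borel_vec p)
      (\<lambda>x. (Z *\<^sub>v fst x + s \<cdot>\<^sub>v snd x, 2 \<cdot>\<^sub>v r (Z *\<^sub>v fst x + s \<cdot>\<^sub>v snd x) - fst x))"
proof (rule distr_eqI_vec_vec)
  have [measurable]: "(\<lambda>x. Z) \<in> M \<rightarrow>\<^sub>M borel_mat n p" for M :: "'a measure" using Z by simp
  let ?P = "gauss_vec \<tau> p \<Otimes>\<^sub>M gauss_vec 1 n"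
  let ?y = "\<lambda>x. Z *\<^sub>v fst x + s \<cdot>\<^sub>v snd x"
  show "(\<lambda>x. (?y x, fst x)) \<in> ?P \<rightarrow>\<^sub>M borel_vec n \<Otimes>\<^sub>M borel_vec p"
    "(\<lambda>x. (?y x, 2 \<cdot>\<^sub>v r (?y x) - fst x)) \<in> ?P \<rightarrow>\<^sub>M borel_vec n \<Otimes>\<^sub>M borel_vec p" by measurable
  show "prob_space ?P" "prob_space ?P"
    using \<tau> by (intro prob_space_pair prob_space_gauss_vec; simp)+
  fix a b :: "real vec" assume a: "a \<in> carrier_vec n" and b: "b \<in> carrier_vec p"
  \<comment> \<open>With u for the parameter, \<open>\<kappa>\<close> holds the regression
    coefficients of \<open>b \<bullet> u\<close> on the data: the data have covariance
    \<open>\<tau>\<^sup>2 Z Z\<^sup>T + s\<^sup>2 I\<close>, and their covariance with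
    \<open>b \<bullet> u\<close> is \<open>\<tau>\<^sup>2 Z b\<close>.\<close>
  obtain \<kappa> where \<kappa>: "\<kappa> \<in> carrier_vec n" and r\<kappa>: "\<And>y. y \<in> carrier_vec n \<Longrightarrow> b \<bullet> r y = \<kappa> \<bullet> y"
    and ne: "\<tau>\<^sup>2 \<cdot>\<^sub>v (Z *\<^sub>v (Z\<^sup>T *\<^sub>v \<kappa>)) + s\<^sup>2 \<cdot>\<^sub>v \<kappa> = \<tau>\<^sup>2 \<cdot>\<^sub>v (Z *\<^sub>v b)"
    using normal_eq[OF b] by blast
  have adj: "(Z\<^sup>T *\<^sub>v t) \<bullet> x = t \<bullet> (Z *\<^sub>v x)" if "t \<in> carrier_vec n" "x \<in> carrier_vec p" for t x
    using transpose_vec_mult_scalar[OF Z that(2,1)] .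
  \<comment> \<open>As linear forms in parameter and noise, the test functional has coefficients
    \<open>c\<close> and \<open>s a\<close> before the reflection and \<open>c + 2 m\<close> and
    \<open>s a'\<close> after it.\<close>
  define c where "c = Z\<^sup>T *\<^sub>v a + b"
  define m where "m = Z\<^sup>T *\<^sub>v \<kappa> - b"
  define a' where "a' = a + 2 \<cdot>\<^sub>v \<kappa>"
  have car: "c \<in> carrier_vec p" "m \<in> carrier_vec p" "a' \<in> carrier_vec n" "Z\<^sup>T *\<^sub>v a \<in> carrier_vec p"
    "Z\<^sup>T *\<^sub>v \<kappa> \<in> carrier_vec p" "Z *\<^sub>v m \<in> carrier_vec n" "a + \<kappa> \<in> carrier_vec n"
    using Z a b \<kappa> by (auto simp: c_def m_def a'_def)
  have rc: "r y \<in> carrier_vec p" if "y \<in> carrier_vec n" for y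
    using measurable_space[OF r, of y] that by simp
  have "centered_normal ?P (\<lambda>x. c \<bullet> fst x + (s \<cdot>\<^sub>v a) \<bullet> snd x) (\<tau>\<^sup>2 * sq_norm c + 1\<^sup>2 * sq_norm (s \<cdot>\<^sub>v a))"
    using a car by (intro centered_normal_pair prob_space_gauss_vec centered_normal_gauss_vec \<tau>) simp_all
  then have 1: "centered_normal ?P (\<lambda>x. a \<bullet> fst (?y x, fst x) + b \<bullet> snd (?y x, fst x))
      (\<tau>\<^sup>2 * sq_norm c + 1\<^sup>2 * sq_norm (s \<cdot>\<^sub>v a))"
    by (rule centered_normal_cong[THEN iffD1, rotated])
      (use a b Z car in \<open>auto simp: space_pair_measure c_def add_scalar_prod_distrib[of _ p] scalar_prod_add_distrib[of _ n] adj\<close>)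
  have "centered_normal ?P (\<lambda>x. (c + 2 \<cdot>\<^sub>v m) \<bullet> fst x + (s \<cdot>\<^sub>v a') \<bullet> snd x)
      (\<tau>\<^sup>2 * sq_norm (c + 2 \<cdot>\<^sub>v m) + 1\<^sup>2 * sq_norm (s \<cdot>\<^sub>v a'))"
    using car by (intro centered_normal_pair prob_space_gauss_vec centered_normal_gauss_vec \<tau>) simp_all
  then have 2: "centered_normal ?P (\<lambda>x. a \<bullet> fst (?y x, 2 \<cdot>\<^sub>v r (?y x) - fst x) + b \<bullet> snd (?y x, 2 \<cdot>\<^sub>v r (?y x) - fst x))
      (\<tau>\<^sup>2 * sq_norm (c + 2 \<cdot>\<^sub>v m) + 1\<^sup>2 * sq_norm (s \<cdot>\<^sub>v a'))"
  proof (rule centered_normal_cong[THEN iffD1, rotated])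
    fix x assume "x \<in> space ?P"
    then obtain u e where x: "x = (u, e)" and u: "u \<in> carrier_vec p" and e: "e \<in> carrier_vec n"
      by (cases x) (auto simp: space_pair_measure)
    have y: "?y x \<in> carrier_vec n" using Z u e by (simp add: x)
    have "a \<bullet> ?y x + b \<bullet> (2 \<cdot>\<^sub>v r (?y x) - u) = a \<bullet> ?y x + 2 * (\<kappa> \<bullet> ?y x) - b \<bullet> u"
      using y rc[OF y] b u r\<kappa>[OF y] by (simp add: scalar_prod_minus_distrib[of _ p])
    also have "\<dots> = a \<bullet> (Z *\<^sub>v u) + 2 * (\<kappa> \<bullet> (Z *\<^sub>v u)) - b \<bullet> u + (s * (a \<bullet> e) + 2 * s * (\<kappa> \<bullet> e))"
      using Z u e a \<kappa> by (simp add: x scalar_prod_add_distrib[of _ n] algebra_simps)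
    also have "\<dots> = (c + 2 \<cdot>\<^sub>v m) \<bullet> u + (s \<cdot>\<^sub>v a') \<bullet> e"
      using Z u e a b \<kappa> car
      by (simp add: c_def m_def a'_def add_scalar_prod_distrib[of _ p] add_scalar_prod_distrib[of _ n]
          minus_scalar_prod_distrib[of _ p] adj algebra_simps)
    finally show "(c + 2 \<cdot>\<^sub>v m) \<bullet> fst x + (s \<cdot>\<^sub>v a') \<bullet> snd x =
        a \<bullet> fst (?y x, 2 \<cdot>\<^sub>v r (?y x) - fst x) + b \<bullet> snd (?y x, 2 \<cdot>\<^sub>v r (?y x) - fst x)" by (simp add: x)
  qed
  \<comment> \<open>The change of variance is four times a bracket. Since \<open>c + m\<close>
    equals \<open>Z\<^sup>T (a + \<kappa>)\<close>, the bracket is the scalar product of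
    \<open>a + \<kappa>\<close> with \<open>\<tau>\<^sup>2 Z m + s\<^sup>2 \<kappa>\<close>, and the
    normal equation says that this last vector is 0.\<close>
  have "\<tau>\<^sup>2 * sq_norm (c + 2 \<cdot>\<^sub>v m) + s\<^sup>2 * sq_norm a' =
      \<tau>\<^sup>2 * sq_norm c + s\<^sup>2 * sq_norm a + 4 * (\<tau>\<^sup>2 * ((c + m) \<bullet> m) + s\<^sup>2 * ((a + \<kappa>) \<bullet> \<kappa>))"
    using car a \<kappa> by (simp add: a'_def sq_norm_add[of _ p] sq_norm_add[of _ n] sq_norm_smult
        add_scalar_prod_distrib[of _ p] add_scalar_prod_distrib[of _ n] algebra_simps) (simp add: sq_norm_def algebra_simps)
  also have "(c + m) \<bullet> m = (a + \<kappa>) \<bullet> (Z *\<^sub>v m)"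
  proof -
    have "c + m = Z\<^sup>T *\<^sub>v a + Z\<^sup>T *\<^sub>v \<kappa>" using Z a b \<kappa> by (intro eq_vecI) (auto simp: c_def m_def)
    also have "\<dots> = Z\<^sup>T *\<^sub>v (a + \<kappa>)"
      using Z a \<kappa> by (intro mult_add_distrib_mat_vec[symmetric, of _ p n]) auto
    finally show ?thesis using adj[of "a + \<kappa>" m] car by simp
  qed
  also have "\<tau>\<^sup>2 * ((a + \<kappa>) \<bullet> (Z *\<^sub>v m)) + s\<^sup>2 * ((a + \<kappa>) \<bullet> \<kappa>) = (a + \<kappa>) \<bullet> (\<tau>\<^sup>2 \<cdot>\<^sub>v (Z *\<^sub>v m) + s\<^sup>2 \<cdot>\<^sub>v \<kappa>)"
    using car \<kappa> by (simp add: scalar_prod_add_distrib[of _ n])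
  also have "\<tau>\<^sup>2 \<cdot>\<^sub>v (Z *\<^sub>v m) + s\<^sup>2 \<cdot>\<^sub>v \<kappa> = 0\<^sub>v n"
  proof -
    have Zm: "Z *\<^sub>v m = Z *\<^sub>v (Z\<^sup>T *\<^sub>v \<kappa>) - Z *\<^sub>v b"
      unfolding m_def using Z b car by (intro mult_minus_distrib_mat_vec) auto
    have "\<tau>\<^sup>2 * (Z *\<^sub>v (Z\<^sup>T *\<^sub>v \<kappa>)) $ i + s\<^sup>2 * \<kappa> $ i = \<tau>\<^sup>2 * (Z *\<^sub>v b) $ i" if "i < n" for i
      using arg_cong[OF ne, of "\<lambda>v. v $ i"] that Z \<kappa> by simp
    then show ?thesis
      unfolding Zm using Z \<kappa> by (intro eq_vecI) (auto simp: algebra_simps simp del: index_mult_mat_vec)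
  qed
  also have "(a + \<kappa>) \<bullet> 0\<^sub>v n = 0" using car by simp
  finally have "\<tau>\<^sup>2 * sq_norm (c + 2 \<cdot>\<^sub>v m) + 1\<^sup>2 * sq_norm (s \<cdot>\<^sub>v a') = \<tau>\<^sup>2 * sq_norm c + 1\<^sup>2 * sq_norm (s \<cdot>\<^sub>v a)"
    by (simp add: sq_norm_smult)
  with 1 2 show "\<exists>v. centered_normal ?P (\<lambda>x. a \<bullet> fst (?y x, fst x) + b \<bullet> snd (?y x, fst x)) v \<and>
      centered_normal ?P (\<lambda>x. a \<bullet> fst (?y x, 2 \<cdot>\<^sub>v r (?y x) - fst x) + b \<bullet> snd (?y x, 2 \<cdot>\<^sub>v r (?y x) - fst x)) v"
    by (intro exI[of _ "\<tau>\<^sup>2 * sq_norm c + 1\<^sup>2 * sq_norm (s \<cdot>\<^sub>v a)"]) simp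
qed

section \<open>Ridge estimators\<close>

text \<open>Cramer's rule, chosen because it is visibly measurable in the matrix. For determinant 0
  the quotient 1 / 0 is 0 and the value is a zero vector.\<close>

definition mat_solve :: "real mat \<Rightarrow> real vec \<Rightarrow> real vec" where
  "mat_solve B v = (1 / Determinant.det B) \<cdot>\<^sub>v (adj_mat B *\<^sub>v v)"

definition gram :: "real \<Rightarrow> nat \<Rightarrow> nat \<Rightarrow> real mat \<Rightarrow> real mat" where
  "gram l n p Z = (1 / real n) \<cdot>\<^sub>m (Z\<^sup>T * Z) + l \<cdot>\<^sub>m 1\<^sub>m p"

definition ridge_sol :: "real \<Rightarrow> nat \<Rightarrow> nat \<Rightarrow> real mat \<Rightarrow> real vec \<Rightarrow> real vec" where
  "ridge_sol l n p Z y = mat_solve (gram l n p Z) ((1 / real n) \<cdot>\<^sub>v (Z\<^sup>T *\<^sub>v y))"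

text \<open>The penalty \<open>l\<close> may vary with the outcome, as it does in
  \<open>center\<close>, where it depends on \<open>q\<close>.\<close>

lemma measurable_ridge_sol [measurable (raw)]:
  assumes [measurable]: "l \<in> borel_measurable M" "Z \<in> M \<rightarrow>\<^sub>M borel_mat n p" "y \<in> M \<rightarrow>\<^sub>M borel_vec n"
  shows "(\<lambda>x. ridge_sol (l x) n p (Z x) (y x)) \<in> M \<rightarrow>\<^sub>M borel_vec p"
proof -
  have [measurable]: "(\<lambda>x. 1\<^sub>m p) \<in> M \<rightarrow>\<^sub>M borel_mat p p" by simp
  have G: "(\<lambda>x. gram (l x) n p (Z x)) \<in> M \<rightarrow>\<^sub>M borel_mat p p" unfolding gram_def by measurable
  note [measurable] = measurable_det[OF G] measurable_adj_mat[OF G]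
  show ?thesis unfolding ridge_sol_def mat_solve_def by measurable
qed

lemma smult_mult_mat_vec:
  assumes "A \<in> carrier_mat m k" "v \<in> carrier_vec k"
  shows "(c \<cdot>\<^sub>m A) *\<^sub>v v = (c :: real) \<cdot>\<^sub>v (A *\<^sub>v v)"
  using assms by (intro eq_vecI) (auto simp: row_smult smult_scalar_prod_distrib[of _ k])

section \<open>The penalised Gram matrix and its linear system\<close>

context
  fixes Z :: "real mat" and n p :: nat
  assumes Z: "Z \<in> carrier_mat n p"
begin

lemma gram_carrier [simp]: "gram l n p Z \<in> carrier_mat p p"
  using Z by (simp add: gram_def)

lemma gram_mult:
  assumes x: "x \<in> carrier_vec p"
  shows "gram l n p Z *\<^sub>v x = (1 / real n) \<cdot>\<^sub>v (Z\<^sup>T *\<^sub>v (Z *\<^sub>v x)) + l \<cdot>\<^sub>v x"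
proof -
  have "gram l n p Z *\<^sub>v x = ((1 / real n) \<cdot>\<^sub>m (Z\<^sup>T * Z)) *\<^sub>v x + (l \<cdot>\<^sub>m 1\<^sub>m p) *\<^sub>v x"
    unfolding gram_def using Z x by (intro add_mult_distrib_mat_vec[of _ p p]) auto
  then show ?thesis
    using Z x by (simp add: smult_mult_mat_vec[of _ p p] assoc_mult_mat_vec[of _ p n])
qed

lemma gram_adjoint:
  assumes x: "x \<in> carrier_vec p" and y: "y \<in> carrier_vec p"
  shows "(gram l n p Z *\<^sub>v x) \<bullet> y = (1 / real n) * ((Z *\<^sub>v x) \<bullet> (Z *\<^sub>v y)) + l * (x \<bullet> y)"
proof -
  have "(Z\<^sup>T *\<^sub>v (Z *\<^sub>v x)) \<bullet> y = (Z *\<^sub>v x) \<bullet> (Z *\<^sub>v y)"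
    using transpose_vec_mult_scalar[OF Z y, of "Z *\<^sub>v x"] Z x by simp
  then show ?thesis using Z x y by (simp add: gram_mult add_scalar_prod_distrib[of _ p])
qed

lemma gram_symmetric:
  assumes x: "x \<in> carrier_vec p" and y: "y \<in> carrier_vec p"
  shows "(gram l n p Z *\<^sub>v x) \<bullet> y = x \<bullet> (gram l n p Z *\<^sub>v y)"
proof -
  have "x \<bullet> (gram l n p Z *\<^sub>v y) = (gram l n p Z *\<^sub>v y) \<bullet> x"
    using x y by (intro comm_scalar_prod[of _ p]) (auto intro: mult_mat_vec_carrier[OF gram_carrier])
  then show ?thesis
    using gram_adjoint[OF x y, of l] gram_adjoint[OF y x, of l] comm_scalar_prod[OF x y]
      comm_scalar_prod[of "Z *\<^sub>v x" n "Z *\<^sub>v y"] Z x y by simp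
qed

text \<open>A positive semidefinite matrix plus \<open>l\<close> times the identity: the quadratic
  form at \<open>x\<close> is at least \<open>l * sq_norm x\<close>, and Cauchy-Schwarz turns this
  into a bound on the image. Invertibility and stability in the penalty both follow from it.\<close>

lemma gram_lower_bound:
  assumes l: "0 < l" and x: "x \<in> carrier_vec p"
  shows "l\<^sup>2 * sq_norm x \<le> sq_norm (gram l n p Z *\<^sub>v x)"
proof (cases "sq_norm x = 0")
  case False
  have Bx: "gram l n p Z *\<^sub>v x \<in> carrier_vec p" using x by (auto intro: mult_mat_vec_carrier[OF gram_carrier])
  have pos: "sq_norm x > 0" using False sq_norm_nonneg[of x] by linarith
  have "l * sq_norm x \<le> (gram l n p Z *\<^sub>v x) \<bullet> x"
    using gram_adjoint[OF x x, of l] sq_norm_nonneg[of "Z *\<^sub>v x"] by (simp add: sq_norm_def)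
  then have "(l * sq_norm x)\<^sup>2 \<le> ((gram l n p Z *\<^sub>v x) \<bullet> x)\<^sup>2"
    using l pos by (intro power_mono) auto
  also have "\<dots> \<le> sq_norm (gram l n p Z *\<^sub>v x) * sq_norm x"
    using scalar_prod_le_sq_norm[OF Bx x] .
  finally have "(l\<^sup>2 * sq_norm x) * sq_norm x \<le> sq_norm (gram l n p Z *\<^sub>v x) * sq_norm x"
    by (simp add: power2_eq_square algebra_simps)
  then show ?thesis using pos by simp
qed simp

lemma det_gram: "0 < l \<Longrightarrow> Determinant.det (gram l n p Z) \<noteq> 0"
proof
  assume l: "0 < l" and "Determinant.det (gram l n p Z) = 0"
  then obtain v where v: "v \<in> carrier_vec p" "v \<noteq> 0\<^sub>v p" "gram l n p Z *\<^sub>v v = 0\<^sub>v p"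
    using det_0_iff_vec_prod_zero_field[OF gram_carrier] by blast
  then have "l\<^sup>2 * sq_norm v \<le> 0"
    using gram_lower_bound[OF l v(1)] sq_norm_eq_0_iff[of "0\<^sub>v p" p] by simp
  moreover have "sq_norm v > 0"
    using v sq_norm_eq_0_iff[OF v(1)] sq_norm_nonneg[of v] by linarith
  ultimately show False using l by (simp add: mult_le_0_iff)
qed

lemma gram_solve:
  assumes l: "0 < l" and v: "v \<in> carrier_vec p"
  shows "mat_solve (gram l n p Z) v \<in> carrier_vec p" "gram l n p Z *\<^sub>v mat_solve (gram l n p Z) v = v"
proof -
  let ?B = "gram l n p Z"
  have adj: "adj_mat ?B \<in> carrier_mat p p" "?B * adj_mat ?B = Determinant.det ?B \<cdot>\<^sub>m 1\<^sub>m p"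
    using adj_mat[OF gram_carrier] by auto
  show "mat_solve ?B v \<in> carrier_vec p" using adj(1) v by (simp add: mat_solve_def)
  have "?B *\<^sub>v (adj_mat ?B *\<^sub>v v) = Determinant.det ?B \<cdot>\<^sub>v v"
    unfolding assoc_mult_mat_vec[OF gram_carrier[of l] adj(1) v, symmetric] adj(2)
    using v by (simp add: smult_mult_mat_vec[of _ p p])
  then show "?B *\<^sub>v mat_solve ?B v = v"
    using adj(1) v det_gram[OF l] by (simp add: mat_solve_def mult_mat_vec[OF gram_carrier] smult_smult_assoc)
qed

lemma gram_inj:
  assumes l: "0 < l" and x: "x \<in> carrier_vec p" and y: "y \<in> carrier_vec p"
    and eq: "gram l n p Z *\<^sub>v x = gram l n p Z *\<^sub>v y"
  shows "x = y"
proof -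
  have "gram l n p Z *\<^sub>v (x - y) = 0\<^sub>v p"
    using x y eq by (simp add: mult_minus_distrib_mat_vec[OF gram_carrier])
      (intro minus_cancel_vec mult_mat_vec_carrier[OF gram_carrier])
  then have "l\<^sup>2 * sq_norm (x - y) \<le> 0"
    using gram_lower_bound[OF l, of "x - y"] x y sq_norm_eq_0_iff[of "0\<^sub>v p" p] by simp
  then have "sq_norm (x - y) = 0"
    using l sq_norm_nonneg[of "x - y"] by (simp add: mult_le_0_iff)
  then have "x - y = 0\<^sub>v p" using x y sq_norm_eq_0_iff[of "x - y" p] by simp
  then have "(x - y) $ i = 0" if "i < p" for i using that by simp
  then show ?thesis using x y by (intro eq_vecI) auto
qed

lemma ridge_sol_carrier: "0 < l \<Longrightarrow> y \<in> carrier_vec n \<Longrightarrow> ridge_sol l n p Z y \<in> carrier_vec p"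
  unfolding ridge_sol_def using Z by (intro gram_solve) auto

lemma gram_ridge_sol:
  "0 < l \<Longrightarrow> y \<in> carrier_vec n \<Longrightarrow> gram l n p Z *\<^sub>v ridge_sol l n p Z y = (1 / real n) \<cdot>\<^sub>v (Z\<^sup>T *\<^sub>v y)"
  unfolding ridge_sol_def using Z by (intro gram_solve) auto

text \<open>Both solutions have the same right-hand side, so \<open>gram l\<close> maps their
  difference to \<open>(\<mu> - l) \<cdot>\<^sub>v r\<close>, and \<open>gram_lower_bound\<close>
  divides by \<open>l\<close>. Only \<open>l\<close> has to be positive: \<open>gram \<mu>\<close>
  may be singular, which covers the noiseless case \<open>\<mu> = 0\<close>.\<close>

lemma ridge_sol_perturb:
  assumes l: "0 < l" and y: "y \<in> carrier_vec n" and r: "r \<in> carrier_vec p"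
    and eq: "gram \<mu> n p Z *\<^sub>v r = (1 / real n) \<cdot>\<^sub>v (Z\<^sup>T *\<^sub>v y)"
  shows "sq_norm (ridge_sol l n p Z y - r) \<le> ((\<mu> - l) / l)\<^sup>2 * sq_norm r"
proof -
  let ?b = "ridge_sol l n p Z y"
  have b: "?b \<in> carrier_vec p" using l y by (rule ridge_sol_carrier)
  have "gram l n p Z *\<^sub>v (?b - r) = gram \<mu> n p Z *\<^sub>v r - gram l n p Z *\<^sub>v r"
    using b r l y eq by (simp add: mult_minus_distrib_mat_vec[OF gram_carrier] gram_ridge_sol)
  also have "\<dots> = (\<mu> - l) \<cdot>\<^sub>v r"
    unfolding gram_mult[OF r] using Z r by (intro eq_vecI) (auto simp: algebra_simps)
  finally have "l\<^sup>2 * sq_norm (?b - r) \<le> (\<mu> - l)\<^sup>2 * sq_norm r"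
    using gram_lower_bound[OF l, of "?b - r"] b r by (simp add: sq_norm_smult)
  then show ?thesis using l by (simp add: power_divide field_simps)
qed

text \<open>Provides the hypothesis of \<open>law_reflection\<close> for the ridge estimator. It
  fixes the Bayesian penalty: noise variance over \<open>n\<close> times the prior variance.\<close>

lemma ridge_sol_normal_eq:
  assumes n: "0 < n" and \<tau>: "0 < \<tau>" and s: "0 < s" and \<mu>: "\<mu> = s\<^sup>2 / (real n * \<tau>\<^sup>2)"
    and b: "b \<in> carrier_vec p"
  shows "\<exists>\<kappa>\<in>carrier_vec n. (\<forall>y\<in>carrier_vec n. b \<bullet> ridge_sol \<mu> n p Z y = \<kappa> \<bullet> y) \<and>
    \<tau>\<^sup>2 \<cdot>\<^sub>v (Z *\<^sub>v (Z\<^sup>T *\<^sub>v \<kappa>)) + s\<^sup>2 \<cdot>\<^sub>v \<kappa> = \<tau>\<^sup>2 \<cdot>\<^sub>v (Z *\<^sub>v b)"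
proof (intro bexI conjI ballI)
  have \<mu>0: "0 < \<mu>" using n \<tau> s by (simp add: \<mu>)
  \<comment> \<open>With B for the Gram matrix, symmetry moves its inverse from the estimator to
    \<open>b\<close>; hence \<open>\<kappa>\<close> is \<open>Z x / n\<close> with
    \<open>B x = b\<close>. Multiplying this equation by \<open>Z\<close> gives the normal
    equation.\<close>
  define x where "x = mat_solve (gram \<mu> n p Z) b"
  note x = gram_solve[OF \<mu>0 b, folded x_def]
  let ?\<kappa> = "(1 / real n) \<cdot>\<^sub>v (Z *\<^sub>v x)"
  show \<kappa>: "?\<kappa> \<in> carrier_vec n" using Z x by simp
  show "b \<bullet> ridge_sol \<mu> n p Z y = ?\<kappa> \<bullet> y" if y: "y \<in> carrier_vec n" for y
  proof -
    have "b \<bullet> ridge_sol \<mu> n p Z y = x \<bullet> (gram \<mu> n p Z *\<^sub>v ridge_sol \<mu> n p Z y)"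
      using gram_symmetric[OF x(1) ridge_sol_carrier[OF \<mu>0 y], of \<mu>] x(2) by simp
    also have "\<dots> = (1 / real n) * (x \<bullet> (Z\<^sup>T *\<^sub>v y))"
      using gram_ridge_sol[OF \<mu>0 y] x Z y by simp
    also have "x \<bullet> (Z\<^sup>T *\<^sub>v y) = (Z\<^sup>T *\<^sub>v y) \<bullet> x" using x Z y by (intro comm_scalar_prod[of _ p]) auto
    also have "\<dots> = y \<bullet> (Z *\<^sub>v x)" by (rule transpose_vec_mult_scalar[OF Z x(1) y])
    also have "\<dots> = (Z *\<^sub>v x) \<bullet> y" using x Z y by (intro comm_scalar_prod[of _ n]) auto
    finally show ?thesis using x Z y by simp
  qed
  have "Z *\<^sub>v b = Z *\<^sub>v ((1 / real n) \<cdot>\<^sub>v (Z\<^sup>T *\<^sub>v (Z *\<^sub>v x)) + \<mu> \<cdot>\<^sub>v x)"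
    using x gram_mult[OF x(1), of \<mu>] by simp
  also have "\<dots> = Z *\<^sub>v ((1 / real n) \<cdot>\<^sub>v (Z\<^sup>T *\<^sub>v (Z *\<^sub>v x))) + Z *\<^sub>v (\<mu> \<cdot>\<^sub>v x)"
    using Z x by (intro mult_add_distrib_mat_vec) auto
  also have "\<dots> = (1 / real n) \<cdot>\<^sub>v (Z *\<^sub>v (Z\<^sup>T *\<^sub>v (Z *\<^sub>v x))) + \<mu> \<cdot>\<^sub>v (Z *\<^sub>v x)"
    using Z x by (simp add: mult_mat_vec[OF Z])
  finally have Zb: "Z *\<^sub>v b = (1 / real n) \<cdot>\<^sub>v (Z *\<^sub>v (Z\<^sup>T *\<^sub>v (Z *\<^sub>v x))) + \<mu> \<cdot>\<^sub>v (Z *\<^sub>v x)" .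
  have Z\<kappa>: "Z *\<^sub>v (Z\<^sup>T *\<^sub>v ?\<kappa>) = (1 / real n) \<cdot>\<^sub>v (Z *\<^sub>v (Z\<^sup>T *\<^sub>v (Z *\<^sub>v x)))"
    using Z x mult_mat_vec[of "Z\<^sup>T" p n "Z *\<^sub>v x" "1 / real n"] by (simp add: mult_mat_vec[OF Z])
  show "\<tau>\<^sup>2 \<cdot>\<^sub>v (Z *\<^sub>v (Z\<^sup>T *\<^sub>v ?\<kappa>)) + s\<^sup>2 \<cdot>\<^sub>v ?\<kappa> = \<tau>\<^sup>2 \<cdot>\<^sub>v (Z *\<^sub>v b)"
    unfolding Zb Z\<kappa> using Z n \<tau>
    by (intro eq_vecI) (auto simp: \<mu> field_simps simp del: index_mult_mat_vec)
qed

end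

text \<open>A positive penalty makes the matrix invertible, so \<open>mat_inverse\<close> does not
  return \<open>None\<close>, and injectivity identifies the two solutions. The right-hand side
  depends on \<open>x\<close> and \<open>w\<close> only through the observed product
  \<open>x * w\<^sup>T\<close>.\<close>

lemma ridge_eq_ridge_sol:
  assumes l: "0 < l" and x: "x \<in> carrier_mat n d" and w: "w \<in> carrier_mat p d" and y: "y \<in> carrier_vec n"
  shows "ridge l n p x w y = ridge_sol l n p (x * w\<^sup>T) y"
proof -
  let ?Z = "x * w\<^sup>T"
  have Z: "?Z \<in> carrier_mat n p" using x w by simp
  have tr: "?Z\<^sup>T = w * x\<^sup>T" using transpose_mult[OF x, of "w\<^sup>T" p] w by simp
  have "w * x\<^sup>T * x * w\<^sup>T = (w * x\<^sup>T) * (x * w\<^sup>T)"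
    by (rule assoc_mult_mat[of _ p n _ d _ p]) (use x w in auto)
  then have B: "(1 / real n) \<cdot>\<^sub>m (w * x\<^sup>T * x * w\<^sup>T) + l \<cdot>\<^sub>m 1\<^sub>m p = gram l n p ?Z"
    by (simp add: gram_def tr)
  have "gram l n p ?Z \<in> Units (ring_mat TYPE(real) p ())"
    by (rule det_non_zero_imp_unit[OF gram_carrier[OF Z] det_gram[OF Z l]])
  then obtain B' where B': "mat_inverse (gram l n p ?Z) = Some B'"
    using mat_inverse(1)[OF gram_carrier[OF Z], of l "()"] by (meson not_None_eq)
  note inv = mat_inverse(2)[OF gram_carrier[OF Z] B']
  define v where "v = (1 / real n) \<cdot>\<^sub>v (?Z\<^sup>T *\<^sub>v y)"
  have v: "v \<in> carrier_vec p" using Z y by (simp add: v_def)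
  have "gram l n p ?Z *\<^sub>v (B' *\<^sub>v v) = v"
    unfolding assoc_mult_mat_vec[OF gram_carrier[OF Z] inv[THEN conjunct2, THEN conjunct2] v, symmetric]
    using inv v by simp
  moreover have "gram l n p ?Z *\<^sub>v ridge_sol l n p ?Z y = v"
    using gram_ridge_sol[OF Z l y] by (simp add: v_def)
  moreover have "B' *\<^sub>v v \<in> carrier_vec p" using inv v by (auto intro: mult_mat_vec_carrier)
  ultimately have "B' *\<^sub>v v = ridge_sol l n p ?Z y"
    using inv v ridge_sol_carrier[OF Z l y] by (intro gram_inj[OF Z l, of "B' *\<^sub>v v"]) simp_all
  then show ?thesis by (simp add: ridge_def B B' v_def tr)
qed

section \<open>The joint model\<close>

text \<open>The variables of the model have different types, and their independence is given through
  the sigma-algebras they generate. Grouping these into two disjoint blocks turns it into a product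
  law.\<close>

lemma (in prob_space) distr_pair_indep_sets:
  assumes ind: "indep_sets F I" and stab: "\<And>i. i \<in> I \<Longrightarrow> Int_stable (F i)"
    and J: "J \<subseteq> I" and K: "K \<subseteq> I" and JK: "J \<inter> K = {}"
    and f: "f \<in> sigma (space M) (\<Union>k\<in>J. F k) \<rightarrow>\<^sub>M A" and g: "g \<in> sigma (space M) (\<Union>k\<in>K. F k) \<rightarrow>\<^sub>M B"
  shows "distr M (A \<Otimes>\<^sub>M B) (\<lambda>\<omega>. (f \<omega>, g \<omega>)) = distr M A f \<Otimes>\<^sub>M distr M B g"
proof -
  let ?J = "case_bool J K"
  have "indep_sets F (\<Union>j\<in>UNIV. ?J j)"
    using ind by (rule indep_sets_mono_index[rotated]) (use J K in \<open>auto split: bool.splits\<close>)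
  then have ind2: "indep_sets (\<lambda>j. sigma_sets (space M) (\<Union>k\<in>?J j. F k)) UNIV"
  proof (rule indep_sets_collect_sigma)
    show "Int_stable (F i)" if "i \<in> ?J j" for i j
      using that J K stab by (cases j) auto
    show "disjoint_family_on ?J UNIV"
      using JK by (auto simp: disjoint_family_on_def split: bool.splits)
  qed
  have ev: "(\<Union>k\<in>L. F k) \<subseteq> events" if "L \<subseteq> I" for L using ind that by (auto simp: indep_sets_def)
  have Pow: "(\<Union>k\<in>L. F k) \<subseteq> Pow (space M)" if "L \<subseteq> I" for L
    using ev[OF that] sets.space_closed by blast
  have sigma_events: "sigma_sets (space M) (\<Union>k\<in>L. F k) \<subseteq> events" if "L \<subseteq> I" for L
    by (rule sets.sigma_sets_subset[OF ev[OF that]])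
  have pre: "h -` U \<inter> space M \<in> sigma_sets (space M) (\<Union>k\<in>L. F k)"
    if "h \<in> sigma (space M) (\<Union>k\<in>L. F k) \<rightarrow>\<^sub>M C" "U \<in> sets C" "L \<subseteq> I" for h C U L
    using measurable_sets[OF that(1,2)] Pow[OF that(3)] by (simp add: sets_measure_of space_measure_of_conv)
  have meas: "h \<in> M \<rightarrow>\<^sub>M C" if "h \<in> sigma (space M) (\<Union>k\<in>L. F k) \<rightarrow>\<^sub>M C" "L \<subseteq> I" for h C L
    using pre[OF that(1) _ that(2)] sigma_events[OF that(2)] measurable_space[OF that(1)]
    by (intro measurableI) (auto simp: space_measure_of_conv)
  note [measurable] = meas[OF f J] meas[OF g K]
  have "prob ((f -` U \<inter> space M) \<inter> (g -` V \<inter> space M)) = prob (f -` U \<inter> space M) * prob (g -` V \<inter> space M)"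
    if U: "U \<in> sets A" and V: "V \<in> sets B" for U V
  proof -
    let ?E = "case_bool (f -` U \<inter> space M) (g -` V \<inter> space M)"
    have "prob (\<Inter>j\<in>UNIV. ?E j) = (\<Prod>j\<in>UNIV. prob (?E j))"
      using pre[OF f U J] pre[OF g V K] by (intro indep_setsD[OF ind2]) (auto split: bool.splits)
    then show ?thesis by (simp add: UNIV_bool Int_commute mult.commute)
  qed
  then have eq: "emeasure M (f -` U \<inter> space M \<inter> (g -` V \<inter> space M)) = emeasure M (f -` U \<inter> space M) * emeasure M (g -` V \<inter> space M)"
    if "U \<in> sets A" "V \<in> sets B" for U V
    using that by (simp add: emeasure_eq_measure ennreal_mult)
  interpret fA: prob_space "distr M A f" by (rule prob_space_distr) measurable
  interpret gB: prob_space "distr M B g" by (rule prob_space_distr) measurable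
  show ?thesis
  proof (rule pair_measure_eqI[symmetric])
    fix U V assume "U \<in> sets (distr M A f)" "V \<in> sets (distr M B g)"
    then have UV: "U \<in> sets A" "V \<in> sets B" by auto
    have "(\<lambda>\<omega>. (f \<omega>, g \<omega>)) -` (U \<times> V) \<inter> space M = f -` U \<inter> space M \<inter> (g -` V \<inter> space M)" by auto
    then show "emeasure (distr M A f) U * emeasure (distr M B g) V = emeasure (distr M (A \<Otimes>\<^sub>M B) (\<lambda>\<omega>. (f \<omega>, g \<omega>))) (U \<times> V)"
      using UV eq[OF UV] by (simp add: emeasure_distr)
  qed (auto simp: fA.sigma_finite_measure_axioms gB.sigma_finite_measure_axioms cong: sets_pair_measure_cong)
qed

text \<open>A single dimension \<open>d\<close>, with \<open>\<tau>\<close> for the prior standard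
  deviation \<open>\<alpha> / sqrt d\<close>. All bounds in the locale are explicit in
  \<open>n\<close>, \<open>p\<close> and \<open>d\<close>; limits are taken only at the end.\<close>

locale ridge_model = prob_space M for M :: "'w measure" +
  fixes n p d :: nat and \<tau> \<sigma> :: real
    and X W :: "'w \<Rightarrow> real mat" and \<theta> \<E> :: "'w \<Rightarrow> real vec"
  assumes \<tau>0: "0 \<le> \<tau>" and \<sigma>0: "0 \<le> \<sigma>"
    and X_meas [measurable]: "X \<in> M \<rightarrow>\<^sub>M borel_mat n d"
    and \<theta>_meas [measurable]: "\<theta> \<in> M \<rightarrow>\<^sub>M borel_vec d"
    and \<E>_meas [measurable]: "\<E> \<in> M \<rightarrow>\<^sub>M borel_vec n"
    and W_meas [measurable]: "W \<in> M \<rightarrow>\<^sub>M borel_mat p d"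
    and X_law: "distr M (borel_mat n d) X = gauss_mat 1 n d"
    and \<theta>_law: "distr M (borel_vec d) \<theta> = gauss_vec \<tau> d"
    and \<E>_law: "distr M (borel_vec n) \<E> = gauss_vec \<sigma> n"
    and W_stiefel: "AE w in distr M (borel_mat p d) W. w * w\<^sup>T = 1\<^sub>m p"
    and indep: "indep_sets
           (\<lambda>i. [sets (vimage_algebra (space M) X (borel_mat n d)),
                 sets (vimage_algebra (space M) \<theta> (borel_vec d)),
                 sets (vimage_algebra (space M) \<E> (borel_vec n)),
                 sets (vimage_algebra (space M) W (borel_mat p d))] ! i) {..<4}"
begin

abbreviation \<mu>W :: "real mat measure" where
  "\<mu>W \<equiv> distr M (borel_mat p d) W"

text \<open>The nesting puts \<open>W\<close> and \<open>\<theta>\<close> outermost, since the laws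
  of design and noise are computed with both of them fixed.\<close>

lemma joint_law:
  "distr M (borel_mat p d \<Otimes>\<^sub>M (borel_vec d \<Otimes>\<^sub>M (borel_mat n d \<Otimes>\<^sub>M borel_vec n))) (\<lambda>\<omega>. (W \<omega>, \<theta> \<omega>, X \<omega>, \<E> \<omega>)) =
   \<mu>W \<Otimes>\<^sub>M (gauss_vec \<tau> d \<Otimes>\<^sub>M (gauss_mat 1 n d \<Otimes>\<^sub>M gauss_vec \<sigma> n))"
proof -
  define F where "F i = [sets (vimage_algebra (space M) X (borel_mat n d)),
                 sets (vimage_algebra (space M) \<theta> (borel_vec d)),
                 sets (vimage_algebra (space M) \<E> (borel_vec n)),
                 sets (vimage_algebra (space M) W (borel_mat p d))] ! i" for i
  have F: "F 0 = sets (vimage_algebra (space M) X (borel_mat n d))"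
    "F 1 = sets (vimage_algebra (space M) \<theta> (borel_vec d))"
    "F 2 = sets (vimage_algebra (space M) \<E> (borel_vec n))"
    "F 3 = sets (vimage_algebra (space M) W (borel_mat p d))"
    by (simp_all add: F_def numeral_2_eq_2 numeral_3_eq_3)
  have i4: "i = 0 \<or> i = 1 \<or> i = 2 \<or> i = 3" if "i \<in> {..<4}" for i :: nat using that by auto
  have stab: "Int_stable (F i)" if "i \<in> {..<4}" for i
    using i4[OF that] by (elim disjE) (simp_all only: F sets.Int_stable)
  have sub: "F i \<subseteq> Pow (space M)" if "i \<in> {..<4}" for i
    using i4[OF that] sets.space_closed[of "vimage_algebra (space M) X (borel_mat n d)"]
      sets.space_closed[of "vimage_algebra (space M) \<theta> (borel_vec d)"]
      sets.space_closed[of "vimage_algebra (space M) \<E> (borel_vec n)"]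
      sets.space_closed[of "vimage_algebra (space M) W (borel_mat p d)"]
    by (elim disjE) (simp_all only: F space_vimage_algebra)
  have comp: "h \<in> sigma (space M) (\<Union>k\<in>K. F k) \<rightarrow>\<^sub>M B"
    if Fk: "F k = sets (vimage_algebra (space M) h B)" and k: "k \<in> K" "K \<subseteq> {..<4}" and h: "h \<in> M \<rightarrow>\<^sub>M B" for h B k K
  proof (rule measurableI)
    have K: "(\<Union>k\<in>K. F k) \<subseteq> Pow (space M)" using k(2) sub by blast
    show "h x \<in> space B" if "x \<in> space (sigma (space M) (\<Union>k\<in>K. F k))" for x
      using that measurable_space[OF h] by (simp add: space_measure_of_conv)
    fix A assume "A \<in> sets B"
    then have "h -` A \<inter> space M \<in> F k" unfolding Fk by (rule in_vimage_algebra)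
    then show "h -` A \<inter> space (sigma (space M) (\<Union>k\<in>K. F k)) \<in> sets (sigma (space M) (\<Union>k\<in>K. F k))"
      using k K by (simp add: space_measure_of_conv sets_measure_of) (blast intro: sigma_sets.Basic)
  qed
  note comps = comp[OF F(1) _ _ X_meas] comp[OF F(2) _ _ \<theta>_meas] comp[OF F(3) _ _ \<E>_meas] comp[OF F(4) _ _ W_meas]
  have ind: "indep_sets F {..<4}" using indep unfolding F_def[abs_def] .
  note split = distr_pair_indep_sets[OF ind stab]
  have XE: "distr M (borel_mat n d \<Otimes>\<^sub>M borel_vec n) (\<lambda>\<omega>. (X \<omega>, \<E> \<omega>)) = gauss_mat 1 n d \<Otimes>\<^sub>M gauss_vec \<sigma> n"
    unfolding X_law[symmetric] \<E>_law[symmetric]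
    by (rule split[of "{0}" "{2}"]; (intro comps measurable_Pair)?; simp)
  have \<theta>XE: "distr M (borel_vec d \<Otimes>\<^sub>M (borel_mat n d \<Otimes>\<^sub>M borel_vec n)) (\<lambda>\<omega>. (\<theta> \<omega>, X \<omega>, \<E> \<omega>)) =
      gauss_vec \<tau> d \<Otimes>\<^sub>M (gauss_mat 1 n d \<Otimes>\<^sub>M gauss_vec \<sigma> n)"
    unfolding \<theta>_law[symmetric] XE[symmetric]
    by (rule split[of "{1}" "{0, 2}"]; (intro comps measurable_Pair)?; simp)
  show ?thesis
    unfolding \<theta>XE[symmetric]
    by (rule split[of "{3}" "{0, 1, 2}"]; (intro comps measurable_Pair)?; simp)
qed

end

section \<open>The joint law of data, projected signal and unseen strength\<close>

abbreviation data_space :: "nat \<Rightarrow> nat \<Rightarrow> nat \<Rightarrow> (real mat \<times> real mat \<times> real vec) measure" where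
  "data_space n p d \<equiv> borel_mat n p \<Otimes>\<^sub>M borel_mat p d \<Otimes>\<^sub>M borel_vec n"

abbreviation signal_space :: "nat \<Rightarrow> nat \<Rightarrow> nat \<Rightarrow> ((real mat \<times> real mat \<times> real vec) \<times> real vec \<times> real) measure" where
  "signal_space n p d \<equiv> data_space n p d \<Otimes>\<^sub>M borel_vec p \<Otimes>\<^sub>M borel"

context
  fixes w :: "real mat" and n p d :: nat and \<tau> \<sigma> :: real and F :: "(real mat \<times> real mat \<times> real vec) \<times> real vec \<times> real \<Rightarrow> ennreal"
  assumes w: "w \<in> carrier_mat p d" and ww: "w * w\<^sup>T = 1\<^sub>m p" and \<tau>0: "0 \<le> \<tau>" and \<sigma>0: "0 \<le> \<sigma>"
    and F [measurable]: "F \<in> borel_measurable (signal_space n p d)"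
begin

text \<open>For fixed \<open>t\<close>, \<open>law_design_noise\<close> turns the unseen part into
  noise; then \<open>law_signal_resid\<close> makes the seen part independent of the unseen one. On
  the right \<open>fst x\<close> is a fresh signal and \<open>t\<close> enters only through
  \<open>q\<close>, so that design, signal, noise and \<open>q\<close> are independent.\<close>

lemma model_law_fixed:
  "(\<integral>\<^sup>+t. \<integral>\<^sup>+x. F ((fst x * w\<^sup>T, w, fst x *\<^sub>v t + snd x), w *\<^sub>v t, sq_norm t - sq_norm (w *\<^sub>v t))
      \<partial>(gauss_mat 1 n d \<Otimes>\<^sub>M gauss_vec \<sigma> n) \<partial>gauss_vec \<tau> d) =
   (\<integral>\<^sup>+t. \<integral>\<^sup>+Z. \<integral>\<^sup>+x. F ((Z, w, Z *\<^sub>v fst x + sqrt (sq_norm t - sq_norm (w *\<^sub>v t) + \<sigma>\<^sup>2) \<cdot>\<^sub>v snd x), fst x, sq_norm t - sq_norm (w *\<^sub>v t))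
      \<partial>(gauss_vec \<tau> p \<Otimes>\<^sub>M gauss_vec 1 n) \<partial>gauss_mat 1 n p \<partial>gauss_vec \<tau> d)"
proof -
  interpret U: prob_space "gauss_vec \<tau> p" by (rule prob_space_gauss_vec[OF \<tau>0])
  interpret V: prob_space "gauss_vec \<tau> d" by (rule prob_space_gauss_vec[OF \<tau>0])
  interpret N: prob_space "gauss_vec 1 n" by (rule prob_space_gauss_vec) simp
  interpret G: prob_space "gauss_mat 1 n p" by (rule prob_space_gauss_mat) simp
  interpret UV: pair_sigma_finite "gauss_vec \<tau> p" "gauss_vec \<tau> d" ..
  interpret GN: pair_sigma_finite "gauss_mat 1 n p" "gauss_vec 1 n" ..
  interpret UG: pair_sigma_finite "gauss_vec \<tau> p" "gauss_mat 1 n p" ..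
  have [measurable]: "(\<lambda>x. w) \<in> M \<rightarrow>\<^sub>M borel_mat p d" for M :: "'a measure" using w by simp
  \<comment> \<open>The integral over design and noise depends on \<open>t\<close> only through the
    pair of its seen part and its residual, which is the pair treated by
    \<open>law_signal_resid\<close>.\<close>
  define K where "K a = (\<integral>\<^sup>+x. F ((fst x, w, fst x *\<^sub>v fst a + sqrt (sq_norm (snd a) + \<sigma>\<^sup>2) \<cdot>\<^sub>v snd x), fst a, sq_norm (snd a))
      \<partial>(gauss_mat 1 n p \<Otimes>\<^sub>M gauss_vec 1 n))" for a
  have K_meas [measurable]: "K \<in> borel_measurable (borel_vec p \<Otimes>\<^sub>M borel_vec d)"
    unfolding K_def by measurable
  have resid_meas [measurable]: "resid w \<in> borel_vec d \<rightarrow>\<^sub>M borel_vec d"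
    using measurable_resid[OF w ww measurable_ident] by simp
  have inner: "(\<integral>\<^sup>+x. F ((fst x * w\<^sup>T, w, fst x *\<^sub>v t + snd x), w *\<^sub>v t, sq_norm t - sq_norm (w *\<^sub>v t))
      \<partial>(gauss_mat 1 n d \<Otimes>\<^sub>M gauss_vec \<sigma> n)) = K (w *\<^sub>v t, resid w t)" if t: "t \<in> carrier_vec d" for t
  proof -
    define u where "u = w *\<^sub>v t"
    define z where "z = resid w t"
    have u: "u \<in> carrier_vec p" using w t by (simp add: u_def)
    have z: "z \<in> carrier_vec d" using resid_carrier[OF w ww t] by (simp add: z_def)
    have [measurable]: "(\<lambda>x. u) \<in> M \<rightarrow>\<^sub>M borel_vec p" "(\<lambda>x. z) \<in> M \<rightarrow>\<^sub>M borel_vec d" for M :: "'a measure"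
      using u z by auto
    have q: "sq_norm t - sq_norm u = sq_norm z" using sq_norm_resid[OF w ww t] by (simp add: u_def z_def)
    define H where "H y = F ((fst y, w, fst y *\<^sub>v u + snd y), u, sq_norm z)" for y
    have H [measurable]: "H \<in> borel_measurable (borel_mat n p \<Otimes>\<^sub>M borel_vec n)" unfolding H_def by measurable
    \<comment> \<open>Decomposing \<open>t\<close> into row space and kernel splits the response
      into the projected linear model and the extra noise \<open>x *\<^sub>v z\<close>.\<close>
    have split: "x *\<^sub>v t + e = (x * w\<^sup>T) *\<^sub>v u + (x *\<^sub>v z + e)" if x: "x \<in> carrier_mat n d" and e: "e \<in> carrier_vec n" for x e
    proof -
      have "t = w\<^sup>T *\<^sub>v u + z" using resid_decomp[OF w ww t] by (simp add: u_def z_def)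
      then have "x *\<^sub>v t = x *\<^sub>v (w\<^sup>T *\<^sub>v u) + x *\<^sub>v z"
        using x w u z by (simp add: mult_add_distrib_mat_vec[OF x])
      then show ?thesis
        using x w u z e assoc_mult_mat_vec[of x n d "w\<^sup>T" p u] by (simp add: assoc_add_vec[of _ n])
    qed
    have "(\<integral>\<^sup>+x. F ((fst x * w\<^sup>T, w, fst x *\<^sub>v t + snd x), u, sq_norm t - sq_norm u) \<partial>(gauss_mat 1 n d \<Otimes>\<^sub>M gauss_vec \<sigma> n)) =
        (\<integral>\<^sup>+x. H (fst x * w\<^sup>T, fst x *\<^sub>v z + snd x) \<partial>(gauss_mat 1 n d \<Otimes>\<^sub>M gauss_vec \<sigma> n))"
      by (intro nn_integral_cong) (auto simp: space_pair_measure H_def split q)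
    also have "\<dots> = integral\<^sup>N (distr (gauss_mat 1 n d \<Otimes>\<^sub>M gauss_vec \<sigma> n) (borel_mat n p \<Otimes>\<^sub>M borel_vec n) (\<lambda>x. (fst x * w\<^sup>T, fst x *\<^sub>v z + snd x))) H"
      by (subst nn_integral_distr) auto
    also have "\<dots> = integral\<^sup>N (distr (gauss_mat 1 n p \<Otimes>\<^sub>M gauss_vec 1 n) (borel_mat n p \<Otimes>\<^sub>M borel_vec n) (\<lambda>x. (fst x, sqrt (sq_norm z + \<sigma>\<^sup>2) \<cdot>\<^sub>v snd x))) H"
      using law_design_noise[OF w ww \<sigma>0 z] mult_resid[OF w ww t] by (simp add: z_def)
    also have "\<dots> = (\<integral>\<^sup>+x. H (fst x, sqrt (sq_norm z + \<sigma>\<^sup>2) \<cdot>\<^sub>v snd x) \<partial>(gauss_mat 1 n p \<Otimes>\<^sub>M gauss_vec 1 n))"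
      by (subst nn_integral_distr) auto
    also have "\<dots> = K (u, z)" by (simp add: K_def H_def)
    finally show ?thesis by (simp add: u_def z_def)
  qed
  have "(\<integral>\<^sup>+t. \<integral>\<^sup>+x. F ((fst x * w\<^sup>T, w, fst x *\<^sub>v t + snd x), w *\<^sub>v t, sq_norm t - sq_norm (w *\<^sub>v t))
      \<partial>(gauss_mat 1 n d \<Otimes>\<^sub>M gauss_vec \<sigma> n) \<partial>gauss_vec \<tau> d) = (\<integral>\<^sup>+t. K (w *\<^sub>v t, resid w t) \<partial>gauss_vec \<tau> d)"
    by (intro nn_integral_cong) (simp add: inner)
  also have "\<dots> = integral\<^sup>N (distr (gauss_vec \<tau> d) (borel_vec p \<Otimes>\<^sub>M borel_vec d) (\<lambda>t. (w *\<^sub>v t, resid w t))) K"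
    by (subst nn_integral_distr) auto
  also have "\<dots> = integral\<^sup>N (distr (gauss_vec \<tau> p \<Otimes>\<^sub>M gauss_vec \<tau> d) (borel_vec p \<Otimes>\<^sub>M borel_vec d) (\<lambda>x. (fst x, resid w (snd x)))) K"
    by (simp only: law_signal_resid[OF w ww \<tau>0])
  also have "\<dots> = (\<integral>\<^sup>+x. K (fst x, resid w (snd x)) \<partial>(gauss_vec \<tau> p \<Otimes>\<^sub>M gauss_vec \<tau> d))"
    by (subst nn_integral_distr) auto
  also have "\<dots> = (\<integral>\<^sup>+t. \<integral>\<^sup>+u. K (u, resid w t) \<partial>gauss_vec \<tau> p \<partial>gauss_vec \<tau> d)"
    by (subst UV.nn_integral_snd[symmetric]) auto
  also have "\<dots> = (\<integral>\<^sup>+t. \<integral>\<^sup>+Z. \<integral>\<^sup>+x. F ((Z, w, Z *\<^sub>v fst x + sqrt (sq_norm t - sq_norm (w *\<^sub>v t) + \<sigma>\<^sup>2) \<cdot>\<^sub>v snd x), fst x, sq_norm t - sq_norm (w *\<^sub>v t))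
      \<partial>(gauss_vec \<tau> p \<Otimes>\<^sub>M gauss_vec 1 n) \<partial>gauss_mat 1 n p \<partial>gauss_vec \<tau> d)"
  proof (rule nn_integral_cong)
    fix t assume "t \<in> space (gauss_vec \<tau> d)"
    then have q: "sq_norm t - sq_norm (w *\<^sub>v t) = sq_norm (resid w t)" using sq_norm_resid[OF w ww] by simp
    let ?q = "sq_norm (resid w t)"
    have "(\<integral>\<^sup>+u. K (u, resid w t) \<partial>gauss_vec \<tau> p) =
        (\<integral>\<^sup>+u. \<integral>\<^sup>+Z. \<integral>\<^sup>+e. F ((Z, w, Z *\<^sub>v u + sqrt (?q + \<sigma>\<^sup>2) \<cdot>\<^sub>v e), u, ?q) \<partial>gauss_vec 1 n \<partial>gauss_mat 1 n p \<partial>gauss_vec \<tau> p)"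
      unfolding K_def
    proof (intro nn_integral_cong)
      fix u assume "u \<in> space (gauss_vec \<tau> p)"
      then have [measurable]: "(\<lambda>x. u) \<in> M \<rightarrow>\<^sub>M borel_vec p" for M :: "'a measure" by simp
      show "(\<integral>\<^sup>+x. F ((fst x, w, fst x *\<^sub>v fst (u, resid w t) + sqrt (sq_norm (snd (u, resid w t)) + \<sigma>\<^sup>2) \<cdot>\<^sub>v snd x), fst (u, resid w t), sq_norm (snd (u, resid w t)))
          \<partial>(gauss_mat 1 n p \<Otimes>\<^sub>M gauss_vec 1 n)) =
        (\<integral>\<^sup>+Z. \<integral>\<^sup>+e. F ((Z, w, Z *\<^sub>v u + sqrt (?q + \<sigma>\<^sup>2) \<cdot>\<^sub>v e), u, ?q) \<partial>gauss_vec 1 n \<partial>gauss_mat 1 n p)"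
        by (subst N.nn_integral_fst[symmetric]) auto
    qed
    \<comment> \<open>The design is moved outside signal and noise because the reflection acts for a
      fixed design.\<close>
    also have "\<dots> = (\<integral>\<^sup>+Z. \<integral>\<^sup>+u. \<integral>\<^sup>+e. F ((Z, w, Z *\<^sub>v u + sqrt (?q + \<sigma>\<^sup>2) \<cdot>\<^sub>v e), u, ?q) \<partial>gauss_vec 1 n \<partial>gauss_vec \<tau> p \<partial>gauss_mat 1 n p)"
      by (rule UG.Fubini'[symmetric]) measurable
    also have "\<dots> = (\<integral>\<^sup>+Z. \<integral>\<^sup>+x. F ((Z, w, Z *\<^sub>v fst x + sqrt (?q + \<sigma>\<^sup>2) \<cdot>\<^sub>v snd x), fst x, ?q) \<partial>(gauss_vec \<tau> p \<Otimes>\<^sub>M gauss_vec 1 n) \<partial>gauss_mat 1 n p)"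
    proof (intro nn_integral_cong)
      fix Z assume "Z \<in> space (gauss_mat 1 n p)"
      then have [measurable]: "(\<lambda>x. Z) \<in> M \<rightarrow>\<^sub>M borel_mat n p" for M :: "'a measure" by simp
      show "(\<integral>\<^sup>+u. \<integral>\<^sup>+e. F ((Z, w, Z *\<^sub>v u + sqrt (?q + \<sigma>\<^sup>2) \<cdot>\<^sub>v e), u, ?q) \<partial>gauss_vec 1 n \<partial>gauss_vec \<tau> p) =
          (\<integral>\<^sup>+x. F ((Z, w, Z *\<^sub>v fst x + sqrt (?q + \<sigma>\<^sup>2) \<cdot>\<^sub>v snd x), fst x, ?q) \<partial>(gauss_vec \<tau> p \<Otimes>\<^sub>M gauss_vec 1 n))"
        by (subst N.nn_integral_fst[symmetric]) auto
    qed
    finally show "(\<integral>\<^sup>+u. K (u, resid w t) \<partial>gauss_vec \<tau> p) =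
      (\<integral>\<^sup>+Z. \<integral>\<^sup>+x. F ((Z, w, Z *\<^sub>v fst x + sqrt (sq_norm t - sq_norm (w *\<^sub>v t) + \<sigma>\<^sup>2) \<cdot>\<^sub>v snd x), fst x, sq_norm t - sq_norm (w *\<^sub>v t))
      \<partial>(gauss_vec \<tau> p \<Otimes>\<^sub>M gauss_vec 1 n) \<partial>gauss_mat 1 n p)" unfolding q .
  qed
  finally show ?thesis .
qed

end

text \<open>
  The posterior mean of \<open>w \<theta>\<close> when the squared norm \<open>q\<close> of the part of \<open>\<theta>\<close> not seen by \<open>w\<close> is
  known as well.  In the noiseless case \<open>q + \<sigma>\<^sup>2 = 0\<close> the value \<open>u\<close> of \<open>w \<theta>\<close> itself serves the purpose.
\<close>

definition center :: "nat \<Rightarrow> nat \<Rightarrow> real \<Rightarrow> real \<Rightarrow> (real mat \<times> real mat \<times> real vec) \<times> real vec \<times> real \<Rightarrow> real vec" where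
  "center n p \<tau> \<sigma> = (\<lambda>(D, u, q). if 0 < q + \<sigma>\<^sup>2 then ridge_sol ((q + \<sigma>\<^sup>2) / (real n * \<tau>\<^sup>2)) n p (fst D) (snd (snd D)) else u)"

lemma measurable_center [measurable]:
  "center n p \<tau> \<sigma> \<in> signal_space n p d \<rightarrow>\<^sub>M borel_vec p"
  unfolding center_def by measurable

definition reflect :: "nat \<Rightarrow> nat \<Rightarrow> real \<Rightarrow> real \<Rightarrow> (real mat \<times> real mat \<times> real vec) \<times> real vec \<times> real \<Rightarrow>
    (real mat \<times> real mat \<times> real vec) \<times> real vec \<times> real" where
  "reflect n p \<tau> \<sigma> x = (fst x, 2 \<cdot>\<^sub>v center n p \<tau> \<sigma> x - fst (snd x), snd (snd x))"

lemma measurable_reflect [measurable]: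
  "reflect n p \<tau> \<sigma> \<in> signal_space n p d \<rightarrow>\<^sub>M
    signal_space n p d"
  unfolding reflect_def by measurable

text \<open>For a positive noise variance this is \<open>law_reflection\<close> with the Bayesian
  penalty. Otherwise \<open>center\<close> is the signal itself and the reflection changes
  nothing.\<close>

lemma model_reflect:
  assumes Z: "Z \<in> carrier_mat n p" and w: "w \<in> carrier_mat p d" and n: "0 < n" and \<tau>: "0 < \<tau>"
    and F [measurable]: "F \<in> borel_measurable (signal_space n p d)"
  shows "(\<integral>\<^sup>+x. F ((Z, w, Z *\<^sub>v fst x + sqrt (q + \<sigma>\<^sup>2) \<cdot>\<^sub>v snd x), fst x, q) \<partial>(gauss_vec \<tau> p \<Otimes>\<^sub>M gauss_vec 1 n)) =
    (\<integral>\<^sup>+x. F (reflect n p \<tau> \<sigma> ((Z, w, Z *\<^sub>v fst x + sqrt (q + \<sigma>\<^sup>2) \<cdot>\<^sub>v snd x), fst x, q)) \<partial>(gauss_vec \<tau> p \<Otimes>\<^sub>M gauss_vec 1 n))"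
proof (cases "0 < q + \<sigma>\<^sup>2")
  case True
  let ?s = "sqrt (q + \<sigma>\<^sup>2)"
  let ?P = "gauss_vec \<tau> p \<Otimes>\<^sub>M gauss_vec 1 n"
  define \<mu> where "\<mu> = ?s\<^sup>2 / (real n * \<tau>\<^sup>2)"
  have \<mu>: "\<mu> = (q + \<sigma>\<^sup>2) / (real n * \<tau>\<^sup>2)" using True by (simp add: \<mu>_def)
  have [measurable]: "(\<lambda>x. Z) \<in> M \<rightarrow>\<^sub>M borel_mat n p" "(\<lambda>x. w) \<in> M \<rightarrow>\<^sub>M borel_mat p d" for M :: "'a measure"
    using Z w by auto
  define H where "H y = F ((Z, w, fst y), snd y, q)" for y
  have [measurable]: "H \<in> borel_measurable (borel_vec n \<Otimes>\<^sub>M borel_vec p)" unfolding H_def by measurable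
  have r: "ridge_sol \<mu> n p Z \<in> borel_vec n \<rightarrow>\<^sub>M borel_vec p" by measurable
  note [measurable] = r
  let ?y = "\<lambda>x. Z *\<^sub>v fst x + ?s \<cdot>\<^sub>v snd x"
  have "(\<integral>\<^sup>+x. F ((Z, w, ?y x), fst x, q) \<partial>?P) = (\<integral>\<^sup>+x. H (?y x, fst x) \<partial>?P)"
    by (simp add: H_def)
  also have "\<dots> = integral\<^sup>N (distr ?P (borel_vec n \<Otimes>\<^sub>M borel_vec p) (\<lambda>x. (?y x, fst x))) H"
    by (subst nn_integral_distr) auto
  also have "\<dots> = integral\<^sup>N (distr ?P (borel_vec n \<Otimes>\<^sub>M borel_vec p) (\<lambda>x. (?y x, 2 \<cdot>\<^sub>v ridge_sol \<mu> n p Z (?y x) - fst x))) H"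
    using law_reflection[OF less_imp_le[OF \<tau>] Z r ridge_sol_normal_eq[OF Z n \<tau> _ \<mu>_def]] True by simp
  also have "\<dots> = (\<integral>\<^sup>+x. H (?y x, 2 \<cdot>\<^sub>v ridge_sol \<mu> n p Z (?y x) - fst x) \<partial>?P)"
    by (subst nn_integral_distr) auto
  also have "\<dots> = (\<integral>\<^sup>+x. F (reflect n p \<tau> \<sigma> ((Z, w, ?y x), fst x, q)) \<partial>?P)"
    using True by (simp add: H_def reflect_def center_def \<mu>)
  finally show ?thesis .
next
  case False
  have "2 \<cdot>\<^sub>v u - u = u" if "u \<in> carrier_vec p" for u :: "real vec"
    using that by (intro eq_vecI) auto
  then show ?thesis
    using False by (intro nn_integral_cong) (auto simp: reflect_def center_def space_pair_measure)
qed

context ridge_model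
begin

definition Y :: "'w \<Rightarrow> real vec" where "Y \<omega> = X \<omega> *\<^sub>v \<theta> \<omega> + \<E> \<omega>"

definition D :: "'w \<Rightarrow> real mat \<times> real mat \<times> real vec" where "D \<omega> = (X \<omega> * (W \<omega>)\<^sup>T, W \<omega>, Y \<omega>)"

definition \<eta> :: "'w \<Rightarrow> real vec" where "\<eta> \<omega> = W \<omega> *\<^sub>v \<theta> \<omega>"

definition q :: "'w \<Rightarrow> real" where "q \<omega> = sq_norm (\<theta> \<omega>) - sq_norm (\<eta> \<omega>)"

abbreviation msq :: "('w \<Rightarrow> real vec) \<Rightarrow> ennreal" where
  "msq u \<equiv> \<integral>\<^sup>+\<omega>. ennreal (sq_norm (u \<omega>)) \<partial>M"

lemma measurable_Y [measurable]: "Y \<in> M \<rightarrow>\<^sub>M borel_vec n"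
  unfolding Y_def by measurable

lemma measurable_D [measurable]: "D \<in> M \<rightarrow>\<^sub>M data_space n p d"
  unfolding D_def by measurable

lemma measurable_\<eta> [measurable]: "\<eta> \<in> M \<rightarrow>\<^sub>M borel_vec p"
  unfolding \<eta>_def by measurable

lemma measurable_q [measurable]: "q \<in> borel_measurable M"
  unfolding q_def by measurable

lemma model_law:
  assumes F [measurable]: "F \<in> borel_measurable (signal_space n p d)"
  shows "(\<integral>\<^sup>+\<omega>. F (D \<omega>, \<eta> \<omega>, q \<omega>) \<partial>M) =
    (\<integral>\<^sup>+w. \<integral>\<^sup>+t. \<integral>\<^sup>+Z. \<integral>\<^sup>+x. F ((Z, w, Z *\<^sub>v fst x + sqrt (sq_norm t - sq_norm (w *\<^sub>v t) + \<sigma>\<^sup>2) \<cdot>\<^sub>v snd x), fst x, sq_norm t - sq_norm (w *\<^sub>v t))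
      \<partial>(gauss_vec \<tau> p \<Otimes>\<^sub>M gauss_vec 1 n) \<partial>gauss_mat 1 n p \<partial>gauss_vec \<tau> d \<partial>\<mu>W)"
proof -
  interpret V: prob_space "gauss_vec \<tau> d" by (rule prob_space_gauss_vec[OF \<tau>0])
  interpret N: prob_space "gauss_vec \<sigma> n" by (rule prob_space_gauss_vec[OF \<sigma>0])
  interpret G: prob_space "gauss_mat 1 n d" by (rule prob_space_gauss_mat) simp
  interpret GN: pair_prob_space "gauss_mat 1 n d" "gauss_vec \<sigma> n" ..
  interpret VGN: pair_prob_space "gauss_vec \<tau> d" "gauss_mat 1 n d \<Otimes>\<^sub>M gauss_vec \<sigma> n" ..
  define H where "H a = (case a of (w, t, x) \<Rightarrow> F ((fst x * w\<^sup>T, w, fst x *\<^sub>v t + snd x), w *\<^sub>v t, sq_norm t - sq_norm (w *\<^sub>v t)))" for a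
  have H [measurable]: "H \<in> borel_measurable (borel_mat p d \<Otimes>\<^sub>M (borel_vec d \<Otimes>\<^sub>M (borel_mat n d \<Otimes>\<^sub>M borel_vec n)))"
    unfolding H_def by measurable
  have "(\<integral>\<^sup>+\<omega>. F (D \<omega>, \<eta> \<omega>, q \<omega>) \<partial>M) = (\<integral>\<^sup>+\<omega>. H (W \<omega>, \<theta> \<omega>, X \<omega>, \<E> \<omega>) \<partial>M)"
    by (simp add: H_def D_def Y_def \<eta>_def q_def)
  also have "\<dots> = integral\<^sup>N (\<mu>W \<Otimes>\<^sub>M (gauss_vec \<tau> d \<Otimes>\<^sub>M (gauss_mat 1 n d \<Otimes>\<^sub>M gauss_vec \<sigma> n))) H"
    unfolding joint_law[symmetric] by (subst nn_integral_distr) auto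
  also have "\<dots> = (\<integral>\<^sup>+w. \<integral>\<^sup>+a. H (w, a) \<partial>(gauss_vec \<tau> d \<Otimes>\<^sub>M (gauss_mat 1 n d \<Otimes>\<^sub>M gauss_vec \<sigma> n)) \<partial>\<mu>W)"
    by (rule VGN.nn_integral_fst[symmetric]) measurable
  also have "\<dots> = (\<integral>\<^sup>+w. \<integral>\<^sup>+t. \<integral>\<^sup>+x. H (w, t, x) \<partial>(gauss_mat 1 n d \<Otimes>\<^sub>M gauss_vec \<sigma> n) \<partial>gauss_vec \<tau> d \<partial>\<mu>W)"
  proof (rule nn_integral_cong)
    fix w assume "w \<in> space \<mu>W"
    then have [measurable]: "(\<lambda>x. w) \<in> M \<rightarrow>\<^sub>M borel_mat p d" for M :: "'a measure" by simp
    show "(\<integral>\<^sup>+a. H (w, a) \<partial>(gauss_vec \<tau> d \<Otimes>\<^sub>M (gauss_mat 1 n d \<Otimes>\<^sub>M gauss_vec \<sigma> n))) =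
      (\<integral>\<^sup>+t. \<integral>\<^sup>+x. H (w, t, x) \<partial>(gauss_mat 1 n d \<Otimes>\<^sub>M gauss_vec \<sigma> n) \<partial>gauss_vec \<tau> d)"
      by (rule GN.nn_integral_fst[symmetric]) measurable
  qed
  also have "\<dots> = (\<integral>\<^sup>+w. \<integral>\<^sup>+t. \<integral>\<^sup>+Z. \<integral>\<^sup>+x. F ((Z, w, Z *\<^sub>v fst x + sqrt (sq_norm t - sq_norm (w *\<^sub>v t) + \<sigma>\<^sup>2) \<cdot>\<^sub>v snd x), fst x, sq_norm t - sq_norm (w *\<^sub>v t))
      \<partial>(gauss_vec \<tau> p \<Otimes>\<^sub>M gauss_vec 1 n) \<partial>gauss_mat 1 n p \<partial>gauss_vec \<tau> d \<partial>\<mu>W)"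
    using W_stiefel AE_space[of \<mu>W]
    by (intro nn_integral_cong_AE, eventually_elim) (simp add: H_def model_law_fixed \<tau>0 \<sigma>0)
  finally show ?thesis .
qed

text \<open>In \<open>model_law\<close> the innermost integral has \<open>w\<close>,
  \<open>t\<close> and \<open>Z\<close> fixed, hence also \<open>q\<close>;
  \<open>model_reflect\<close> applies to it pointwise.\<close>

lemma reflection_symmetry:
  assumes n: "0 < n" and \<tau>: "0 < \<tau>"
    and F [measurable]: "F \<in> borel_measurable (signal_space n p d)"
  shows "(\<integral>\<^sup>+\<omega>. F (D \<omega>, \<eta> \<omega>, q \<omega>) \<partial>M) = (\<integral>\<^sup>+\<omega>. F (reflect n p \<tau> \<sigma> (D \<omega>, \<eta> \<omega>, q \<omega>)) \<partial>M)"
  unfolding model_law[OF F] model_law[OF measurable_compose[OF measurable_reflect F]]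
  by (rule nn_integral_cong, rule nn_integral_cong, rule nn_integral_cong, rule model_reflect[OF _ _ n \<tau> F]) simp_all

end

section \<open>Distance to the conditional mean given the unseen signal strength\<close>

lemma borel_measurable_sq_norm: "sq_norm \<in> borel_measurable (borel_vec m)"
  by (rule measurable_sq_norm[OF measurable_ident_sets[OF refl]])

text \<open>The parallelogram law: \<open>c\<close> is the midpoint of \<open>u\<close> and its
  reflection.\<close>

lemma sq_norm_reflect:
  assumes "g \<in> carrier_vec m" "c \<in> carrier_vec m" "u \<in> carrier_vec m"
  shows "sq_norm (g - u) + sq_norm (g - (2 \<cdot>\<^sub>v c - u)) = 2 * (sq_norm (g - c) + sq_norm (c - u))"
proof -
  have "(g $ i - u $ i)\<^sup>2 + (g $ i - (2 * c $ i - u $ i))\<^sup>2 = 2 * ((g $ i - c $ i)\<^sup>2 + (c $ i - u $ i)\<^sup>2)" for i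
    by (simp add: power2_eq_square algebra_simps)
  then show ?thesis
    using assms by (simp add: sq_norm_sum sum_distrib_left flip: sum.distrib)
qed

lemma ennreal_double_cancel: "(a :: ennreal) + a = 2 * b \<Longrightarrow> a = b"
  by (simp add: ennreal_mult_cancel_left flip: mult_2)

lemma ennreal_two: "0 \<le> x \<Longrightarrow> 2 * ennreal x = ennreal (2 * x)"
  by (simp add: ennreal_mult')

lemma power2_add_le: "(a + b)\<^sup>2 \<le> 2 * a\<^sup>2 + 2 * b\<^sup>2" for a b :: real
  using zero_le_power2[of "a - b"] by (simp add: power2_eq_square algebra_simps)

lemma power2_diff_le: "(a - b)\<^sup>2 \<le> 2 * a\<^sup>2 + 2 * b\<^sup>2" for a b :: real
  using power2_add_le[of a "- b"] by simp

lemma AE_gauss_vec_zero: "AE v in gauss_vec 0 m. v = 0\<^sub>v m"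
proof -
  have "AE v in gauss_vec 0 m. sq_norm v = 0"
    using gauss_vec_sq_norm(1,2)[of 0 m] by (subst integral_nonneg_eq_0_iff_AE[symmetric]) auto
  then show ?thesis
    using AE_space[of "gauss_vec 0 m"] by eventually_elim (auto simp: sq_norm_eq_0_iff[of _ m])
qed

lemma (in prob_space) nn_integral_const_prob: "(\<integral>\<^sup>+x. c \<partial>M) = c"
  by (simp add: emeasure_space_1)

context ridge_model
begin

lemma AE_stiefel: "AE \<omega> in M. W \<omega> * (W \<omega>)\<^sup>T = 1\<^sub>m p"
proof -
  have [measurable]: "(\<lambda>w. w * w\<^sup>T) \<in> borel_mat p d \<rightarrow>\<^sub>M borel_mat p p" by measurable
  show ?thesis using AE_distrD[OF W_meas W_stiefel] .
qed

lemma carriers: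
  assumes "\<omega> \<in> space M"
  shows "X \<omega> \<in> carrier_mat n d" "\<theta> \<omega> \<in> carrier_vec d" "\<E> \<omega> \<in> carrier_vec n" "W \<omega> \<in> carrier_mat p d"
    "Y \<omega> \<in> carrier_vec n" "\<eta> \<omega> \<in> carrier_vec p" "X \<omega> * (W \<omega>)\<^sup>T \<in> carrier_mat n p"
  using measurable_space[OF X_meas assms] measurable_space[OF \<theta>_meas assms] measurable_space[OF \<E>_meas assms]
    measurable_space[OF W_meas assms] by (auto simp: Y_def \<eta>_def)

text \<open>Not an estimator: it depends on \<open>q\<close>, and in the noiseless case on
  \<open>\<eta>\<close>. It serves only as a point of comparison.\<close>

definition C :: "'w \<Rightarrow> real vec" where
  "C \<omega> = center n p \<tau> \<sigma> (D \<omega>, \<eta> \<omega>, q \<omega>)"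

lemma measurable_C [measurable]: "C \<in> M \<rightarrow>\<^sub>M borel_vec p"
  unfolding C_def by measurable

lemma reflect_D: "reflect n p \<tau> \<sigma> (D \<omega>, \<eta> \<omega>, q \<omega>) = (D \<omega>, 2 \<cdot>\<^sub>v C \<omega> - \<eta> \<omega>, q \<omega>)"
  by (simp add: reflect_def C_def)

lemma C_carrier: "\<omega> \<in> space M \<Longrightarrow> C \<omega> \<in> carrier_vec p"
  using measurable_space[OF measurable_C] by simp

text \<open>The errors of \<open>g\<close> against \<open>\<eta>\<close> and against the reflected
  \<open>\<eta>\<close> have the same mean; the parallelogram law adds them and the factor 2
  cancels. In \<open>ennreal\<close> this makes sense for every measurable \<open>g\<close>, also
  one of infinite error.\<close>

lemma center_pythagoras:
  assumes n: "0 < n" and \<tau>: "0 < \<tau>"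
    and g [measurable]: "g \<in> data_space n p d \<rightarrow>\<^sub>M borel_vec p"
  shows "msq (\<lambda>\<omega>. g (D \<omega>) - \<eta> \<omega>) =
    msq (\<lambda>\<omega>. g (D \<omega>) - C \<omega>) + msq (\<lambda>\<omega>. C \<omega> - \<eta> \<omega>)"
proof (rule ennreal_double_cancel)
  have gc: "g (D \<omega>) \<in> carrier_vec p" if "\<omega> \<in> space M" for \<omega>
    using measurable_space[OF g measurable_space[OF measurable_D that]] by simp
  have "msq (\<lambda>\<omega>. g (D \<omega>) - \<eta> \<omega>) = msq (\<lambda>\<omega>. g (D \<omega>) - (2 \<cdot>\<^sub>v C \<omega> - \<eta> \<omega>))"
    using reflection_symmetry[OF n \<tau>, of "\<lambda>x. ennreal (sq_norm (g (fst x) - fst (snd x)))"] by (simp add: reflect_D)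
  then have "msq (\<lambda>\<omega>. g (D \<omega>) - \<eta> \<omega>) + msq (\<lambda>\<omega>. g (D \<omega>) - \<eta> \<omega>) =
      msq (\<lambda>\<omega>. g (D \<omega>) - \<eta> \<omega>) + msq (\<lambda>\<omega>. g (D \<omega>) - (2 \<cdot>\<^sub>v C \<omega> - \<eta> \<omega>))"
    by simp
  also have "\<dots> = (\<integral>\<^sup>+\<omega>. ennreal (sq_norm (g (D \<omega>) - \<eta> \<omega>)) + ennreal (sq_norm (g (D \<omega>) - (2 \<cdot>\<^sub>v C \<omega> - \<eta> \<omega>))) \<partial>M)"
    by (rule nn_integral_add[symmetric]) measurable
  also have "\<dots> = (\<integral>\<^sup>+\<omega>. 2 * (ennreal (sq_norm (g (D \<omega>) - C \<omega>)) + ennreal (sq_norm (C \<omega> - \<eta> \<omega>))) \<partial>M)"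
  proof (rule nn_integral_cong)
    fix \<omega> assume \<omega>: "\<omega> \<in> space M"
    show "ennreal (sq_norm (g (D \<omega>) - \<eta> \<omega>)) + ennreal (sq_norm (g (D \<omega>) - (2 \<cdot>\<^sub>v C \<omega> - \<eta> \<omega>))) =
        2 * (ennreal (sq_norm (g (D \<omega>) - C \<omega>)) + ennreal (sq_norm (C \<omega> - \<eta> \<omega>)))"
      using sq_norm_reflect[OF gc[OF \<omega>] C_carrier[OF \<omega>] carriers(6)[OF \<omega>]]
      by (simp only: ennreal_plus[symmetric] ennreal_two sq_norm_nonneg add_nonneg_nonneg)
  qed
  also have "\<dots> = 2 * (msq (\<lambda>\<omega>. g (D \<omega>) - C \<omega>) + msq (\<lambda>\<omega>. C \<omega> - \<eta> \<omega>))"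
    by (subst nn_integral_cmult, measurable) (subst nn_integral_add, auto)
  finally show "msq (\<lambda>\<omega>. g (D \<omega>) - \<eta> \<omega>) + msq (\<lambda>\<omega>. g (D \<omega>) - \<eta> \<omega>) =
    2 * (msq (\<lambda>\<omega>. g (D \<omega>) - C \<omega>) + msq (\<lambda>\<omega>. C \<omega> - \<eta> \<omega>))" .
qed

text \<open>A Jensen inequality for the conditional mean, obtained from the parallelogram law around
  0 by dropping the distance from \<open>C\<close> to \<open>\<eta>\<close>. The reflection fixes
  \<open>q\<close>, so a weight in \<open>q\<close> is allowed; the weight used later is the squared
  relative error of the penalty.\<close>

lemma center_contraction:
  assumes n: "0 < n" and \<tau>: "0 < \<tau>" and h [measurable]: "h \<in> borel_measurable borel" and h0: "\<And>x. 0 \<le> h x"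
  shows "(\<integral>\<^sup>+\<omega>. ennreal (h (q \<omega>) * sq_norm (C \<omega>)) \<partial>M) \<le> (\<integral>\<^sup>+\<omega>. ennreal (h (q \<omega>) * sq_norm (\<eta> \<omega>)) \<partial>M)" (is "?c \<le> ?e")
proof -
  have "?e = (\<integral>\<^sup>+\<omega>. ennreal (h (q \<omega>) * sq_norm (2 \<cdot>\<^sub>v C \<omega> - \<eta> \<omega>)) \<partial>M)"
    using reflection_symmetry[OF n \<tau>, of "\<lambda>x. ennreal (h (snd (snd x)) * sq_norm (fst (snd x)))"] by (simp add: reflect_D)
  then have "?e + ?e = ?e + (\<integral>\<^sup>+\<omega>. ennreal (h (q \<omega>) * sq_norm (2 \<cdot>\<^sub>v C \<omega> - \<eta> \<omega>)) \<partial>M)" by simp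
  also have "\<dots> = (\<integral>\<^sup>+\<omega>. ennreal (h (q \<omega>) * sq_norm (\<eta> \<omega>)) + ennreal (h (q \<omega>) * sq_norm (2 \<cdot>\<^sub>v C \<omega> - \<eta> \<omega>)) \<partial>M)"
    by (rule nn_integral_add[symmetric]) measurable
  also have "\<dots> \<ge> (\<integral>\<^sup>+\<omega>. 2 * ennreal (h (q \<omega>) * sq_norm (C \<omega>)) \<partial>M)"
  proof (rule nn_integral_mono)
    fix \<omega> assume \<omega>: "\<omega> \<in> space M"
    have z: "sq_norm (- v) = sq_norm v" for v
      by (simp add: sq_norm_sum)
    have "sq_norm (\<eta> \<omega>) + sq_norm (2 \<cdot>\<^sub>v C \<omega> - \<eta> \<omega>) = 2 * (sq_norm (C \<omega>) + sq_norm (C \<omega> - \<eta> \<omega>))"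
      using sq_norm_reflect[of "0\<^sub>v p" p "C \<omega>" "\<eta> \<omega>"] C_carrier[OF \<omega>] carriers(6)[OF \<omega>] by (simp add: z)
    then have "2 * sq_norm (C \<omega>) \<le> sq_norm (\<eta> \<omega>) + sq_norm (2 \<cdot>\<^sub>v C \<omega> - \<eta> \<omega>)"
      using sq_norm_nonneg[of "C \<omega> - \<eta> \<omega>"] by simp
    from mult_left_mono[OF this h0[of "q \<omega>"]]
    have "2 * (h (q \<omega>) * sq_norm (C \<omega>)) \<le> h (q \<omega>) * sq_norm (\<eta> \<omega>) + h (q \<omega>) * sq_norm (2 \<cdot>\<^sub>v C \<omega> - \<eta> \<omega>)"
      by (simp add: distrib_left mult_ac)
    then have "ennreal (2 * (h (q \<omega>) * sq_norm (C \<omega>))) \<le> ennreal (h (q \<omega>) * sq_norm (\<eta> \<omega>) + h (q \<omega>) * sq_norm (2 \<cdot>\<^sub>v C \<omega> - \<eta> \<omega>))"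
      by (rule ennreal_leI)
    then show "2 * ennreal (h (q \<omega>) * sq_norm (C \<omega>)) \<le> ennreal (h (q \<omega>) * sq_norm (\<eta> \<omega>)) + ennreal (h (q \<omega>) * sq_norm (2 \<cdot>\<^sub>v C \<omega> - \<eta> \<omega>))"
      using h0 by (simp add: ennreal_mult' ennreal_plus)
  qed
  also have "(\<integral>\<^sup>+\<omega>. 2 * ennreal (h (q \<omega>) * sq_norm (C \<omega>)) \<partial>M) = 2 * ?c"
    by (rule nn_integral_cmult) measurable
  finally have "2 * ?c \<le> 2 * ?e" by (simp add: mult_2)
  then show ?thesis by (simp add: ennreal_mult_le_mult_iff)
qed

text \<open>In \<open>model_law\<close> the signal is integrated against its own Gaussian law while
  \<open>q\<close> depends only on \<open>w\<close> and \<open>t\<close>; therefore the expectation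
  factors.\<close>

lemma signal_moment:
  assumes h [measurable]: "h \<in> borel_measurable borel" and h0: "\<And>x. 0 \<le> h x"
    and k [measurable]: "k \<in> borel_measurable (borel_vec p)" and k0: "\<And>v. 0 \<le> k v"
    and ki: "integrable (gauss_vec \<tau> p) k" and kv: "(\<integral>v. k v \<partial>gauss_vec \<tau> p) = v"
  shows "(\<integral>\<^sup>+\<omega>. ennreal (h (q \<omega>) * k (\<eta> \<omega>)) \<partial>M) = ennreal v * (\<integral>\<^sup>+\<omega>. ennreal (h (q \<omega>)) \<partial>M)"
proof -
  interpret U: prob_space "gauss_vec \<tau> p" by (rule prob_space_gauss_vec[OF \<tau>0])
  interpret V: prob_space "gauss_vec \<tau> d" by (rule prob_space_gauss_vec[OF \<tau>0])
  interpret N: prob_space "gauss_vec 1 n" by (rule prob_space_gauss_vec) simp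
  interpret G: prob_space "gauss_mat 1 n p" by (rule prob_space_gauss_mat) simp
  interpret UN: pair_prob_space "gauss_vec \<tau> p" "gauss_vec 1 n" ..
  have "(\<integral>\<^sup>+v. ennreal (k v) \<partial>gauss_vec \<tau> p) = ennreal v"
    using nn_integral_eq_integral[OF ki] k0 kv by simp
  then have pair: "(\<integral>\<^sup>+x. ennreal (k (fst x)) \<partial>(gauss_vec \<tau> p \<Otimes>\<^sub>M gauss_vec 1 n)) = ennreal v"
    by (subst N.nn_integral_fst[symmetric]) (auto simp: N.nn_integral_const_prob[simplified])
  have inner: "(\<integral>\<^sup>+x. ennreal (c * k (fst x)) \<partial>(gauss_vec \<tau> p \<Otimes>\<^sub>M gauss_vec 1 n)) = ennreal v * ennreal c" if "0 \<le> c" for c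
  proof -
    have "(\<integral>\<^sup>+x. ennreal (c * k (fst x)) \<partial>(gauss_vec \<tau> p \<Otimes>\<^sub>M gauss_vec 1 n)) =
        (\<integral>\<^sup>+x. ennreal c * ennreal (k (fst x)) \<partial>(gauss_vec \<tau> p \<Otimes>\<^sub>M gauss_vec 1 n))"
      using that k0 by (simp add: ennreal_mult)
    also have "\<dots> = ennreal c * ennreal v"
      by (subst nn_integral_cmult, measurable) (simp add: pair)
    finally show ?thesis by (simp add: mult.commute)
  qed
  have qm: "(\<lambda>t. h (sq_norm t - sq_norm (w *\<^sub>v t))) \<in> borel_measurable (gauss_vec \<tau> d)" if "w \<in> carrier_mat p d" for w
  proof -
    have w: "(\<lambda>x. w) \<in> gauss_vec \<tau> d \<rightarrow>\<^sub>M borel_mat p d" using that by simp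
    have t: "(\<lambda>t. t) \<in> gauss_vec \<tau> d \<rightarrow>\<^sub>M borel_vec d" by simp
    show ?thesis
      by (rule measurable_compose[OF borel_measurable_diff[OF measurable_sq_norm[OF t]
              measurable_sq_norm[OF measurable_mult_mat_vec[OF w t]]] h])
  qed
  have "(\<integral>\<^sup>+\<omega>. ennreal (h (q \<omega>) * k (\<eta> \<omega>)) \<partial>M) =
      (\<integral>\<^sup>+w. \<integral>\<^sup>+t. ennreal v * ennreal (h (sq_norm t - sq_norm (w *\<^sub>v t))) \<partial>gauss_vec \<tau> d \<partial>\<mu>W)"
    using model_law[of "\<lambda>x. ennreal (h (snd (snd x)) * k (fst (snd x)))"]
    by (simp add: inner h0 G.emeasure_space_1[simplified])
  also have "\<dots> = (\<integral>\<^sup>+w. ennreal v * (\<integral>\<^sup>+t. ennreal (h (sq_norm t - sq_norm (w *\<^sub>v t))) \<partial>gauss_vec \<tau> d) \<partial>\<mu>W)"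
    by (rule nn_integral_cong, rule nn_integral_cmult) (use qm in simp)
  also have "\<dots> = ennreal v * (\<integral>\<^sup>+w. \<integral>\<^sup>+t. ennreal (h (sq_norm t - sq_norm (w *\<^sub>v t))) \<partial>gauss_vec \<tau> d \<partial>\<mu>W)"
    by (rule nn_integral_cmult) measurable
  also have "(\<integral>\<^sup>+w. \<integral>\<^sup>+t. ennreal (h (sq_norm t - sq_norm (w *\<^sub>v t))) \<partial>gauss_vec \<tau> d \<partial>\<mu>W) = (\<integral>\<^sup>+\<omega>. ennreal (h (q \<omega>)) \<partial>M)"
    using model_law[of "\<lambda>x. ennreal (h (snd (snd x)))"]
    by (simp add: G.emeasure_space_1[simplified] UN.emeasure_space_1)
  finally show ?thesis .
qed

lemma signal_sq_norm:
  assumes h [measurable]: "h \<in> borel_measurable borel" and h0: "\<And>x. 0 \<le> h x"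
  shows "(\<integral>\<^sup>+\<omega>. ennreal (h (q \<omega>) * sq_norm (\<eta> \<omega>)) \<partial>M) = ennreal (real p * \<tau>\<^sup>2) * (\<integral>\<^sup>+\<omega>. ennreal (h (q \<omega>)) \<partial>M)"
  by (rule signal_moment[OF h h0 borel_measurable_sq_norm sq_norm_nonneg gauss_vec_sq_norm(1,2)[OF \<tau>0]])

text \<open>\<open>q\<close> is a difference of two squared norms of variances
  \<open>2 d \<tau>\<^sup>4\<close> and \<open>2 p \<tau>\<^sup>4\<close>, and the square of a
  difference is at most twice the sum of the squares. For
  \<open>\<tau>\<^sup>2 = \<alpha>\<^sup>2 / d\<close> and \<open>p \<le> d\<close> the bound is of
  order 1 / d.\<close>

lemma q_variance:
  "(\<integral>\<^sup>+\<omega>. ennreal ((q \<omega> - (real d - real p) * \<tau>\<^sup>2)\<^sup>2) \<partial>M) \<le> ennreal (4 * (real d + real p) * \<tau> ^ 4)"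
proof -
  have [measurable]: "(\<lambda>v. (sq_norm v - real m * \<tau>\<^sup>2)\<^sup>2) \<in> borel_measurable (borel_vec m)" for m
    by (intro borel_measurable_power borel_measurable_diff borel_measurable_sq_norm borel_measurable_const)
  have 1: "(\<integral>\<^sup>+\<omega>. ennreal ((sq_norm (\<theta> \<omega>) - real d * \<tau>\<^sup>2)\<^sup>2) \<partial>M) = ennreal (2 * real d * \<tau> ^ 4)"
  proof -
    have "(\<integral>\<^sup>+\<omega>. ennreal ((sq_norm (\<theta> \<omega>) - real d * \<tau>\<^sup>2)\<^sup>2) \<partial>M) = (\<integral>\<^sup>+v. ennreal ((sq_norm v - real d * \<tau>\<^sup>2)\<^sup>2) \<partial>gauss_vec \<tau> d)"
      unfolding \<theta>_law[symmetric] by (rule nn_integral_distr[OF \<theta>_meas, symmetric]) measurable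
    also have "\<dots> = ennreal (2 * real d * \<tau> ^ 4)"
      unfolding gauss_vec_sq_norm(4)[OF \<tau>0, of d, symmetric]
      by (rule nn_integral_eq_integral[OF gauss_vec_sq_norm(3)[OF \<tau>0, of d]]) simp
    finally show ?thesis .
  qed
  \<comment> \<open>The weight 1 in \<open>signal_moment\<close> gives the moments of the projected
    signal.\<close>
  have 2: "(\<integral>\<^sup>+\<omega>. ennreal ((sq_norm (\<eta> \<omega>) - real p * \<tau>\<^sup>2)\<^sup>2) \<partial>M) = ennreal (2 * real p * \<tau> ^ 4)"
  proof -
    have "(\<integral>\<^sup>+\<omega>. ennreal (1 * (sq_norm (\<eta> \<omega>) - real p * \<tau>\<^sup>2)\<^sup>2) \<partial>M) =
        ennreal (2 * real p * \<tau> ^ 4) * (\<integral>\<^sup>+\<omega>. ennreal 1 \<partial>M)"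
      by (rule signal_moment[OF _ _ _ _ gauss_vec_sq_norm(3,4)[OF \<tau>0, of p]]) simp_all
    then show ?thesis by (simp only: mult_1 ennreal_1 nn_integral_const_prob mult_1_right)
  qed
  have "(\<integral>\<^sup>+\<omega>. ennreal ((q \<omega> - (real d - real p) * \<tau>\<^sup>2)\<^sup>2) \<partial>M) \<le>
      (\<integral>\<^sup>+\<omega>. 2 * ennreal ((sq_norm (\<theta> \<omega>) - real d * \<tau>\<^sup>2)\<^sup>2) + 2 * ennreal ((sq_norm (\<eta> \<omega>) - real p * \<tau>\<^sup>2)\<^sup>2) \<partial>M)"
  proof (rule nn_integral_mono)
    fix \<omega>
    let ?a = "sq_norm (\<theta> \<omega>) - real d * \<tau>\<^sup>2" and ?b = "sq_norm (\<eta> \<omega>) - real p * \<tau>\<^sup>2"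
    have "(?a - ?b)\<^sup>2 \<le> 2 * ?a\<^sup>2 + 2 * ?b\<^sup>2"
      by (rule power2_diff_le)
    moreover have "q \<omega> - (real d - real p) * \<tau>\<^sup>2 = ?a - ?b" by (simp add: q_def algebra_simps)
    ultimately have "ennreal ((q \<omega> - (real d - real p) * \<tau>\<^sup>2)\<^sup>2) \<le> ennreal (2 * ?a\<^sup>2 + 2 * ?b\<^sup>2)"
      by (simp only: ennreal_leI)
    also have "\<dots> = 2 * ennreal (?a\<^sup>2) + 2 * ennreal (?b\<^sup>2)"
      by (simp add: ennreal_plus ennreal_mult')
    finally show "ennreal ((q \<omega> - (real d - real p) * \<tau>\<^sup>2)\<^sup>2) \<le> 2 * ennreal (?a\<^sup>2) + 2 * ennreal (?b\<^sup>2)" .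
  qed
  also have "\<dots> = 2 * ennreal (2 * real d * \<tau> ^ 4) + 2 * ennreal (2 * real p * \<tau> ^ 4)"
    unfolding 1[symmetric] 2[symmetric]
    by (subst nn_integral_add, measurable) (subst nn_integral_cmult, measurable, subst nn_integral_cmult, measurable)
  also have "\<dots> = ennreal (2 * (2 * real d * \<tau> ^ 4) + 2 * (2 * real p * \<tau> ^ 4))"
    using \<tau>0 by (simp only: ennreal_two ennreal_plus[symmetric] zero_le_power mult_nonneg_nonneg of_nat_0_le_iff zero_le_numeral)
  also have "2 * (2 * real d * \<tau> ^ 4) + 2 * (2 * real p * \<tau> ^ 4) = 4 * (real d + real p) * \<tau> ^ 4"
    by (simp add: algebra_simps)
  finally show ?thesis .
qed

text \<open>One linear equation for both branches of \<open>center\<close>, so that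
  \<open>ridge_sol_perturb\<close> applies without a case distinction.\<close>

lemma center_equation:
  assumes n: "0 < n" and \<tau>: "0 < \<tau>"
  shows "AE \<omega> in M. gram ((q \<omega> + \<sigma>\<^sup>2) / (real n * \<tau>\<^sup>2)) n p (X \<omega> * (W \<omega>)\<^sup>T) *\<^sub>v C \<omega> =
    (1 / real n) \<cdot>\<^sub>v ((X \<omega> * (W \<omega>)\<^sup>T)\<^sup>T *\<^sub>v Y \<omega>)"
proof -
  have "AE \<omega> in M. \<sigma> = 0 \<longrightarrow> \<E> \<omega> = 0\<^sub>v n"
  proof (cases "\<sigma> = 0")
    case True
    have "AE v in distr M (borel_vec n) \<E>. v = 0\<^sub>v n" unfolding \<E>_law True by (rule AE_gauss_vec_zero)
    from AE_distrD[OF \<E>_meas this] show ?thesis by eventually_elim simp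
  qed simp
  with AE_stiefel AE_space[of M] show ?thesis
  proof eventually_elim
    fix \<omega> assume ww: "W \<omega> * (W \<omega>)\<^sup>T = 1\<^sub>m p" and \<omega>: "\<omega> \<in> space M" and e: "\<sigma> = 0 \<longrightarrow> \<E> \<omega> = 0\<^sub>v n"
    note c = carriers[OF \<omega>]
    let ?Z = "X \<omega> * (W \<omega>)\<^sup>T" and ?\<mu> = "(q \<omega> + \<sigma>\<^sup>2) / (real n * \<tau>\<^sup>2)"
    have q: "q \<omega> = sq_norm (resid (W \<omega>) (\<theta> \<omega>))"
      using sq_norm_resid[OF c(4) ww c(2)] by (simp add: q_def \<eta>_def)
    show "gram ?\<mu> n p ?Z *\<^sub>v C \<omega> = (1 / real n) \<cdot>\<^sub>v (?Z\<^sup>T *\<^sub>v Y \<omega>)"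
    proof (cases "0 < q \<omega> + \<sigma>\<^sup>2")
      case True
      then show ?thesis using n \<tau> c(5,7) gram_ridge_sol[OF c(7) _ c(5), of ?\<mu>]
        by (simp add: C_def center_def D_def)
    next
      case False
      \<comment> \<open>Both \<open>q\<close> and \<open>\<sigma>\<^sup>2\<close> are nonnegative
        here, so both vanish: there is no noise, \<open>\<theta>\<close> lies in the row space of
        \<open>W\<close>, and \<open>Y\<close> is exactly the projected design times
        \<open>\<eta>\<close>. Hence \<open>\<eta>\<close> solves the unpenalised equation.\<close>
      then have s: "\<sigma> = 0" and r: "sq_norm (resid (W \<omega>) (\<theta> \<omega>)) = 0" and q0: "q \<omega> = 0"
        using q sq_norm_nonneg[of "resid (W \<omega>) (\<theta> \<omega>)"] zero_le_power2[of \<sigma>] by (smt (verit) zero_eq_power2)+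
      have rc: "resid (W \<omega>) (\<theta> \<omega>) \<in> carrier_vec d" using c ww by (intro resid_carrier)
      have "resid (W \<omega>) (\<theta> \<omega>) = 0\<^sub>v d" using r sq_norm_eq_0_iff[OF rc] by simp
      then have "\<theta> \<omega> = (W \<omega>)\<^sup>T *\<^sub>v \<eta> \<omega>"
        using resid_decomp[OF c(4) ww c(2)] c by (simp add: \<eta>_def)
      then have y: "Y \<omega> = ?Z *\<^sub>v \<eta> \<omega>"
        using e s c assoc_mult_mat_vec[of "X \<omega>" n d "(W \<omega>)\<^sup>T" p "\<eta> \<omega>"] by (simp add: Y_def)
      have c\<eta>: "C \<omega> = \<eta> \<omega>" using False by (simp add: C_def center_def)
      have \<mu>: "?\<mu> = 0" using s q0 by simp
      have zero: "v + 0 \<cdot>\<^sub>v u = v" if "v \<in> carrier_vec p" "u \<in> carrier_vec p" for u v :: "real vec"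
        using that by (intro eq_vecI) auto
      have "?Z\<^sup>T *\<^sub>v (?Z *\<^sub>v \<eta> \<omega>) \<in> carrier_vec p"
        using c(7) mult_mat_vec_carrier[OF c(7) c(6)] by (intro mult_mat_vec_carrier[of _ p n]) (simp_all only: transpose_carrier_mat)
      then show ?thesis
        unfolding y c\<eta> \<mu> gram_mult[OF c(7) c(6)] by (intro zero smult_carrier_vec[THEN iffD2] c(6))
    qed
  qed
qed

text \<open>The factor \<open>p \<tau>\<^sup>2\<close> is the mean of |\<eta>|^2. In the bracket the
  first term bounds the fluctuation of the Bayesian penalty and the second its bias against
  \<open>l\<close>.\<close>

lemma ridge_center_distance:
  assumes n: "0 < n" and \<tau>: "0 < \<tau>" and l: "0 < l"
  shows "msq (\<lambda>\<omega>. ridge_sol l n p (X \<omega> * (W \<omega>)\<^sup>T) (Y \<omega>) - C \<omega>) \<le>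
    ennreal (real p * \<tau>\<^sup>2 / l\<^sup>2 * (8 * (real d + real p) / (real n)\<^sup>2 + 2 * (((real d - real p) * \<tau>\<^sup>2 + \<sigma>\<^sup>2) / (real n * \<tau>\<^sup>2) - l)\<^sup>2))"
proof -
  \<comment> \<open>\<open>e\<close> is the Bayesian penalty at the mean of \<open>q\<close>, minus
    \<open>l\<close>; \<open>h\<close> is the squared relative error of the penalty as a function of
    \<open>q\<close>, the factor in \<open>ridge_sol_perturb\<close>.\<close>
  define e where "e = ((real d - real p) * \<tau>\<^sup>2 + \<sigma>\<^sup>2) / (real n * \<tau>\<^sup>2) - l"
  define h where "h x = (((x + \<sigma>\<^sup>2) / (real n * \<tau>\<^sup>2) - l) / l)\<^sup>2" for x
  have [measurable]: "h \<in> borel_measurable borel" unfolding h_def by measurable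
  have h0: "0 \<le> h x" for x by (simp add: h_def)
  have "msq (\<lambda>\<omega>. ridge_sol l n p (X \<omega> * (W \<omega>)\<^sup>T) (Y \<omega>) - C \<omega>) \<le>
      (\<integral>\<^sup>+\<omega>. ennreal (h (q \<omega>) * sq_norm (C \<omega>)) \<partial>M)"
    using center_equation[OF n \<tau>] AE_space[of M]
  proof (intro nn_integral_mono_AE, eventually_elim)
    fix \<omega> assume eq: "gram ((q \<omega> + \<sigma>\<^sup>2) / (real n * \<tau>\<^sup>2)) n p (X \<omega> * (W \<omega>)\<^sup>T) *\<^sub>v C \<omega> =
      (1 / real n) \<cdot>\<^sub>v ((X \<omega> * (W \<omega>)\<^sup>T)\<^sup>T *\<^sub>v Y \<omega>)" and \<omega>: "\<omega> \<in> space M"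
    show "ennreal (sq_norm (ridge_sol l n p (X \<omega> * (W \<omega>)\<^sup>T) (Y \<omega>) - C \<omega>)) \<le> ennreal (h (q \<omega>) * sq_norm (C \<omega>))"
      using ridge_sol_perturb[OF carriers(7)[OF \<omega>] l carriers(5)[OF \<omega>] C_carrier[OF \<omega>] eq]
      by (intro ennreal_leI) (simp add: h_def)
  qed
  also have "\<dots> \<le> (\<integral>\<^sup>+\<omega>. ennreal (h (q \<omega>) * sq_norm (\<eta> \<omega>)) \<partial>M)"
    by (rule center_contraction[OF n \<tau> _ h0]) measurable
  also have "\<dots> = ennreal (real p * \<tau>\<^sup>2) * (\<integral>\<^sup>+\<omega>. ennreal (h (q \<omega>)) \<partial>M)"
    by (rule signal_sq_norm[OF _ h0]) measurable
  also have "(\<integral>\<^sup>+\<omega>. ennreal (h (q \<omega>)) \<partial>M) \<le> ennreal (1 / l\<^sup>2 * (8 * (real d + real p) / (real n)\<^sup>2 + 2 * e\<^sup>2))"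
  proof -
    let ?k = "2 / (l\<^sup>2 * (real n * \<tau>\<^sup>2)\<^sup>2)"
    have "(\<integral>\<^sup>+\<omega>. ennreal (h (q \<omega>)) \<partial>M) \<le>
        (\<integral>\<^sup>+\<omega>. ennreal ?k * ennreal ((q \<omega> - (real d - real p) * \<tau>\<^sup>2)\<^sup>2) + ennreal (2 * e\<^sup>2 / l\<^sup>2) \<partial>M)"
    proof (rule nn_integral_mono)
      fix \<omega>
      \<comment> \<open>Fluctuation of the penalty around its mean; together with the bias
        \<open>e\<close> it makes up the whole error.\<close>
      let ?a = "(q \<omega> - (real d - real p) * \<tau>\<^sup>2) / (real n * \<tau>\<^sup>2)"
      have "(q \<omega> + \<sigma>\<^sup>2) / (real n * \<tau>\<^sup>2) - l = ?a + e"
        by (simp add: e_def add_divide_distrib diff_divide_distrib)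
      then have "h (q \<omega>) = (?a + e)\<^sup>2 / l\<^sup>2" by (simp add: h_def power_divide)
      also have "\<dots> \<le> (2 * ?a\<^sup>2 + 2 * e\<^sup>2) / l\<^sup>2"
        by (intro divide_right_mono power2_add_le) simp
      also have "\<dots> = ?k * (q \<omega> - (real d - real p) * \<tau>\<^sup>2)\<^sup>2 + 2 * e\<^sup>2 / l\<^sup>2"
        by (simp add: power_divide add_divide_distrib)
      finally have "ennreal (h (q \<omega>)) \<le> ennreal (?k * (q \<omega> - (real d - real p) * \<tau>\<^sup>2)\<^sup>2 + 2 * e\<^sup>2 / l\<^sup>2)" by (rule ennreal_leI)
      also have "\<dots> = ennreal ?k * ennreal ((q \<omega> - (real d - real p) * \<tau>\<^sup>2)\<^sup>2) + ennreal (2 * e\<^sup>2 / l\<^sup>2)"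
        by (simp only: ennreal_plus ennreal_mult zero_le_power2 zero_le_divide_iff zero_le_mult_iff zero_le_numeral simp_thms)
      finally show "ennreal (h (q \<omega>)) \<le> ennreal ?k * ennreal ((q \<omega> - (real d - real p) * \<tau>\<^sup>2)\<^sup>2) + ennreal (2 * e\<^sup>2 / l\<^sup>2)" .
    qed
    also have "\<dots> = ennreal ?k * (\<integral>\<^sup>+\<omega>. ennreal ((q \<omega> - (real d - real p) * \<tau>\<^sup>2)\<^sup>2) \<partial>M) + ennreal (2 * e\<^sup>2 / l\<^sup>2)"
      by (subst nn_integral_add, measurable) (subst nn_integral_cmult, measurable, simp add: emeasure_space_1)
    also have "\<dots> \<le> ennreal ?k * ennreal (4 * (real d + real p) * \<tau> ^ 4) + ennreal (2 * e\<^sup>2 / l\<^sup>2)"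
      by (intro add_mono mult_left_mono q_variance) simp_all
    also have "\<dots> = ennreal (?k * (4 * (real d + real p) * \<tau> ^ 4) + 2 * e\<^sup>2 / l\<^sup>2)"
      using \<tau>0 by (subst ennreal_plus; (subst ennreal_mult)?) auto
    \<comment> \<open>The powers of \<open>\<tau>\<close> cancel: the variance of \<open>q\<close>
      is of order \<open>\<tau>\<^sup>4\<close>, and the penalty divides \<open>q\<close> by
      \<open>n \<tau>\<^sup>2\<close>. The 8 is 2 times the 4 from
      \<open>q_variance\<close>.\<close>
    also have "?k * (4 * (real d + real p) * \<tau> ^ 4) + 2 * e\<^sup>2 / l\<^sup>2 = 1 / l\<^sup>2 * (8 * (real d + real p) / (real n)\<^sup>2 + 2 * e\<^sup>2)"
    proof -
      have "(real n * \<tau>\<^sup>2)\<^sup>2 = (real n)\<^sup>2 * \<tau> ^ 4" by (simp add: power_mult_distrib flip: power_mult)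
      then have "?k * (4 * (real d + real p) * \<tau> ^ 4) = 1 / l\<^sup>2 * (8 * (real d + real p) / (real n)\<^sup>2)"
        using \<tau> by simp
      then show ?thesis by (simp only: distrib_left) simp
    qed
    finally show ?thesis .
  qed
  then have "ennreal (real p * \<tau>\<^sup>2) * (\<integral>\<^sup>+\<omega>. ennreal (h (q \<omega>)) \<partial>M) \<le>
      ennreal (real p * \<tau>\<^sup>2) * ennreal (1 / l\<^sup>2 * (8 * (real d + real p) / (real n)\<^sup>2 + 2 * e\<^sup>2))"
    by (rule mult_left_mono) simp
  also have "\<dots> = ennreal (real p * \<tau>\<^sup>2 / l\<^sup>2 * (8 * (real d + real p) / (real n)\<^sup>2 + 2 * e\<^sup>2))"
    by (subst ennreal_mult[symmetric]) (auto simp: e_def)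
  finally show ?thesis by (simp only: e_def)
qed

end

section \<open>Posterior risk\<close>

lemma gauss_shifted_second_moment:
  assumes "0 \<le> s"
  shows "integrable (gauss s) (\<lambda>e. (a - e)\<^sup>2)" "(\<integral>e. (a - e)\<^sup>2 \<partial>gauss s) = a\<^sup>2 + s\<^sup>2"
proof -
  interpret prob_space "gauss s" by (rule prob_space_gauss[OF assms])
  have i: "integrable (gauss s) (\<lambda>e. e)" "integrable (gauss s) (\<lambda>e. e\<^sup>2)"
    using gauss_moments(1)[OF assms, of 1] gauss_moments(1)[OF assms, of 2] by simp_all
  have eq: "(a - e)\<^sup>2 = a\<^sup>2 - 2 * a * e + e\<^sup>2" for e by (simp add: power2_diff)
  show "integrable (gauss s) (\<lambda>e. (a - e)\<^sup>2)" unfolding eq using i by simp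
  show "(\<integral>e. (a - e)\<^sup>2 \<partial>gauss s) = a\<^sup>2 + s\<^sup>2"
    unfolding eq using i gauss_moments(2,3)[OF assms] by (simp add: prob_space[simplified])
qed

text \<open>The prediction error is linear in the test data with coefficient vector
  \<open>w\<^sup>T b - t\<close>. Isotropy of \<open>x\<close> turns its second moment into a
  squared norm, and orthonormal rows give \<open>w\<^sup>T b\<close> the norm of
  \<open>b\<close>.\<close>

lemma test_risk_eq:
  assumes \<sigma>: "0 \<le> \<sigma>" and w: "w \<in> carrier_mat p d" and ww: "w * w\<^sup>T = 1\<^sub>m p"
    and t: "t \<in> carrier_vec d" and b: "b \<in> carrier_vec p"
  shows "test_risk \<sigma> d w t b = sq_norm b - 2 * (b \<bullet> (w *\<^sub>v t)) + sq_norm t + \<sigma>\<^sup>2"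
proof -
  interpret V: prob_space "gauss_vec 1 d" by (rule prob_space_gauss_vec) simp
  interpret N: prob_space "gauss \<sigma>" by (rule prob_space_gauss[OF \<sigma>])
  interpret VN: pair_sigma_finite "gauss_vec 1 d" "gauss \<sigma>" ..
  define c where "c = w\<^sup>T *\<^sub>v b - t"
  have c: "c \<in> carrier_vec d" using w t b by (simp add: c_def)
  have cm: "(\<lambda>x. c) \<in> M \<rightarrow>\<^sub>M borel_vec d" for M :: "'a measure" using c by simp
  have lin: "(w *\<^sub>v x) \<bullet> b - (x \<bullet> t + e) = c \<bullet> x - e" if x: "x \<in> carrier_vec d" for x e
  proof -
    have "(w *\<^sub>v x) \<bullet> b = (w\<^sup>T *\<^sub>v b) \<bullet> x"
      using stiefel_adjoint[OF w ww b x] comm_scalar_prod[of "w *\<^sub>v x" p b] w x b by simp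
    then show ?thesis
      using w x b t comm_scalar_prod[OF x t] by (simp add: c_def minus_scalar_prod_distrib[of _ d])
  qed
  have meas: "(\<lambda>x. (c \<bullet> fst x - snd x)\<^sup>2) \<in> borel_measurable (gauss_vec 1 d \<Otimes>\<^sub>M gauss \<sigma>)"
    by (intro borel_measurable_power borel_measurable_diff measurable_scalar_prod[OF cm]) auto
  have ic: "integrable (gauss_vec 1 d) (\<lambda>x. (c \<bullet> x)\<^sup>2 + \<sigma>\<^sup>2)"
    using gauss_vec_linear(3)[OF _ c, of 1] by simp
  have int: "integrable (gauss_vec 1 d \<Otimes>\<^sub>M gauss \<sigma>) (\<lambda>x. (c \<bullet> fst x - snd x)\<^sup>2)"
  proof (rule VN.Fubini_integrable[OF meas])
    show "integrable (gauss_vec 1 d) (\<lambda>x. \<integral>y. norm ((c \<bullet> fst (x, y) - snd (x, y))\<^sup>2) \<partial>gauss \<sigma>)"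
      using ic by (simp add: gauss_shifted_second_moment[OF \<sigma>])
    show "AE x in gauss_vec 1 d. integrable (gauss \<sigma>) (\<lambda>y. (c \<bullet> fst (x, y) - snd (x, y))\<^sup>2)"
      by (simp add: gauss_shifted_second_moment[OF \<sigma>])
  qed
  have "test_risk \<sigma> d w t b = (\<integral>x. (c \<bullet> fst x - snd x)\<^sup>2 \<partial>(gauss_vec 1 d \<Otimes>\<^sub>M gauss \<sigma>))"
    unfolding test_risk_def by (intro Bochner_Integration.integral_cong) (auto simp: space_pair_measure lin)
  also have "\<dots> = (\<integral>x. (c \<bullet> x)\<^sup>2 + \<sigma>\<^sup>2 \<partial>gauss_vec 1 d)"
    using VN.integral_fst'[OF int] by (simp add: gauss_shifted_second_moment[OF \<sigma>])
  also have "\<dots> = sq_norm c + \<sigma>\<^sup>2"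
    using gauss_vec_linear(3,4)[OF _ c, of 1] by (simp add: V.prob_space[simplified])
  also have "sq_norm c = sq_norm b - 2 * (b \<bullet> (w *\<^sub>v t)) + sq_norm t"
    using w b t by (simp add: c_def sq_norm_minus[of _ d] stiefel_sq_norm[OF w ww b] stiefel_adjoint[OF w ww b])
  finally show ?thesis by simp
qed

section \<open>Quadratic risk under a law with finite second moment\<close>

context
  fixes Q :: "real vec measure" and w :: "real mat" and p d :: nat
  assumes Q: "prob_space Q" and sets_Q: "sets Q = sets (borel_vec d)" and Q2: "integrable Q sq_norm"
    and w: "w \<in> carrier_mat p d" and ww: "w * w\<^sup>T = 1\<^sub>m p"
begin

interpretation Q: prob_space Q by (rule Q)

lemma space_Q: "space Q = carrier_vec d"
  using sets_eq_imp_space_eq[OF sets_Q] by simp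

lemma ident_Q: "(\<lambda>t. t) \<in> Q \<rightarrow>\<^sub>M borel_vec d"
  by (rule measurable_ident_sets[OF sets_Q])

lemma posterior_mean_carrier [simp]: "posterior_mean d Q \<in> carrier_vec d"
  by (simp add: posterior_mean_def)

lemma integrable_entry:
  assumes "i < d"
  shows "integrable Q (\<lambda>t. t $ i)"
proof (rule Bochner_Integration.integrable_bound)
  show "integrable Q (\<lambda>t. 1 + sq_norm t)" using Q2 by simp
  show "(\<lambda>t. t $ i) \<in> borel_measurable Q" by (rule measurable_vec_entry[OF ident_Q assms])
  show "AE t in Q. norm (t $ i) \<le> norm (1 + sq_norm t)"
  proof (rule AE_I2)
    fix t assume "t \<in> space Q"
    then have "(t $ i)\<^sup>2 \<le> sq_norm t"
      using assms by (auto simp: space_Q sq_norm_sum intro!: member_le_sum)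
    moreover have "2 * \<bar>t $ i\<bar> \<le> 1 + (t $ i)\<^sup>2"
      using zero_le_power2[of "\<bar>t $ i\<bar> - 1"] unfolding power2_diff by simp
    ultimately show "norm (t $ i) \<le> norm (1 + sq_norm t)" using sq_norm_nonneg[of t] by simp
  qed
qed

lemma integral_scalar_prod:
  assumes c: "c \<in> carrier_vec d"
  shows "integrable Q (\<lambda>t. c \<bullet> t)" "(\<integral>t. c \<bullet> t \<partial>Q) = c \<bullet> posterior_mean d Q"
proof -
  have eq: "c \<bullet> t = (\<Sum>i<d. c $ i * t $ i)" if "t \<in> space Q" for t
    using that by (auto simp: space_Q scalar_prod_def atLeast0LessThan)
  have "integrable Q (\<lambda>t. \<Sum>i<d. c $ i * t $ i)" using integrable_entry by auto
  then show "integrable Q (\<lambda>t. c \<bullet> t)" by (simp add: eq cong: Bochner_Integration.integrable_cong)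
  have "(\<integral>t. c \<bullet> t \<partial>Q) = (\<integral>t. (\<Sum>i<d. c $ i * t $ i) \<partial>Q)"
    by (intro Bochner_Integration.integral_cong eq refl)
  also have "\<dots> = (\<Sum>i<d. c $ i * (\<integral>t. t $ i \<partial>Q))"
    using integrable_entry by (subst Bochner_Integration.integral_sum) auto
  finally show "(\<integral>t. c \<bullet> t \<partial>Q) = c \<bullet> posterior_mean d Q"
    by (simp add: posterior_mean_def scalar_prod_def atLeast0LessThan)
qed

lemma integral_projection:
  assumes b: "b \<in> carrier_vec p"
  shows "integrable Q (\<lambda>t. b \<bullet> (w *\<^sub>v t))" "(\<integral>t. b \<bullet> (w *\<^sub>v t) \<partial>Q) = b \<bullet> (w *\<^sub>v posterior_mean d Q)"
proof -
  have wb: "w\<^sup>T *\<^sub>v b \<in> carrier_vec d" using w b by simp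
  have eq: "b \<bullet> (w *\<^sub>v t) = (w\<^sup>T *\<^sub>v b) \<bullet> t" if "t \<in> carrier_vec d" for t
    using stiefel_adjoint[OF w ww b that] by simp
  show "integrable Q (\<lambda>t. b \<bullet> (w *\<^sub>v t))"
    using integral_scalar_prod(1)[OF wb]
    by (rule Bochner_Integration.integrable_cong[THEN iffD1, rotated 2]) (simp_all add: eq space_Q)
  have "(\<integral>t. b \<bullet> (w *\<^sub>v t) \<partial>Q) = (\<integral>t. (w\<^sup>T *\<^sub>v b) \<bullet> t \<partial>Q)"
    by (intro Bochner_Integration.integral_cong) (simp_all add: eq space_Q)
  then show "(\<integral>t. b \<bullet> (w *\<^sub>v t) \<partial>Q) = b \<bullet> (w *\<^sub>v posterior_mean d Q)"
    by (simp add: integral_scalar_prod(2)[OF wb] eq)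
qed

text \<open>Completing the square: the excess risk at \<open>b\<close> is exactly its squared
  distance from the projected posterior mean. The unique minimiser and the limit of the excess risk
  both come from this.\<close>

lemma posterior_risk_eq:
  assumes \<sigma>: "0 \<le> \<sigma>" and b: "b \<in> carrier_vec p"
  shows "posterior_risk \<sigma> d w Q b = sq_norm (b - w *\<^sub>v posterior_mean d Q) +
    ((\<integral>t. sq_norm t \<partial>Q) + \<sigma>\<^sup>2 - sq_norm (w *\<^sub>v posterior_mean d Q))"
proof -
  have "posterior_risk \<sigma> d w Q b = (\<integral>t. sq_norm b - 2 * (b \<bullet> (w *\<^sub>v t)) + sq_norm t + \<sigma>\<^sup>2 \<partial>Q)"
    unfolding posterior_risk_def
    by (intro Bochner_Integration.integral_cong) (simp_all add: test_risk_eq[OF \<sigma> w ww _ b] space_Q)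
  also have "\<dots> = sq_norm b - 2 * (b \<bullet> (w *\<^sub>v posterior_mean d Q)) + (\<integral>t. sq_norm t \<partial>Q) + \<sigma>\<^sup>2"
    using integral_projection[OF b] Q2 by (simp add: Q.prob_space)
  finally show ?thesis using b w by (simp add: sq_norm_minus[of _ p])
qed

lemma posterior_risk_arg_min:
  assumes \<sigma>: "0 \<le> \<sigma>"
  shows "is_arg_min (posterior_risk \<sigma> d w Q) (\<lambda>b. b \<in> carrier_vec p) b \<longleftrightarrow> b = w *\<^sub>v posterior_mean d Q"
proof -
  let ?m = "w *\<^sub>v posterior_mean d Q"
  have m: "?m \<in> carrier_vec p" using w by simp
  have zero: "sq_norm (?m - ?m) = 0" using m by (simp add: sq_norm_eq_0_iff[of _ p])
  have pos: "b = ?m" if "b \<in> carrier_vec p" "sq_norm (b - ?m) \<le> 0" for b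
  proof -
    have "sq_norm (b - ?m) = 0" using that(2) sq_norm_nonneg[of "b - ?m"] by linarith
    then have "b - ?m = 0\<^sub>v p" using that(1) m sq_norm_eq_0_iff[of "b - ?m" p] by simp
    then have "(b - ?m) $ i = 0" if "i < p" for i using that by simp
    then show ?thesis using that(1) m w by (intro eq_vecI) auto
  qed
  show ?thesis
    unfolding is_arg_min_def
    using m pos[of b] zero sq_norm_nonneg
    by (auto simp: posterior_risk_eq[OF \<sigma>] not_less)
qed

text \<open>\<open>arg_min\<close> is a choice operator; its value is known only because the
  minimiser is unique.\<close>

lemma beta_opt_eq:
  assumes "0 \<le> \<sigma>"
  shows "beta_opt \<sigma> d p w Q = w *\<^sub>v posterior_mean d Q"
proof -
  have "is_arg_min (posterior_risk \<sigma> d w Q) (\<lambda>b. b \<in> carrier_vec p) = (\<lambda>b. b = w *\<^sub>v posterior_mean d Q)"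
    by (intro ext posterior_risk_arg_min assms)
  then show ?thesis by (simp add: beta_opt_def arg_min_def)
qed

text \<open>The decomposition into squared bias and variance under \<open>Q\<close>. The form with
  nonnegative integrals is the one that is then integrated over the data.\<close>

lemma posterior_pythagoras:
  assumes b: "b \<in> carrier_vec p"
  shows "(\<integral>\<^sup>+t. ennreal (sq_norm (b - w *\<^sub>v t)) \<partial>Q) =
    ennreal (sq_norm (b - w *\<^sub>v posterior_mean d Q)) + (\<integral>\<^sup>+t. ennreal (sq_norm (w *\<^sub>v posterior_mean d Q - w *\<^sub>v t)) \<partial>Q)"
proof -
  let ?m = "w *\<^sub>v posterior_mean d Q"
  have m: "?m \<in> carrier_vec p" using w by simp
  have wm: "(\<lambda>t. w) \<in> Q \<rightarrow>\<^sub>M borel_mat p d" using w by simp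
  have int_w: "integrable Q (\<lambda>t. sq_norm (w *\<^sub>v t))"
  proof (rule Bochner_Integration.integrable_bound[OF Q2])
    show "(\<lambda>t. sq_norm (w *\<^sub>v t)) \<in> borel_measurable Q"
      by (rule measurable_sq_norm[OF measurable_mult_mat_vec[OF wm ident_Q]])
    show "AE t in Q. norm (sq_norm (w *\<^sub>v t)) \<le> norm (sq_norm t)"
    proof (rule AE_I2)
      fix t assume "t \<in> space Q"
      then show "norm (sq_norm (w *\<^sub>v t)) \<le> norm (sq_norm t)"
        using sq_norm_resid[OF w ww, of t] sq_norm_nonneg[of "resid w t"] by (simp add: space_Q)
    qed
  qed
  have eq: "sq_norm (c - w *\<^sub>v t) = sq_norm c - 2 * (c \<bullet> (w *\<^sub>v t)) + sq_norm (w *\<^sub>v t)"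
    if "c \<in> carrier_vec p" "t \<in> carrier_vec d" for c t
    using that w by (simp add: sq_norm_minus[of _ p])
  have int: "integrable Q (\<lambda>t. sq_norm (c - w *\<^sub>v t))"
    and val: "(\<integral>t. sq_norm (c - w *\<^sub>v t) \<partial>Q) = sq_norm c - 2 * (c \<bullet> ?m) + (\<integral>t. sq_norm (w *\<^sub>v t) \<partial>Q)"
    if c: "c \<in> carrier_vec p" for c
  proof -
    have "integrable Q (\<lambda>t. sq_norm c - 2 * (c \<bullet> (w *\<^sub>v t)) + sq_norm (w *\<^sub>v t))"
      using integral_projection[OF c] int_w by simp
    then show "integrable Q (\<lambda>t. sq_norm (c - w *\<^sub>v t))"
      by (rule Bochner_Integration.integrable_cong[THEN iffD1, rotated 2]) (simp_all add: eq[OF c] space_Q)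
    have "(\<integral>t. sq_norm (c - w *\<^sub>v t) \<partial>Q) = (\<integral>t. sq_norm c - 2 * (c \<bullet> (w *\<^sub>v t)) + sq_norm (w *\<^sub>v t) \<partial>Q)"
      by (intro Bochner_Integration.integral_cong) (simp_all add: eq[OF c] space_Q)
    then show "(\<integral>t. sq_norm (c - w *\<^sub>v t) \<partial>Q) = sq_norm c - 2 * (c \<bullet> ?m) + (\<integral>t. sq_norm (w *\<^sub>v t) \<partial>Q)"
      using integral_projection[OF c] int_w by (simp add: Q.prob_space)
  qed
  have nn: "(\<integral>\<^sup>+t. ennreal (sq_norm (c - w *\<^sub>v t)) \<partial>Q) = ennreal (\<integral>t. sq_norm (c - w *\<^sub>v t) \<partial>Q)" if "c \<in> carrier_vec p" for c
    by (rule nn_integral_eq_integral[OF int[OF that]]) simp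
  have "(\<integral>t. sq_norm (b - w *\<^sub>v t) \<partial>Q) = sq_norm (b - ?m) + (\<integral>t. sq_norm (?m - w *\<^sub>v t) \<partial>Q)"
    unfolding val[OF b] val[OF m] using b m by (simp add: sq_norm_minus[of _ p]) (simp add: sq_norm_def)
  then show ?thesis
    unfolding nn[OF b] nn[OF m] by (simp add: ennreal_plus integral_nonneg)
qed

end

text \<open>\<open>posterior_dist\<close> prescribes the joint law on rectangles only. These are
  stable under intersection and generate the product sigma-algebra, so the whole joint law is
  determined.\<close>

lemma posterior_disintegration:
  assumes M: "prob_space M" and Z [measurable]: "Z \<in> M \<rightarrow>\<^sub>M S" and T [measurable]: "T \<in> M \<rightarrow>\<^sub>M N"
    and post: "posterior_dist M S Z N T \<kappa>"
    and F [measurable]: "F \<in> borel_measurable (S \<Otimes>\<^sub>M N)"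
  shows "(\<integral>\<^sup>+\<omega>. F (Z \<omega>, T \<omega>) \<partial>M) = (\<integral>\<^sup>+\<omega>. \<integral>\<^sup>+t. F (Z \<omega>, t) \<partial>\<kappa> (Z \<omega>) \<partial>M)"
proof -
  interpret M: prob_space M by (rule M)
  have \<kappa>p: "\<kappa> \<in> S \<rightarrow>\<^sub>M prob_algebra N" using post by (simp add: posterior_dist_def)
  have \<kappa> [measurable]: "\<kappa> \<in> S \<rightarrow>\<^sub>M subprob_algebra N" by (rule measurable_prob_algebraD[OF \<kappa>p])
  have \<kappa>_sets: "sets (\<kappa> z) = sets N" if "z \<in> space S" for z
    using measurable_space[OF \<kappa> that] by (simp add: space_subprob_algebra)
  \<comment> \<open>The posterior with its data point attached; the joint law is the monadic bind of
    the data law with this kernel.\<close>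
  define k where "k z = distr (\<kappa> z) (S \<Otimes>\<^sub>M N) (\<lambda>t. (z, t))" for z
  have k [measurable]: "k \<in> S \<rightarrow>\<^sub>M subprob_algebra (S \<Otimes>\<^sub>M N)"
    unfolding k_def using measurable_distr2[of "\<lambda>z t. (z, t)" S N "S \<Otimes>\<^sub>M N" \<kappa>] by simp
  let ?P = "distr M S Z"
  interpret P: prob_space ?P by (rule M.prob_space_distr[OF Z])
  have Pair: "(\<lambda>t. (z, t)) \<in> \<kappa> z \<rightarrow>\<^sub>M S \<Otimes>\<^sub>M N" if "z \<in> space S" for z
    using that by (simp add: measurable_cong_sets[OF \<kappa>_sets[OF that] refl])
  have kP: "k \<in> ?P \<rightarrow>\<^sub>M subprob_algebra (S \<Otimes>\<^sub>M N)" by simp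
  have ne: "space ?P \<noteq> {}" by (rule P.not_empty)
  have eq: "distr M (S \<Otimes>\<^sub>M N) (\<lambda>\<omega>. (Z \<omega>, T \<omega>)) = ?P \<bind> k"
  proof (rule measure_eqI_generator_eq[where E = "{a \<times> b |a b. a \<in> sets S \<and> b \<in> sets N}" and \<Omega> = "space S \<times> space N"
        and A = "\<lambda>_. space S \<times> space N"])
    show "Int_stable {a \<times> b |a b. a \<in> sets S \<and> b \<in> sets N}" by (rule Int_stable_pair_measure_generator)
    show "{a \<times> b |a b. a \<in> sets S \<and> b \<in> sets N} \<subseteq> Pow (space S \<times> space N)" by (rule pair_measure_closed)
    show "sets (distr M (S \<Otimes>\<^sub>M N) (\<lambda>\<omega>. (Z \<omega>, T \<omega>))) = sigma_sets (space S \<times> space N) {a \<times> b |a b. a \<in> sets S \<and> b \<in> sets N}"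
      by (simp add: sets_pair_measure)
    show "sets (?P \<bind> k) = sigma_sets (space S \<times> space N) {a \<times> b |a b. a \<in> sets S \<and> b \<in> sets N}"
      using sets_bind[OF sets_kernel[OF kP] ne] by (simp add: sets_pair_measure)
    show "range (\<lambda>_::nat. space S \<times> space N) \<subseteq> {a \<times> b |a b. a \<in> sets S \<and> b \<in> sets N}" by auto
    show "(\<Union>i::nat. space S \<times> space N) = space S \<times> space N" by simp
    show "emeasure (distr M (S \<Otimes>\<^sub>M N) (\<lambda>\<omega>. (Z \<omega>, T \<omega>))) (space S \<times> space N) \<noteq> \<infinity>" for i :: nat
      by (subst emeasure_distr) (auto simp: M.emeasure_eq_measure)
    fix U assume "U \<in> {a \<times> b |a b. a \<in> sets S \<and> b \<in> sets N}"
    then obtain a b where U: "U = a \<times> b" and a [measurable]: "a \<in> sets S" and b [measurable]: "b \<in> sets N" by auto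
    have "emeasure (distr M (S \<Otimes>\<^sub>M N) (\<lambda>\<omega>. (Z \<omega>, T \<omega>))) U = emeasure M {\<omega> \<in> space M. Z \<omega> \<in> a \<and> T \<omega> \<in> b}"
      unfolding U by (subst emeasure_distr) (auto intro!: arg_cong[where f = "emeasure M"])
    also have "\<dots> = (\<integral>\<^sup>+z\<in>a. emeasure (\<kappa> z) b \<partial>?P)" using post by (simp add: posterior_dist_def)
    also have "\<dots> = (\<integral>\<^sup>+z. emeasure (k z) U \<partial>?P)"
    proof (intro nn_integral_cong)
      fix z assume "z \<in> space ?P"
      then have z: "z \<in> space S" by simp
      have "emeasure (k z) U = emeasure (\<kappa> z) ((\<lambda>t. (z, t)) -` U \<inter> space (\<kappa> z))"
        unfolding k_def U by (rule emeasure_distr[OF Pair[OF z]]) simp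
      also have "(\<lambda>t. (z, t)) -` U \<inter> space (\<kappa> z) = (if z \<in> a then b else {})"
        using sets.sets_into_space[OF b] sets_eq_imp_space_eq[OF \<kappa>_sets[OF z]] by (auto simp: U)
      finally show "emeasure (\<kappa> z) b * indicator a z = emeasure (k z) U" by simp
    qed
    also have "\<dots> = emeasure (?P \<bind> k) U"
      by (rule emeasure_bind[OF ne kP, symmetric]) (simp add: U)
    finally show "emeasure (distr M (S \<Otimes>\<^sub>M N) (\<lambda>\<omega>. (Z \<omega>, T \<omega>))) U = emeasure (?P \<bind> k) U" .
  qed
  have "(\<integral>\<^sup>+\<omega>. F (Z \<omega>, T \<omega>) \<partial>M) = integral\<^sup>N (distr M (S \<Otimes>\<^sub>M N) (\<lambda>\<omega>. (Z \<omega>, T \<omega>))) F"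
    by (rule nn_integral_distr[symmetric]) measurable
  also have "\<dots> = (\<integral>\<^sup>+z. \<integral>\<^sup>+y. F y \<partial>k z \<partial>?P)"
    unfolding eq by (rule nn_integral_bind[OF F kP])
  also have "\<dots> = (\<integral>\<^sup>+\<omega>. \<integral>\<^sup>+y. F y \<partial>k (Z \<omega>) \<partial>M)"
    using measurable_compose[OF k nn_integral_measurable_subprob_algebra[OF F]]
    by (intro nn_integral_distr[OF Z]) simp
  also have "\<dots> = (\<integral>\<^sup>+\<omega>. \<integral>\<^sup>+t. F (Z \<omega>, t) \<partial>\<kappa> (Z \<omega>) \<partial>M)"
  proof (rule nn_integral_cong)
    fix \<omega> assume "\<omega> \<in> space M"
    from Pair[OF measurable_space[OF Z this]]
    show "(\<integral>\<^sup>+y. F y \<partial>k (Z \<omega>)) = (\<integral>\<^sup>+t. F (Z \<omega>, t) \<partial>\<kappa> (Z \<omega>))"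
      unfolding k_def by (rule nn_integral_distr) (simp add: F)
  qed
  finally show ?thesis .
qed

section \<open>Asymptotics\<close>

locale ridge_posterior = ridge_model +
  fixes \<kappa> :: "real mat \<times> real mat \<times> real vec \<Rightarrow> real vec measure"
  assumes posterior: "posterior_dist M (data_space n p d) D (borel_vec d) \<theta> \<kappa>"
begin

abbreviation "data \<equiv> data_space n p d"

lemma measurable_\<kappa>: "\<kappa> \<in> data \<rightarrow>\<^sub>M subprob_algebra (borel_vec d)"
  using posterior by (intro measurable_prob_algebraD) (simp add: posterior_dist_def)

lemma \<kappa>_prob:
  assumes "\<omega> \<in> space M"
  shows "prob_space (\<kappa> (D \<omega>))" "sets (\<kappa> (D \<omega>)) = sets (borel_vec d)"
proof -
  have "\<kappa> \<in> data \<rightarrow>\<^sub>M prob_algebra (borel_vec d)" using posterior by (simp add: posterior_dist_def)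
  from measurable_space[OF this measurable_space[OF measurable_D assms]]
  show "prob_space (\<kappa> (D \<omega>))" "sets (\<kappa> (D \<omega>)) = sets (borel_vec d)"
    by (auto simp: space_prob_algebra)
qed

lemmas disintegration = posterior_disintegration[OF prob_space_axioms measurable_D \<theta>_meas posterior]

lemma measurable_posterior_integral:
  "F \<in> borel_measurable (data \<Otimes>\<^sub>M borel_vec d) \<Longrightarrow> (\<lambda>\<omega>. \<integral>\<^sup>+t. F (D \<omega>, t) \<partial>\<kappa> (D \<omega>)) \<in> borel_measurable M"
proof -
  assume F: "F \<in> borel_measurable (data \<Otimes>\<^sub>M borel_vec d)"
  have "(\<lambda>z. \<integral>\<^sup>+t. F (z, t) \<partial>\<kappa> z) \<in> borel_measurable data"
    by (rule nn_integral_measurable_subprob_algebra2[OF _ measurable_\<kappa>]) (use F in simp)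
  from measurable_compose[OF measurable_D this] show ?thesis .
qed

text \<open>The second moment of the posterior averages to the finite prior value
  \<open>d \<tau>\<^sup>2\<close>, hence is finite for almost all data. The other conjuncts complete
  the hypotheses of the risk computations.\<close>

lemma AE_posterior:
  "AE \<omega> in M. \<omega> \<in> space M \<and> W \<omega> * (W \<omega>)\<^sup>T = 1\<^sub>m p \<and> prob_space (\<kappa> (D \<omega>)) \<and>
    sets (\<kappa> (D \<omega>)) = sets (borel_vec d) \<and> integrable (\<kappa> (D \<omega>)) sq_norm"
proof -
  have meas: "(\<lambda>x. ennreal (sq_norm (snd x))) \<in> borel_measurable (data \<Otimes>\<^sub>M borel_vec d)"
    by (intro measurable_compose[OF _ measurable_ennreal] measurable_sq_norm[OF measurable_snd])
  have "msq (\<lambda>\<omega>. \<theta> \<omega>) = (\<integral>\<^sup>+v. ennreal (sq_norm v) \<partial>gauss_vec \<tau> d)"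
    unfolding \<theta>_law[symmetric]
    by (rule nn_integral_distr[OF \<theta>_meas, symmetric])
      (use borel_measurable_sq_norm[of d] in simp)
  also have "\<dots> = ennreal (real d * \<tau>\<^sup>2)"
    unfolding gauss_vec_sq_norm(2)[OF \<tau>0, symmetric]
    by (rule nn_integral_eq_integral[OF gauss_vec_sq_norm(1)[OF \<tau>0]]) simp
  finally have "(\<integral>\<^sup>+\<omega>. \<integral>\<^sup>+t. ennreal (sq_norm t) \<partial>\<kappa> (D \<omega>) \<partial>M) = ennreal (real d * \<tau>\<^sup>2)"
    using disintegration[OF meas] by simp
  then have "AE \<omega> in M. (\<integral>\<^sup>+t. ennreal (sq_norm t) \<partial>\<kappa> (D \<omega>)) \<noteq> \<infinity>"
    using measurable_posterior_integral[OF meas] by (intro nn_integral_PInf_AE) auto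
  with AE_stiefel AE_space[of M] show ?thesis
  proof eventually_elim
    fix \<omega> assume ww: "W \<omega> * (W \<omega>)\<^sup>T = 1\<^sub>m p" and \<omega>: "\<omega> \<in> space M"
      and fin: "(\<integral>\<^sup>+t. ennreal (sq_norm t) \<partial>\<kappa> (D \<omega>)) \<noteq> \<infinity>"
    have "sq_norm \<in> borel_measurable (\<kappa> (D \<omega>))"
      using borel_measurable_sq_norm[of d] by (simp add: measurable_cong_sets[OF \<kappa>_prob(2)[OF \<omega>] refl])
    then have "integrable (\<kappa> (D \<omega>)) sq_norm"
      using fin by (intro integrableI_nonneg) (auto simp: top.not_eq_extremum)
    then show "\<omega> \<in> space M \<and> W \<omega> * (W \<omega>)\<^sup>T = 1\<^sub>m p \<and> prob_space (\<kappa> (D \<omega>)) \<and>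
      sets (\<kappa> (D \<omega>)) = sets (borel_vec d) \<and> integrable (\<kappa> (D \<omega>)) sq_norm"
      using ww \<omega> \<kappa>_prob[OF \<omega>] by simp
  qed
qed

text \<open>\<open>W\<close> is read from the data triple, so that \<open>bayes\<close> is a
  function of the data alone and qualifies as \<open>g\<close> in
  \<open>center_pythagoras\<close>.\<close>

definition bayes :: "real mat \<times> real mat \<times> real vec \<Rightarrow> real vec" where
  "bayes z = fst (snd z) *\<^sub>v posterior_mean d (\<kappa> z)"

lemma bayes_D: "bayes (D \<omega>) = W \<omega> *\<^sub>v posterior_mean d (\<kappa> (D \<omega>))"
  by (simp add: bayes_def D_def)

lemma measurable_bayes: "bayes \<in> data \<rightarrow>\<^sub>M borel_vec p"
proof -
  have "(\<lambda>z. posterior_mean d (\<kappa> z)) \<in> data \<rightarrow>\<^sub>M borel_vec d"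
  proof (rule measurable_borel_vecI)
    fix i assume i: "i < d"
    have "(\<lambda>t. t $ i) \<in> borel_measurable (borel_vec d)"
      by (rule measurable_vec_entry[OF measurable_ident_sets[OF refl] i])
    from measurable_compose[OF measurable_\<kappa> integral_measurable_subprob_algebra[OF this]] i
    show "(\<lambda>z. posterior_mean d (\<kappa> z) $ i) \<in> borel_measurable data"
      by (simp add: posterior_mean_def)
  qed (simp add: posterior_mean_def)
  then show ?thesis
    unfolding bayes_def
    by (intro measurable_mult_mat_vec[where k = d] measurable_compose[OF measurable_snd measurable_fst])
qed

text \<open>\<open>posterior_pythagoras\<close> at each data point, integrated; the disintegration
  turns the inner posterior integrals back into errors against \<open>\<eta>\<close>.\<close>

lemma bayes_pythagoras:
  assumes g: "g \<in> data \<rightarrow>\<^sub>M borel_vec p"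
  shows "msq (\<lambda>\<omega>. g (D \<omega>) - \<eta> \<omega>) =
    msq (\<lambda>\<omega>. g (D \<omega>) - bayes (D \<omega>)) + msq (\<lambda>\<omega>. bayes (D \<omega>) - \<eta> \<omega>)"
proof -
  have meas: "(\<lambda>x. ennreal (sq_norm (h (fst x) - fst (snd (fst x)) *\<^sub>v snd x))) \<in> borel_measurable (data \<Otimes>\<^sub>M borel_vec d)"
    if [measurable]: "h \<in> data \<rightarrow>\<^sub>M borel_vec p" for h
    by measurable
  have dis: "msq (\<lambda>\<omega>. h (D \<omega>) - \<eta> \<omega>) =
      (\<integral>\<^sup>+\<omega>. \<integral>\<^sup>+t. ennreal (sq_norm (h (D \<omega>) - W \<omega> *\<^sub>v t)) \<partial>\<kappa> (D \<omega>) \<partial>M)"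
    if "h \<in> data \<rightarrow>\<^sub>M borel_vec p" for h
    using disintegration[OF meas[OF that]] by (simp add: \<eta>_def D_def)
  have "msq (\<lambda>\<omega>. g (D \<omega>) - \<eta> \<omega>) =
      (\<integral>\<^sup>+\<omega>. \<integral>\<^sup>+t. ennreal (sq_norm (g (D \<omega>) - W \<omega> *\<^sub>v t)) \<partial>\<kappa> (D \<omega>) \<partial>M)"
    by (rule dis[OF g])
  also have "\<dots> = (\<integral>\<^sup>+\<omega>. ennreal (sq_norm (g (D \<omega>) - bayes (D \<omega>))) +
      (\<integral>\<^sup>+t. ennreal (sq_norm (bayes (D \<omega>) - W \<omega> *\<^sub>v t)) \<partial>\<kappa> (D \<omega>)) \<partial>M)"
    using AE_posterior
  proof (intro nn_integral_cong_AE, eventually_elim)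
    fix \<omega> assume *: "\<omega> \<in> space M \<and> W \<omega> * (W \<omega>)\<^sup>T = 1\<^sub>m p \<and> prob_space (\<kappa> (D \<omega>)) \<and>
      sets (\<kappa> (D \<omega>)) = sets (borel_vec d) \<and> integrable (\<kappa> (D \<omega>)) sq_norm"
    then have "g (D \<omega>) \<in> carrier_vec p"
      using measurable_space[OF g measurable_space[OF measurable_D]] by simp
    with * show "(\<integral>\<^sup>+t. ennreal (sq_norm (g (D \<omega>) - W \<omega> *\<^sub>v t)) \<partial>\<kappa> (D \<omega>)) =
        ennreal (sq_norm (g (D \<omega>) - bayes (D \<omega>))) + (\<integral>\<^sup>+t. ennreal (sq_norm (bayes (D \<omega>) - W \<omega> *\<^sub>v t)) \<partial>\<kappa> (D \<omega>))"
      unfolding bayes_D using carriers(4)[of \<omega>] by (intro posterior_pythagoras) auto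
  qed
  also have "\<dots> = msq (\<lambda>\<omega>. g (D \<omega>) - bayes (D \<omega>)) +
      (\<integral>\<^sup>+\<omega>. \<integral>\<^sup>+t. ennreal (sq_norm (bayes (D \<omega>) - W \<omega> *\<^sub>v t)) \<partial>\<kappa> (D \<omega>) \<partial>M)"
  proof (rule nn_integral_add)
    show "(\<lambda>\<omega>. ennreal (sq_norm (g (D \<omega>) - bayes (D \<omega>)))) \<in> borel_measurable M"
      by (intro measurable_compose[OF _ measurable_ennreal] measurable_sq_norm[where m = p] measurable_minus_vec
          measurable_compose[OF measurable_D g] measurable_compose[OF measurable_D measurable_bayes])
    show "(\<lambda>\<omega>. \<integral>\<^sup>+t. ennreal (sq_norm (bayes (D \<omega>) - W \<omega> *\<^sub>v t)) \<partial>\<kappa> (D \<omega>)) \<in> borel_measurable M"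
      using measurable_posterior_integral[OF meas[OF measurable_bayes]] by (simp add: D_def)
  qed
  also have "(\<integral>\<^sup>+\<omega>. \<integral>\<^sup>+t. ennreal (sq_norm (bayes (D \<omega>) - W \<omega> *\<^sub>v t)) \<partial>\<kappa> (D \<omega>) \<partial>M) =
      msq (\<lambda>\<omega>. bayes (D \<omega>) - \<eta> \<omega>)"
    by (rule dis[OF measurable_bayes, symmetric])
  finally show ?thesis .
qed

text \<open>
  Both \<open>bayes (D \<omega>)\<close> and \<open>C \<omega>\<close> split the error \<open>g (D \<omega>) - \<eta> \<omega>\<close> orthogonally; comparing the two
  decompositions leaves \<open>bayes (D \<omega>)\<close> at least as close to \<open>g (D \<omega>)\<close> as \<open>C \<omega>\<close>.
\<close>

lemma bayes_distance_le:
  assumes n: "0 < n" and \<tau>: "0 < \<tau>" and g: "g \<in> data \<rightarrow>\<^sub>M borel_vec p"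
  shows "msq (\<lambda>\<omega>. g (D \<omega>) - bayes (D \<omega>)) \<le> msq (\<lambda>\<omega>. g (D \<omega>) - C \<omega>)"
proof -
  let ?y = "\<integral>\<^sup>+\<omega>. ennreal (sq_norm (C \<omega> - \<eta> \<omega>)) \<partial>M"
  have "msq (\<lambda>\<omega>. 0\<^sub>v p - \<eta> \<omega>) = (\<integral>\<^sup>+\<omega>. ennreal (1 * sq_norm (\<eta> \<omega>)) \<partial>M)"
    by (intro nn_integral_cong) (use carriers(6) in \<open>auto simp: sq_norm_sum\<close>)
  also have "\<dots> = ennreal (real p * \<tau>\<^sup>2) * (\<integral>\<^sup>+\<omega>. ennreal 1 \<partial>M)"
    by (rule signal_sq_norm) simp_all
  also have "\<dots> < \<infinity>" by (simp add: emeasure_space_1)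
  \<comment> \<open>The cancellation at the end needs a finite error of \<open>C\<close>. It is part
    of the error of the zero estimator, which is \<open>p \<tau>\<^sup>2\<close>.\<close>
  finally have fin: "?y \<noteq> \<infinity>"
    using center_pythagoras[OF n \<tau>, of "\<lambda>_. 0\<^sub>v p"] by (auto simp: add_top)
  \<comment> \<open>With \<open>bayes\<close> in the role of \<open>g\<close>,
    \<open>center_pythagoras\<close> shows that \<open>C\<close>, which knows \<open>q\<close>, has
    at most the error of \<open>bayes\<close>.\<close>
  have "msq (\<lambda>\<omega>. g (D \<omega>) - bayes (D \<omega>)) + ?y \<le>
      msq (\<lambda>\<omega>. g (D \<omega>) - bayes (D \<omega>)) + msq (\<lambda>\<omega>. bayes (D \<omega>) - \<eta> \<omega>)"
    unfolding center_pythagoras[OF n \<tau> measurable_bayes] by (intro add_left_mono) simp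
  also have "\<dots> = msq (\<lambda>\<omega>. g (D \<omega>) - C \<omega>) + ?y"
    using bayes_pythagoras[OF g] center_pythagoras[OF n \<tau> g] by simp
  finally show ?thesis
    using fin by (simp add: add.commute[of _ ?y] ennreal_add_left_cancel_le)
qed

lemma ridge_bayes_distance:
  assumes n: "0 < n" and \<tau>: "0 < \<tau>" and l: "0 < l"
  shows "msq (\<lambda>\<omega>. ridge l n p (X \<omega>) (W \<omega>) (Y \<omega>) - bayes (D \<omega>)) \<le>
    ennreal (real p * \<tau>\<^sup>2 / l\<^sup>2 * (8 * (real d + real p) / (real n)\<^sup>2 + 2 * (((real d - real p) * \<tau>\<^sup>2 + \<sigma>\<^sup>2) / (real n * \<tau>\<^sup>2) - l)\<^sup>2))"
proof -
  define g where "g z = ridge_sol l n p (fst z) (snd (snd z))" for z :: "real mat \<times> real mat \<times> real vec"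
  have g: "g \<in> data \<rightarrow>\<^sub>M borel_vec p" unfolding g_def by measurable
  have "msq (\<lambda>\<omega>. ridge l n p (X \<omega>) (W \<omega>) (Y \<omega>) - bayes (D \<omega>)) =
      msq (\<lambda>\<omega>. g (D \<omega>) - bayes (D \<omega>))"
    using ridge_eq_ridge_sol[OF l carriers(1,4,5)] by (intro nn_integral_cong) (simp add: g_def D_def)
  also have "\<dots> \<le> msq (\<lambda>\<omega>. g (D \<omega>) - C \<omega>)"
    by (rule bayes_distance_le[OF n \<tau> g])
  also have "\<dots> \<le> ennreal (real p * \<tau>\<^sup>2 / l\<^sup>2 * (8 * (real d + real p) / (real n)\<^sup>2 + 2 * (((real d - real p) * \<tau>\<^sup>2 + \<sigma>\<^sup>2) / (real n * \<tau>\<^sup>2) - l)\<^sup>2))"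
    using ridge_center_distance[OF n \<tau> l] by (simp add: g_def D_def)
  finally show ?thesis .
qed

text \<open>The last conjunct translates distance from \<open>\<beta>opt\<close> into excess
  posterior risk, the sense in which ridge is asymptotically optimal.\<close>

lemma AE_beta_opt:
  "AE \<omega> in M. (\<exists>!b. is_arg_min (posterior_risk \<sigma> d (W \<omega>) (\<kappa> (D \<omega>))) (\<lambda>b. b \<in> carrier_vec p) b) \<and>
     beta_opt \<sigma> d p (W \<omega>) (\<kappa> (D \<omega>)) = bayes (D \<omega>) \<and>
     (\<forall>b\<in>carrier_vec p. posterior_risk \<sigma> d (W \<omega>) (\<kappa> (D \<omega>)) b -
        posterior_risk \<sigma> d (W \<omega>) (\<kappa> (D \<omega>)) (bayes (D \<omega>)) = sq_norm (b - bayes (D \<omega>)))"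
  using AE_posterior
proof eventually_elim
  fix \<omega> assume *: "\<omega> \<in> space M \<and> W \<omega> * (W \<omega>)\<^sup>T = 1\<^sub>m p \<and> prob_space (\<kappa> (D \<omega>)) \<and>
    sets (\<kappa> (D \<omega>)) = sets (borel_vec d) \<and> integrable (\<kappa> (D \<omega>)) sq_norm"
  then have w: "W \<omega> \<in> carrier_mat p d" and A: "prob_space (\<kappa> (D \<omega>))" "sets (\<kappa> (D \<omega>)) = sets (borel_vec d)"
    "integrable (\<kappa> (D \<omega>)) sq_norm" "W \<omega> * (W \<omega>)\<^sup>T = 1\<^sub>m p" using carriers(4)[of \<omega>] by auto
  note arg_min = posterior_risk_arg_min[OF A(1-3) w A(4) \<sigma>0]
  have b: "bayes (D \<omega>) \<in> carrier_vec p" using w by (simp add: bayes_D posterior_mean_def)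
  have "sq_norm (bayes (D \<omega>) - bayes (D \<omega>)) = 0" using b by (simp add: sq_norm_eq_0_iff[of _ p])
  then show "(\<exists>!b. is_arg_min (posterior_risk \<sigma> d (W \<omega>) (\<kappa> (D \<omega>))) (\<lambda>b. b \<in> carrier_vec p) b) \<and>
     beta_opt \<sigma> d p (W \<omega>) (\<kappa> (D \<omega>)) = bayes (D \<omega>) \<and>
     (\<forall>b\<in>carrier_vec p. posterior_risk \<sigma> d (W \<omega>) (\<kappa> (D \<omega>)) b -
        posterior_risk \<sigma> d (W \<omega>) (\<kappa> (D \<omega>)) (bayes (D \<omega>)) = sq_norm (b - bayes (D \<omega>)))"
    using arg_min beta_opt_eq[OF A(1-3) w A(4) \<sigma>0] posterior_risk_eq[OF A(1-3) w A(4) \<sigma>0] b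
    by (simp add: bayes_D)
qed

end

text \<open>The fluctuation term is a convergent sequence divided by \<open>d\<close>; the bias
  tends to 0 exactly by the choice of \<open>l\<close>.\<close>

lemma bound_tendsto:
  fixes p n :: "nat \<Rightarrow> nat"
  assumes \<alpha>: "\<alpha> > 0" and p: "\<And>d. p d \<le> d"
    and \<pi>: "(\<lambda>d. real (p d) / real d) \<longlonglongrightarrow> \<pi>" and \<delta>: "(\<lambda>d. real d / real (n d)) \<longlonglongrightarrow> \<delta>"
    and l: "l = \<delta> * (1 - \<pi> + \<sigma>\<^sup>2 / \<alpha>\<^sup>2)"
  shows "(\<lambda>d. \<alpha>\<^sup>2 / l\<^sup>2 * (16 * ((real d / real (n d))\<^sup>2 / real d) +
     2 * (real d / real (n d) * (1 - real (p d) / real d + \<sigma>\<^sup>2 / \<alpha>\<^sup>2) - l)\<^sup>2)) \<longlonglongrightarrow> 0"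
proof -
  have "(\<lambda>d. \<alpha>\<^sup>2 / l\<^sup>2 * (16 * ((real d / real (n d))\<^sup>2 * inverse (real d)) +
     2 * (real d / real (n d) * (1 - real (p d) / real d + \<sigma>\<^sup>2 / \<alpha>\<^sup>2) - l)\<^sup>2))
    \<longlonglongrightarrow> \<alpha>\<^sup>2 / l\<^sup>2 * (16 * (\<delta>\<^sup>2 * 0) + 2 * (\<delta> * (1 - \<pi> + \<sigma>\<^sup>2 / \<alpha>\<^sup>2) - l)\<^sup>2)"
    by (intro tendsto_intros \<pi> \<delta> lim_inverse_n)
  then show ?thesis by (simp add: l divide_inverse)
qed

text \<open>The expectations are nonnegative integrals, so convergence to 0 includes that they are
  finite for large \<open>d\<close>. The last limit makes asymptotic optimality precise; its
  integrand is almost surely a squared norm, so \<open>ennreal\<close> truncates nothing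
  there.\<close>

theorem theorem8:
  fixes \<alpha> \<sigma> \<pi> \<delta> lam :: real
    and p n :: "nat \<Rightarrow> nat"
    and M :: "nat \<Rightarrow> 'w measure"
    and X W :: "nat \<Rightarrow> 'w \<Rightarrow> real mat"
    and \<theta> \<E> Y \<beta>opt \<beta>hat :: "nat \<Rightarrow> 'w \<Rightarrow> real vec"
    and D :: "nat \<Rightarrow> 'w \<Rightarrow> real mat \<times> real mat \<times> real vec"
    and post :: "nat \<Rightarrow> real mat \<times> real mat \<times> real vec \<Rightarrow> real vec measure"
  assumes "\<alpha> > 0" and "\<sigma> \<ge> 0"
    and "\<And>d. p d \<le> d"
    and "(\<lambda>d. real (p d) / real d) \<longlonglongrightarrow> \<pi>" and "0 < \<pi>" and "\<pi> \<le> 1"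
    and "(\<lambda>d. real d / real (n d)) \<longlonglongrightarrow> \<delta>" and "0 < \<delta>"
    and "\<not> (\<pi> = 1 \<and> \<sigma> = 0)"
    and "\<And>d. prob_space (M d)"
    and "\<And>d. X d \<in> M d \<rightarrow>\<^sub>M borel_mat (n d) d"
    and "\<And>d. \<theta> d \<in> M d \<rightarrow>\<^sub>M borel_vec d"
    and "\<And>d. \<E> d \<in> M d \<rightarrow>\<^sub>M borel_vec (n d)"
    and "\<And>d. W d \<in> M d \<rightarrow>\<^sub>M borel_mat (p d) d"
    and "\<And>d. distr (M d) (borel_mat (n d) d) (X d) = gauss_mat 1 (n d) d"
    and "\<And>d. distr (M d) (borel_vec d) (\<theta> d) = gauss_vec (\<alpha> / sqrt (real d)) d"
    and "\<And>d. distr (M d) (borel_vec (n d)) (\<E> d) = gauss_vec \<sigma> (n d)"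
    and "\<And>d. uniform_stiefel (p d) d (distr (M d) (borel_mat (p d) d) (W d))"
    and "\<And>d. prob_space.indep_sets (M d)
           (\<lambda>i. [sets (vimage_algebra (space (M d)) (X d) (borel_mat (n d) d)),
                 sets (vimage_algebra (space (M d)) (\<theta> d) (borel_vec d)),
                 sets (vimage_algebra (space (M d)) (\<E> d) (borel_vec (n d))),
                 sets (vimage_algebra (space (M d)) (W d) (borel_mat (p d) d))] ! i) {..<4}"
    and "\<And>d \<omega>. Y d \<omega> = X d \<omega> *\<^sub>v \<theta> d \<omega> + \<E> d \<omega>"
    and "\<And>d \<omega>. D d \<omega> = (X d \<omega> * (W d \<omega>)\<^sup>T, W d \<omega>, Y d \<omega>)"
    and "\<And>d. posterior_dist (M d)
           (borel_mat (n d) (p d) \<Otimes>\<^sub>M borel_mat (p d) d \<Otimes>\<^sub>M borel_vec (n d)) (D d)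
           (borel_vec d) (\<theta> d) (post d)"
    and "\<And>d \<omega>. \<beta>opt d \<omega> = beta_opt \<sigma> d (p d) (W d \<omega>) (post d (D d \<omega>))"
    and "lam = \<delta> * (1 - \<pi> + \<sigma>\<^sup>2 / \<alpha>\<^sup>2)"
    and "\<And>d \<omega>. \<beta>hat d \<omega> = ridge lam (n d) (p d) (X d \<omega>) (W d \<omega>) (Y d \<omega>)"
  shows "(\<forall>d. AE \<omega> in M d.
            (\<exists>!b. is_arg_min (posterior_risk \<sigma> d (W d \<omega>) (post d (D d \<omega>)))
                    (\<lambda>b. b \<in> carrier_vec (p d)) b) \<and>
            \<beta>opt d \<omega> = W d \<omega> *\<^sub>v posterior_mean d (post d (D d \<omega>))) \<and>
         (\<lambda>d. \<integral>\<^sup>+\<omega>. ennreal (sq_norm (\<beta>hat d \<omega> - \<beta>opt d \<omega>)) \<partial>M d) \<longlonglongrightarrow> 0 \<and>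
         (\<lambda>d. \<integral>\<^sup>+\<omega>. ennreal (posterior_risk \<sigma> d (W d \<omega>) (post d (D d \<omega>)) (\<beta>hat d \<omega>)
                           - posterior_risk \<sigma> d (W d \<omega>) (post d (D d \<omega>)) (\<beta>opt d \<omega>)) \<partial>M d) \<longlonglongrightarrow> 0"
proof -
  let ?R = "\<lambda>d \<omega>. posterior_risk \<sigma> d (W d \<omega>) (post d (D d \<omega>))"
  note \<alpha> = assms(1) and \<sigma> = assms(2) and pd = assms(3) and \<pi>lim = assms(4) and \<delta>lim = assms(7)
  \<comment> \<open>For \<open>d = 0\<close> the quotient is 0, which the locale admits by asking
    only \<open>0 \<le> \<tau>\<close>.\<close>
  define \<tau> where "\<tau> d = \<alpha> / sqrt (real d)" for d :: nat
  have model: "ridge_model (M d) (n d) (p d) d (\<tau> d) \<sigma> (X d) (W d) (\<theta> d) (\<E> d)" for d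
    unfolding \<tau>_def using \<alpha> \<sigma> assms(10-19)[of d]
    by (intro ridge_model.intro ridge_model_axioms.intro) (auto simp: uniform_stiefel_def)
  have Y_eq: "ridge_model.Y (X d) (\<theta> d) (\<E> d) = Y d" for d
    by (rule ext) (simp add: ridge_model.Y_def[OF model] assms(20))
  have D_eq: "ridge_model.D (X d) (W d) (\<theta> d) (\<E> d) = D d" for d
    by (rule ext) (simp add: ridge_model.D_def[OF model] Y_eq assms(21))
  have post: "ridge_posterior (M d) (n d) (p d) d (\<tau> d) \<sigma> (X d) (W d) (\<theta> d) (\<E> d) (post d)" for d
    using assms(22)[of d] by (intro ridge_posterior.intro ridge_posterior_axioms.intro model) (simp add: D_eq)
  define bayes where "bayes d \<omega> = W d \<omega> *\<^sub>v posterior_mean d (post d (D d \<omega>))" for d \<omega>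
  have bayes_eq: "ridge_posterior.bayes d (post d) (D d \<omega>) = bayes d \<omega>" for d \<omega>
    using ridge_posterior.bayes_D[OF post, of d \<omega>] by (simp add: D_eq bayes_def)
  have opt: "AE \<omega> in M d. (\<exists>!b. is_arg_min (?R d \<omega>) (\<lambda>b. b \<in> carrier_vec (p d)) b) \<and>
     \<beta>opt d \<omega> = bayes d \<omega> \<and>
     (\<forall>b\<in>carrier_vec (p d). ?R d \<omega> b -
        ?R d \<omega> (bayes d \<omega>) = sq_norm (b - bayes d \<omega>))" for d
    using ridge_posterior.AE_beta_opt[OF post, of d] unfolding D_eq bayes_eq assms(23) .
  \<comment> \<open>The exclusion of \<open>\<pi> = 1\<close> with \<open>\<sigma> = 0\<close>
    enters here: it makes the limiting penalty positive.\<close>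
  have "1 - \<pi> + \<sigma>\<^sup>2 / \<alpha>\<^sup>2 > 0"
  proof (cases "\<sigma> = 0")
    case True
    then show ?thesis using assms(6,9) by simp
  next
    case False
    then have "\<sigma>\<^sup>2 / \<alpha>\<^sup>2 > 0" using \<alpha> by simp
    then show ?thesis using assms(6) by linarith
  qed
  then have lam: "lam > 0" using assms(8) by (simp add: assms(24))
  \<comment> \<open>The bound of \<open>ridge_bayes_distance\<close> with
    \<open>\<tau>\<^sup>2 = \<alpha>\<^sup>2 / d\<close> inserted and \<open>p \<le> d\<close> used
    twice: \<open>p \<tau>\<^sup>2\<close> is at most \<open>\<alpha>\<^sup>2\<close>, and 8 (d + p)
    at most 16 d.\<close>
  define f where "f d = \<alpha>\<^sup>2 / lam\<^sup>2 * (16 * ((real d / real (n d))\<^sup>2 / real d) +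
     2 * (real d / real (n d) * (1 - real (p d) / real d + \<sigma>\<^sup>2 / \<alpha>\<^sup>2) - lam)\<^sup>2)" for d
  have f_lim: "f \<longlonglongrightarrow> 0"
    unfolding f_def by (rule bound_tendsto[OF \<alpha> pd \<pi>lim \<delta>lim assms(24)])
  \<comment> \<open>Division by 0 gives 0, so the positive limit forces \<open>n d > 0\<close> for
    all large \<open>d\<close>.\<close>
  have ev: "\<forall>\<^sub>F d in sequentially. 0 < real d / real (n d)"
    using order_tendstoD(1)[OF \<delta>lim assms(8)] .
  have bound: "(\<integral>\<^sup>+\<omega>. ennreal (sq_norm (\<beta>hat d \<omega> - bayes d \<omega>)) \<partial>M d) \<le> ennreal (f d)"
    if pos: "0 < real d / real (n d)" for d
  proof -
    have d: "d > 0" and n: "n d > 0" using pos by (auto simp: zero_less_divide_iff)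
    have \<tau>: "\<tau> d > 0" using \<alpha> d by (simp add: \<tau>_def)
    have \<tau>2: "(\<tau> d)\<^sup>2 = \<alpha>\<^sup>2 / real d" by (simp add: \<tau>_def power_divide)
    have e: "((real d - real (p d)) * (\<tau> d)\<^sup>2 + \<sigma>\<^sup>2) / (real (n d) * (\<tau> d)\<^sup>2) =
        real d / real (n d) * (1 - real (p d) / real d + \<sigma>\<^sup>2 / \<alpha>\<^sup>2)"
      unfolding \<tau>2 using d n \<alpha> by (simp add: field_simps)
    have pp: "real (p d) \<le> real d" using pd[of d] by simp
    have "real (p d) * (\<tau> d)\<^sup>2 / lam\<^sup>2 * (8 * (real d + real (p d)) / (real (n d))\<^sup>2 +
        2 * (((real d - real (p d)) * (\<tau> d)\<^sup>2 + \<sigma>\<^sup>2) / (real (n d) * (\<tau> d)\<^sup>2) - lam)\<^sup>2) \<le> f d"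
      unfolding e f_def
    proof (rule mult_mono)
      show "real (p d) * (\<tau> d)\<^sup>2 / lam\<^sup>2 \<le> \<alpha>\<^sup>2 / lam\<^sup>2"
        unfolding \<tau>2 using d pp by (intro divide_right_mono) (simp_all add: field_simps mult_right_mono)
      have "8 * (real d + real (p d)) / (real (n d))\<^sup>2 \<le> 16 * real d / (real (n d))\<^sup>2"
        using pp by (intro divide_right_mono) simp_all
      also have "\<dots> = 16 * ((real d / real (n d))\<^sup>2 / real d)"
        using d by (simp add: power_divide power2_eq_square)
      finally show "8 * (real d + real (p d)) / (real (n d))\<^sup>2 +
          2 * (real d / real (n d) * (1 - real (p d) / real d + \<sigma>\<^sup>2 / \<alpha>\<^sup>2) - lam)\<^sup>2 \<le>
          16 * ((real d / real (n d))\<^sup>2 / real d) +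
          2 * (real d / real (n d) * (1 - real (p d) / real d + \<sigma>\<^sup>2 / \<alpha>\<^sup>2) - lam)\<^sup>2" by simp
    qed simp_all
    then have "ennreal (real (p d) * (\<tau> d)\<^sup>2 / lam\<^sup>2 * (8 * (real d + real (p d)) / (real (n d))\<^sup>2 +
        2 * (((real d - real (p d)) * (\<tau> d)\<^sup>2 + \<sigma>\<^sup>2) / (real (n d) * (\<tau> d)\<^sup>2) - lam)\<^sup>2)) \<le> ennreal (f d)"
      by (rule ennreal_leI)
    with ridge_posterior.ridge_bayes_distance[OF post n \<tau> lam]
    show ?thesis unfolding D_eq Y_eq bayes_eq assms(25) by (rule order_trans)
  qed
  have lim: "(\<lambda>d. \<integral>\<^sup>+\<omega>. ennreal (sq_norm (\<beta>hat d \<omega> - bayes d \<omega>)) \<partial>M d) \<longlonglongrightarrow> 0"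
  proof (rule tendsto_sandwich[where f = "\<lambda>_. 0" and h = "\<lambda>d. ennreal (f d)"])
    show "(\<lambda>d. ennreal (f d)) \<longlonglongrightarrow> 0" using tendsto_ennrealI[OF f_lim] by simp
    show "\<forall>\<^sub>F d in sequentially. (\<integral>\<^sup>+\<omega>. ennreal (sq_norm (\<beta>hat d \<omega> - bayes d \<omega>)) \<partial>M d) \<le> ennreal (f d)"
      using ev by eventually_elim (rule bound)
  qed simp_all
  have dist: "(\<integral>\<^sup>+\<omega>. ennreal (sq_norm (\<beta>hat d \<omega> - \<beta>opt d \<omega>)) \<partial>M d) =
      (\<integral>\<^sup>+\<omega>. ennreal (sq_norm (\<beta>hat d \<omega> - bayes d \<omega>)) \<partial>M d)" for d
    using opt[of d] by (intro nn_integral_cong_AE, eventually_elim) simp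
  have risk: "(\<integral>\<^sup>+\<omega>. ennreal (?R d \<omega> (\<beta>hat d \<omega>)
        - ?R d \<omega> (\<beta>opt d \<omega>)) \<partial>M d) =
      (\<integral>\<^sup>+\<omega>. ennreal (sq_norm (\<beta>hat d \<omega> - bayes d \<omega>)) \<partial>M d)" for d
    using opt[of d] AE_space[of "M d"]
  proof (intro nn_integral_cong_AE, eventually_elim)
    fix \<omega>
    assume *: "(\<exists>!b. is_arg_min (?R d \<omega>) (\<lambda>b. b \<in> carrier_vec (p d)) b) \<and>
     \<beta>opt d \<omega> = bayes d \<omega> \<and>
     (\<forall>b\<in>carrier_vec (p d). ?R d \<omega> b -
        ?R d \<omega> (bayes d \<omega>) = sq_norm (b - bayes d \<omega>))"
      and \<omega>: "\<omega> \<in> space (M d)"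
    note c = ridge_model.carriers[OF model \<omega>, unfolded Y_eq]
    \<comment> \<open>The identity for the excess risk holds for vectors of dimension
      \<open>p d\<close>, so the dimension of the ridge estimator has to be established.\<close>
    have "\<beta>hat d \<omega> \<in> carrier_vec (p d)"
      unfolding assms(25) ridge_eq_ridge_sol[OF lam c(1,4,5)] by (rule ridge_sol_carrier[OF c(7) lam c(5)])
    then show "ennreal (?R d \<omega> (\<beta>hat d \<omega>)
        - ?R d \<omega> (\<beta>opt d \<omega>)) = ennreal (sq_norm (\<beta>hat d \<omega> - bayes d \<omega>))"
      using * by simp
  qed
  have "\<forall>d. AE \<omega> in M d. (\<exists>!b. is_arg_min (?R d \<omega>) (\<lambda>b. b \<in> carrier_vec (p d)) b) \<and>
      \<beta>opt d \<omega> = W d \<omega> *\<^sub>v posterior_mean d (post d (D d \<omega>))"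
  proof
    show "AE \<omega> in M d. (\<exists>!b. is_arg_min (?R d \<omega>) (\<lambda>b. b \<in> carrier_vec (p d)) b) \<and>
      \<beta>opt d \<omega> = W d \<omega> *\<^sub>v posterior_mean d (post d (D d \<omega>))" for d
      using opt[of d] by eventually_elim (simp add: bayes_def)
  qed
  with lim show ?thesis unfolding dist risk by blast
qed

end
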